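(* Let $a>0$ and $f\in L^2(\mathbf R^m,\mathbf C^{(m)})$. Then $f$ is the restriction to $\mathbf R^m=\{x_0=0\}$ of a function in $H^2(S_a,\mathbf C^{(m)})$ if and only if there exists a measurable $\mathbf C^{(m)}$-valued function $g$ on $\mathbf R^m$ such that $e^{a|\underline\xi|}g(\underline\xi)\in L^2(\mathbf R^m,\mathbf C^{(m)})$ and the extension of $f$ is given by $$f(x)=\frac{1}{(2\pi)^m}\int_{\mathbf R^m}e(x,\underline\xi)\,g(\underline\xi)\,d\underline\xi,\qquad x\in S_a;$$ in this case $g=\mathcal F(f)$. Moreover, for such $f$ (extended to $S_a$) there exist $f_+\in H^2(\mathbf R^{m+1}_{+,-a},\mathbf C^{(m)})$ and $f_-\in H^2(\mathbf R^{m+1}_{-,a},\mathbf C^{(m)})$ such that $f(x)=f_+(x)+f_-(x)$ for $x\in S_a$, and this decomposition is unique; thus $H^2(S_a,\mathbf C^{(m)})=H^2(\mathbf R^{m+1}_{+,-a},\mathbf C^{(m)})\oplus H^2(\mathbf R^{m+1}_{-,a},\mathbf C^{(m)})$.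
   Context: $\mathbf C^{(m)}$ is the complex Clifford algebra generated by $\mathbf e_1,\dots,\mathbf e_m$ with $\mathbf e_j\mathbf e_k+\mathbf e_k\mathbf e_j=-2\delta_{jk}$ and unit $\mathbf e_0=1$; an element $x=\sum_T x_T\mathbf e_T$ has norm $|x|=(\sum_T|x_T|^2)^{1/2}$. Points of $\mathbf R^{m+1}$ are written $x=x_0+\underline x$, $\underline x=x_1\mathbf e_1+\dots+x_m\mathbf e_m\in\mathbf R^m$. A $\mathbf C^{(m)}$-valued $C^1$ function $F$ on an open set $\Omega\subset\mathbf R^{m+1}$ is left-monogenic if $\sum_{k=0}^m\mathbf e_k\partial F/\partial x_k=0$ in $\Omega$. The Fourier transform is $\mathcal F(f)(\underline\xi)=\int_{\mathbf R^m}e^{-i\langle\underline x,\underline\xi\rangle}f(\underline x)d\underline x$, applied componentwise and extended to $L^2$. For $\underline\xi\in\mathbf R^m\setminus\{0\}$: $\chi_\pm(\underline\xi)=\frac12(1\pm i\underline\xi/|\underline\xi|)$, $e^\pm(x,\underline\xi)=e^{i\langle\underline x,\underline\xi\rangle}e^{\mp x_0|\underline\xi|}\chi_\pm(\underline\xi)$, $e(x,\underline\xi)=e^+(x,\underline\xi)+e^-(x,\underline\xi)$. Domains: $S_a=\{x: |x_0|<a\}$, $\mathbf R^{m+1}_{+,-a}=\{x: x_0>-a\}$, $\mathbf R^{m+1}_{-,a}=\{x:x_0<a\}$. For such a domain $\Omega$ and $1\le p<\infty$, $H^p(\Omega,\mathbf C^{(m)})$ is the space of left-monogenic $F$ on $\Omega$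 with $\sup_{x_0}\int_{\mathbf R^m}|F(x_0+\underline x)|^p d\underline x<\infty$, the supremum over those $x_0$ with $x_0+\underline x\in\Omega$. *)

theory Defs
  imports "HOL-Analysis.Analysis"
begin

text \<open>Complex Clifford algebra C^(m). The generators are indexed by a finite linearly
ordered type 'm (so m = CARD('m)); an element is a family of complex coefficients x_T
indexed by the subsets T of 'm. The norm of the vec type is the l2 norm of the coefficients,
which is exactly |x| of the paper.\<close>

type_synonym 'm clif = "(complex, 'm set) vec"

definition clif_sign :: "'m::linorder set \<Rightarrow> 'm set \<Rightarrow> complex" where
  "clif_sign S T = (-1) ^ (card {(s,t). s \<in> S \<and> t \<in> T \<and> t < s} + card (S \<inter> T))"

text \<open>e_S e_T = sign(S,T) e_(S symmetric-difference T), with e_j e_k + e_k e_j = -2 delta_jk.\<close>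
definition clif_mult :: "'m::{finite,linorder} clif \<Rightarrow> 'm clif \<Rightarrow> 'm clif" where
  "clif_mult x y = (\<chi> U. \<Sum>S\<in>UNIV. \<Sum>T\<in>UNIV.
      if (S - T) \<union> (T - S) = U then clif_sign S T * (x $ S) * (y $ T) else 0)"

definition clif_one :: "'m::finite clif" where
  "clif_one = (\<chi> T. if T = {} then 1 else 0)"

definition clif_gen :: "'m::finite \<Rightarrow> 'm clif" where
  "clif_gen k = (\<chi> T. if T = {k} then 1 else 0)"

definition cscale :: "complex \<Rightarrow> 'm::finite clif \<Rightarrow> 'm clif" where
  "cscale c x = (\<chi> T. c * (x $ T))"

definition clif_vec :: "(real, 'm::finite) vec \<Rightarrow> 'm clif" where
  "clif_vec \<xi> = (\<Sum>k\<in>UNIV. (\<xi> $ k) *\<^sub>R clif_gen k)"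

definition chi_plus :: "(real, 'm::finite) vec \<Rightarrow> 'm clif" where
  "chi_plus \<xi> = cscale (1/2) (clif_one + cscale \<i> (inverse (norm \<xi>) *\<^sub>R clif_vec \<xi>))"

definition chi_minus :: "(real, 'm::finite) vec \<Rightarrow> 'm clif" where
  "chi_minus \<xi> = cscale (1/2) (clif_one - cscale \<i> (inverse (norm \<xi>) *\<^sub>R clif_vec \<xi>))"

text \<open>Points of R^(m+1) are pairs (x0, x) with x in R^m.
  e(x,xi) = e^+(x,xi) + e^-(x,xi).\<close>
definition ekern :: "real \<times> ((real, 'm::finite) vec) \<Rightarrow> (real, 'm) vec \<Rightarrow> 'm clif" where
  "ekern x \<xi> = cscale (exp (\<i> * complex_of_real (snd x \<bullet> \<xi>)))
      (exp (- fst x * norm \<xi>) *\<^sub>R chi_plus \<xi> + exp (fst x * norm \<xi>) *\<^sub>R chi_minus \<xi>)"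

definition cauchy_ext :: "((real, 'm::{finite,linorder}) vec \<Rightarrow> 'm clif) \<Rightarrow> real \<times> ((real, 'm) vec) \<Rightarrow> 'm clif" where
  "cauchy_ext g x = (1 / (2 * pi) ^ CARD('m)) *\<^sub>R (\<integral>\<xi>. clif_mult (ekern x \<xi>) (g \<xi>) \<partial>lborel)"

definition strip :: "real \<Rightarrow> (real \<times> ((real, 'm::finite) vec)) set" where
  "strip a = {x. \<bar>fst x\<bar> < a}"

definition halfplus :: "real \<Rightarrow> (real \<times> ((real, 'm::finite) vec)) set" where
  "halfplus a = {x. fst x > - a}"

definition halfminus :: "real \<Rightarrow> (real \<times> ((real, 'm::finite) vec)) set" where
  "halfminus a = {x. fst x < a}"

definition pd0 :: "(real \<times> ((real, 'm::finite) vec) \<Rightarrow> 'm clif) \<Rightarrow> real \<times> ((real, 'm) vec) \<Rightarrow> 'm clif" where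
  "pd0 F x = frechet_derivative F (at x) (1, 0)"

definition pdk :: "(real \<times> ((real, 'm::finite) vec) \<Rightarrow> 'm clif) \<Rightarrow> 'm \<Rightarrow> real \<times> ((real, 'm) vec) \<Rightarrow> 'm clif" where
  "pdk F k x = frechet_derivative F (at x) (0, axis k 1)"

definition left_monogenic :: "(real \<times> ((real, 'm::{finite,linorder}) vec)) set \<Rightarrow> (real \<times> ((real, 'm) vec) \<Rightarrow> 'm clif) \<Rightarrow> bool" where
  "left_monogenic \<Omega> F \<longleftrightarrow> open \<Omega> \<and>
     (\<forall>x\<in>\<Omega>. F differentiable (at x)) \<and>
     continuous_on \<Omega> (pd0 F) \<and> (\<forall>k. continuous_on \<Omega> (pdk F k)) \<and>
     (\<forall>x\<in>\<Omega>. pd0 F x + (\<Sum>k\<in>UNIV. clif_mult (clif_gen k) (pdk F k x)) = 0)"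

definition H2 :: "(real \<times> ((real, 'm::{finite,linorder}) vec)) set \<Rightarrow> (real \<times> ((real, 'm) vec) \<Rightarrow> 'm clif) \<Rightarrow> bool" where
  "H2 \<Omega> F \<longleftrightarrow> left_monogenic \<Omega> F \<and>
     (SUP x0\<in>fst ` \<Omega>. \<integral>\<^sup>+ y. ennreal ((norm (F (x0, y)))\<^sup>2) \<partial>lborel) < \<infinity>"

definition L2fun :: "((real, 'm::finite) vec \<Rightarrow> 'm clif) \<Rightarrow> bool" where
  "L2fun f \<longleftrightarrow> f \<in> borel_measurable lborel \<and>
     (\<integral>\<^sup>+ x. ennreal ((norm (f x))\<^sup>2) \<partial>lborel) < \<infinity>"

definition fourier_trunc :: "((real, 'm::finite) vec \<Rightarrow> 'm clif) \<Rightarrow> real \<Rightarrow> (real, 'm) vec \<Rightarrow> 'm clif" where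
  "fourier_trunc f R \<xi> = (\<integral>x. indicator (cball 0 R) x *\<^sub>R
      cscale (exp (- \<i> * complex_of_real (x \<bullet> \<xi>))) (f x) \<partial>lborel)"

definition is_fourier_L2 :: "((real, 'm::finite) vec \<Rightarrow> 'm clif) \<Rightarrow> ((real, 'm) vec \<Rightarrow> 'm clif) \<Rightarrow> bool" where
  "is_fourier_L2 f g \<longleftrightarrow> L2fun g \<and>
     ((\<lambda>R. \<integral>\<^sup>+ \<xi>. ennreal ((norm (g \<xi> - fourier_trunc f R \<xi>))\<^sup>2) \<partial>lborel) \<longlongrightarrow> 0) at_top"

end

theory Submission
  imports Defs "HOL-Probability.Characteristic_Functions"
begin

text \<open>
Let F be in the Hardy space of the strip and let g(t) be the Fourier transform of the slice of
F at height t. The monogenic equation becomes g' = - i xi g, and since left multiplication by i xi is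
self-adjoint with square |xi|^2, this gives g(t) = exp(- t i xi) g(0), where exp(- t i xi) has
eigenvalues exp(- t |xi|) on the range of chi_plus and exp(t |xi|) on that of chi_minus. Letting t tend
to a and to -a turns the uniform bound on the slices into square-integrability of exp(a |xi|) g(0), and
Fourier inversion gives the integral formula. The two spectral parts of g(0) extend to the two half
spaces. If a function extends to both half spaces then exp(b |xi|) g(0) is bounded in L2 for every b,
so it vanishes; this is uniqueness.

F is only known to be C1 with L2 slices, so the evolution equation is derived for slices multiplied by
a cutoff at radius R. This leaves a remainder of size O(1/R) in L2, which disappears in the limit.
Only the inequality in Plancherel's theorem is needed, and it is enough to have it on L1 Int L2.
\<close>

section \<open>Square-integrable functions\<close>

text \<open>Two features of the spectral picture shape the estimates. First, exp(- t i xi) grows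
  exponentially in xi, so the O(1/R) remainder cannot be carried through it in all of L2. The
  transforms of two slices are therefore compared only on balls |xi| <= K, by pairing with psi equal
  to their evolved difference on the ball; once R has been sent to infinity for fixed K, the balls
  exhaust the space. Second, a single height controls only one spectral part: for t > 0 the
  \<open>chi_plus\<close> part is damped. The heights t and - t are used together, which costs a
  factor sqrt 2 but bounds exp(a |xi|) g(0) independently of a, and this independence drives
  uniqueness.

  The inequality can replace the Plancherel identity because the inverse direction is always
  pointwise: slices are continuous, and square-integrability of exp(a |xi|) g(0) makes the transform
  of every interior slice integrable by Cauchy-Schwarz. Gaussian summability then recovers the
  values of a slice, and injectivity on L1 identifies any g in the integral formula with the
  transform of f.\<close>

definition L2 :: "('a::euclidean_space \<Rightarrow> 'b::euclidean_space) \<Rightarrow> bool" where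
  "L2 f \<longleftrightarrow> f \<in> borel_measurable borel \<and> integrable lborel (\<lambda>x. (norm (f x))\<^sup>2)"

definition l2 :: "('a::euclidean_space \<Rightarrow> 'b::euclidean_space) \<Rightarrow> real" where
  "l2 f = sqrt (\<integral>x. (norm (f x))\<^sup>2 \<partial>lborel)"

lemma L2_measurable [measurable_dest]: "L2 f \<Longrightarrow> f \<in> borel_measurable borel"
  by (simp add: L2_def)

lemma L2_integrable: "L2 f \<Longrightarrow> integrable lborel (\<lambda>x. (norm (f x))\<^sup>2)"
  by (simp add: L2_def)

lemma l2_nonneg [simp]: "0 \<le> l2 f"
  by (simp add: l2_def)

lemma l2_power2: "(l2 f)\<^sup>2 = (\<integral>x. (norm (f x))\<^sup>2 \<partial>lborel)"
  by (simp add: l2_def)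

lemma nn_integral_L2: "L2 f \<Longrightarrow> (\<integral>\<^sup>+x. ennreal ((norm (f x))\<^sup>2) \<partial>lborel) = ennreal ((l2 f)\<^sup>2)"
  by (simp add: l2_power2 L2_def nn_integral_eq_integral)

text \<open>Fatou's lemma and the Plancherel inequality produce bounds on extended integrals;
  membership in L2 and the norm bound are read off from them together.\<close>

lemma L2I_nn:
  assumes "f \<in> borel_measurable borel" "(\<integral>\<^sup>+x. ennreal ((norm (f x))\<^sup>2) \<partial>lborel) \<le> ennreal (C\<^sup>2)" "0 \<le> C"
  shows "L2 f" "l2 f \<le> C"
proof -
  have [measurable]: "f \<in> borel_measurable borel" by fact
  show L: "L2 f"
    unfolding L2_def integrable_iff_bounded using assms
    by (auto simp: order_le_less_trans)
  from assms have "ennreal ((l2 f)\<^sup>2) \<le> ennreal (C\<^sup>2)" by (simp add: nn_integral_L2[OF L])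
  then show "l2 f \<le> C" using \<open>0 \<le> C\<close> by (simp add: power2_le_iff_abs_le)
qed

lemma L2fun_iff_L2: "L2fun f \<longleftrightarrow> L2 f"
  by (auto simp: L2fun_def L2_def integrable_iff_bounded)

lemma L2_bound:
  assumes "L2 g" "f \<in> borel_measurable borel" "AE x in lborel. norm (f x) \<le> c * norm (g x)" "0 \<le> c"
  shows "L2 f" "l2 f \<le> c * l2 g"
proof -
  note [measurable] = assms(2) L2_measurable[OF assms(1)]
  have sq: "AE x in lborel. (norm (f x))\<^sup>2 \<le> c\<^sup>2 * (norm (g x))\<^sup>2"
    using assms(3) by eventually_elim (metis norm_ge_zero power_mono power_mult_distrib)
  show L: "L2 f"
    unfolding L2_def
  proof
    show "integrable lborel (\<lambda>x. (norm (f x))\<^sup>2)"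
      by (rule Bochner_Integration.integrable_bound[where f="\<lambda>x. c\<^sup>2 * (norm (g x))\<^sup>2"])
         (use L2_integrable[OF assms(1)] sq in auto)
  qed fact
  have "(l2 f)\<^sup>2 \<le> (\<integral>x. c\<^sup>2 * (norm (g x))\<^sup>2 \<partial>lborel)"
    unfolding l2_power2 using sq L2_integrable[OF L] L2_integrable[OF assms(1)]
    by (intro integral_mono_AE) auto
  also have "\<dots> = (c * l2 g)\<^sup>2" by (simp add: l2_power2 power_mult_distrib)
  finally show "l2 f \<le> c * l2 g" using \<open>0 \<le> c\<close> by (simp add: power2_le_iff_abs_le)
qed

lemma L2_scaleR: "L2 f \<Longrightarrow> L2 (\<lambda>x. c *\<^sub>R f x)"
  by (rule L2_bound(1)[where g=f and c="\<bar>c\<bar>"]) auto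

lemma L2_zero [simp]: "L2 (\<lambda>x. 0)"
  by (simp add: L2_def)

lemma l2_cong_AE:
  assumes "AE x in lborel. f x = g x" "f \<in> borel_measurable borel" "g \<in> borel_measurable borel"
  shows "l2 f = l2 g"
  unfolding l2_def using assms by (intro arg_cong[where f=sqrt] integral_cong_AE) auto

lemma L2_cong_AE:
  assumes "AE x in lborel. f x = g x" "L2 g" "f \<in> borel_measurable borel"
  shows "L2 f"
  by (rule L2_bound(1)[OF assms(2,3), where c=1]) (use assms in auto)

lemma L2_add:
  assumes "L2 f" "L2 g" shows "L2 (\<lambda>x. f x + g x)"
  unfolding L2_def
proof
  note [measurable] = L2_measurable[OF assms(1)] L2_measurable[OF assms(2)]
  show "(\<lambda>x. f x + g x) \<in> borel_measurable borel" by measurable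
  have "(norm (a + b))\<^sup>2 \<le> 2 * (norm a)\<^sup>2 + 2 * (norm b)\<^sup>2" for a b :: 'b
  proof -
    have "(norm (a + b))\<^sup>2 \<le> (norm a + norm b)\<^sup>2" by (simp add: norm_triangle_ineq power_mono)
    also have "\<dots> \<le> 2 * (norm a)\<^sup>2 + 2 * (norm b)\<^sup>2" using sum_squares_bound[of "norm a" "norm b"]
      by (simp add: power2_sum)
    finally show ?thesis .
  qed
  then show "integrable lborel (\<lambda>x. (norm (f x + g x))\<^sup>2)"
    by (intro Bochner_Integration.integrable_bound[where g="\<lambda>x. (norm (f x + g x))\<^sup>2" and
          f="\<lambda>x. 2 * (norm (f x))\<^sup>2 + 2 * (norm (g x))\<^sup>2"])
       (use L2_integrable[OF assms(1)] L2_integrable[OF assms(2)] in auto)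
qed

lemma L2_diff: "L2 f \<Longrightarrow> L2 g \<Longrightarrow> L2 (\<lambda>x. f x - g x)"
  using L2_add[of f "\<lambda>x. (-1) *\<^sub>R g x"] L2_scaleR[of g "-1"] by simp

lemma l2_minus_commute: "l2 (\<lambda>x. f x - g x) = l2 (\<lambda>x. g x - f x)"
  by (simp add: l2_def norm_minus_commute)

lemma L2_Cauchy_Schwarz:
  assumes "L2 f" "L2 g"
  shows "integrable lborel (\<lambda>x. norm (f x) * norm (g x))"
    and "(\<integral>x. norm (f x) * norm (g x) \<partial>lborel) \<le> l2 f * l2 g"
proof -
  note [measurable] = L2_measurable[OF assms(1)] L2_measurable[OF assms(2)]
  show I: "integrable lborel (\<lambda>x. norm (f x) * norm (g x))"
  proof (rule Bochner_Integration.integrable_bound[where f="\<lambda>x. (norm (f x))\<^sup>2 + (norm (g x))\<^sup>2"])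
    show "AE x in lborel. norm (norm (f x) * norm (g x)) \<le> norm ((norm (f x))\<^sup>2 + (norm (g x))\<^sup>2)"
    proof (rule AE_I2)
      fix x show "norm (norm (f x) * norm (g x)) \<le> norm ((norm (f x))\<^sup>2 + (norm (g x))\<^sup>2)"
        using sum_squares_bound[of "norm (f x)" "norm (g x)"] mult_nonneg_nonneg[of "norm (f x)" "norm (g x)"]
        by (auto simp del: mult_nonneg_nonneg)
    qed
  qed (use L2_integrable[OF assms(1)] L2_integrable[OF assms(2)] in auto)
  have "(\<integral>\<^sup>+x. ennreal (norm (f x)) * ennreal (norm (g x)) \<partial>lborel)\<^sup>2
      \<le> (\<integral>\<^sup>+x. (ennreal (norm (f x)))\<^sup>2 \<partial>lborel) * (\<integral>\<^sup>+x. (ennreal (norm (g x)))\<^sup>2 \<partial>lborel)"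
    by (rule Cauchy_Schwarz_nn_integral) auto
  then have "(\<integral>\<^sup>+x. ennreal (norm (f x) * norm (g x)) \<partial>lborel)\<^sup>2 \<le> ennreal ((l2 f)\<^sup>2) * ennreal ((l2 g)\<^sup>2)"
    by (simp add: ennreal_mult' ennreal_power nn_integral_L2[OF assms(1)] nn_integral_L2[OF assms(2)])
  then have "(ennreal (\<integral>x. norm (f x) * norm (g x) \<partial>lborel))\<^sup>2 \<le> ennreal ((l2 f * l2 g)\<^sup>2)"
    using nn_integral_eq_integral[OF I] by (simp add: ennreal_mult' power_mult_distrib)
  then have "(\<integral>x. norm (f x) * norm (g x) \<partial>lborel)\<^sup>2 \<le> (l2 f * l2 g)\<^sup>2"
    by (simp add: ennreal_power)
  then show "(\<integral>x. norm (f x) * norm (g x) \<partial>lborel) \<le> l2 f * l2 g"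
    by (rule power2_le_imp_le) simp
qed

text \<open>The product is abstract because this is applied to complex multiplication, to real
  scaling and to the real inner product of Clifford elements.\<close>

lemma L2_bilinear:
  fixes p :: "'b::euclidean_space \<Rightarrow> 'c::euclidean_space \<Rightarrow> 'd::euclidean_space"
  assumes "bounded_bilinear p" "\<And>a b. norm (p a b) \<le> norm a * norm b" "L2 f" "L2 g"
  shows "integrable lborel (\<lambda>x. p (f x) (g x))"
    and "norm (\<integral>x. p (f x) (g x) \<partial>lborel) \<le> l2 f * l2 g"
proof -
  note [measurable] = L2_measurable[OF assms(3)] L2_measurable[OF assms(4)]
  interpret bounded_bilinear p by fact
  have [measurable]: "(\<lambda>x. p (f x) (g x)) \<in> borel_measurable borel"
    by (rule borel_measurable_continuous_Pair) (auto intro!: continuous_on continuous_intros)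
  show "integrable lborel (\<lambda>x. p (f x) (g x))"
    by (rule Bochner_Integration.integrable_bound[OF L2_Cauchy_Schwarz(1)[OF assms(3,4)]])
       (auto simp: assms(2))
  then show "norm (\<integral>x. p (f x) (g x) \<partial>lborel) \<le> l2 f * l2 g"
    by (intro order_trans[OF integral_norm_bound] order_trans[OF integral_mono L2_Cauchy_Schwarz(2)[OF assms(3,4)]])
       (use L2_Cauchy_Schwarz(1)[OF assms(3,4)] in \<open>auto simp: assms(2)\<close>)
qed

lemma l2_triangle:
  assumes "L2 f" "L2 g" shows "l2 (\<lambda>x. f x + g x) \<le> l2 f + l2 g"
proof -
  note CS = L2_Cauchy_Schwarz[OF assms]
  have "(l2 (\<lambda>x. f x + g x))\<^sup>2 \<le> (\<integral>x. (norm (f x))\<^sup>2 + 2 * (norm (f x) * norm (g x)) + (norm (g x))\<^sup>2 \<partial>lborel)"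
    unfolding l2_power2
  proof (rule integral_mono)
    show "(norm (f x + g x))\<^sup>2 \<le> (norm (f x))\<^sup>2 + 2 * (norm (f x) * norm (g x)) + (norm (g x))\<^sup>2" for x
      using power_mono[OF norm_triangle_ineq[of "f x" "g x"], of 2] by (simp add: power2_sum)
  qed (use CS(1) L2_integrable[OF L2_add[OF assms]] L2_integrable[OF assms(1)] L2_integrable[OF assms(2)] in auto)
  also have "\<dots> = (l2 f)\<^sup>2 + 2 * (\<integral>x. norm (f x) * norm (g x) \<partial>lborel) + (l2 g)\<^sup>2"
    using CS(1) L2_integrable[OF assms(1)] L2_integrable[OF assms(2)] by (simp add: l2_power2)
  also have "\<dots> \<le> (l2 f + l2 g)\<^sup>2"
    using CS(2) by (simp add: power2_sum)
  finally show ?thesis by (rule power2_le_imp_le) simp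
qed

lemma l2_triangle_diff:
  assumes "L2 f" "L2 g" "L2 h" shows "l2 (\<lambda>x. f x - h x) \<le> l2 (\<lambda>x. f x - g x) + l2 (\<lambda>x. g x - h x)"
  using l2_triangle[OF L2_diff[OF assms(1,2)] L2_diff[OF assms(2,3)]] by simp

lemma l2_zero_AE:
  assumes "L2 f" "l2 f \<le> 0" shows "AE x in lborel. f x = 0"
proof -
  have "(\<integral>x. (norm (f x))\<^sup>2 \<partial>lborel) = 0" using assms(2) l2_nonneg[of f] by (simp flip: l2_power2)
  then show ?thesis using integral_nonneg_eq_0_iff_AE[OF L2_integrable[OF assms(1)]] by auto
qed

text \<open>Riesz-Fischer: a rapidly Cauchy subsequence converges almost everywhere, and Fatou's
  lemma turns its pointwise limit into an L2 limit of the whole sequence.\<close>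

lemma L2_complete:
  fixes u :: "nat \<Rightarrow> 'a::euclidean_space \<Rightarrow> 'b::euclidean_space"
  assumes u: "\<And>n. L2 (u n)"
    and Cauchy: "\<And>e. e > 0 \<Longrightarrow> \<exists>N. \<forall>m\<ge>N. \<forall>n\<ge>N. l2 (\<lambda>x. u m x - u n x) < e"
  obtains g where "L2 g" "(\<lambda>n. l2 (\<lambda>x. g x - u n x)) \<longlonglongrightarrow> 0"
proof -
  note [measurable] = L2_measurable[OF u]
  have "\<exists>N. \<forall>m\<ge>N. \<forall>n\<ge>N. l2 (\<lambda>x. u m x - u n x) < (1/4)^k" for k :: nat
    by (rule Cauchy) simp
  then obtain N where N: "\<And>k m n. m \<ge> N k \<Longrightarrow> n \<ge> N k \<Longrightarrow> l2 (\<lambda>x. u m x - u n x) < (1/4)^k"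
    by metis
  \<comment> \<open>Summing the earlier \<open>N j\<close> makes \<open>r\<close> increasing; the
    summand \<open>k\<close> makes it unbounded even if the \<open>N j\<close> vanish.\<close>
  define r where "r k = (\<Sum>j\<le>k. N j) + k" for k
  have rN: "r k \<ge> N k" for k
    unfolding r_def by (meson finite_atMost le_add1 le_trans member_le_sum order_refl atMost_iff zero_le)
  have r_mono: "r k \<le> r (Suc k)" for k by (simp add: r_def)
  have rN': "r (Suc k) \<ge> N k" for k using rN[of k] r_mono[of k] by simp
  define d where "d k x = u (r (Suc k)) x - u (r k) x" for k x
  have [measurable]: "d k \<in> borel_measurable borel" for k unfolding d_def by measurable
  have dL: "L2 (d k)" for k unfolding d_def by (intro L2_diff u)
  have dl: "l2 (d k) < (1/4)^k" for k using N[OF rN' rN] by (simp add: d_def[abs_def])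
  \<comment> \<open>The weight 2^k is weak enough for the increments of norm below 4^(-k) to stay
    summable, and strong enough that finiteness at a point forces geometric decay of the increments
    there.\<close>
  have "(\<integral>\<^sup>+x. (\<Sum>k. ennreal (2^k * (norm (d k x))\<^sup>2)) \<partial>lborel)
      = (\<Sum>k. \<integral>\<^sup>+x. ennreal (2^k * (norm (d k x))\<^sup>2) \<partial>lborel)"
    by (rule nn_integral_suminf) simp
  also have "\<dots> = (\<Sum>k. ennreal (2^k * (l2 (d k))\<^sup>2))"
    by (simp add: ennreal_mult' nn_integral_cmult nn_integral_L2[OF dL])
  also have "\<dots> \<le> (\<Sum>k. ennreal ((1/2)^k))"
  proof (intro suminf_le ennreal_leI)
    fix k
    have "(l2 (d k))\<^sup>2 \<le> ((1/4)^k)\<^sup>2" using dl[of k] by (intro power_mono) auto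
    also have "\<dots> = (1/16)^k" by (simp add: power_mult[symmetric] mult.commute) (simp add: power_mult power2_eq_square flip: power_mult_distrib)
    finally have "2^k * (l2 (d k))\<^sup>2 \<le> 2^k * (1/16)^k" by simp
    also have "\<dots> = (1/8)^k" by (simp flip: power_mult_distrib)
    also have "\<dots> \<le> (1/2)^k" by (intro power_mono) auto
    finally show "2^k * (l2 (d k))\<^sup>2 \<le> (1/2)^k" .
  qed auto
  also have "\<dots> = ennreal (\<Sum>k. (1/2)^k)"
    by (rule suminf_ennreal2) auto
  also have "\<dots> < \<infinity>" by simp
  finally have "AE x in lborel. (\<Sum>k. ennreal (2^k * (norm (d k x))\<^sup>2)) \<noteq> \<infinity>"
    by (intro nn_integral_noteq_infinite) auto
  then have conv: "AE x in lborel. convergent (\<lambda>k. u (r k) x)"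
  proof eventually_elim
    fix x assume fin: "(\<Sum>k. ennreal (2^k * (norm (d k x))\<^sup>2)) \<noteq> \<infinity>"
    then have sm: "summable (\<lambda>k. 2^k * (norm (d k x))\<^sup>2)"
      by (intro summable_suminf_not_top) auto
    define B where "B = (\<Sum>k. 2^k * (norm (d k x))\<^sup>2)"
    have "summable (\<lambda>k. d k x)"
    proof (rule summable_comparison_test)
      have "norm (d k x) \<le> sqrt B * (1 / sqrt 2)^k" for k
      proof -
        have "2^k * (norm (d k x))\<^sup>2 \<le> B" unfolding B_def
          using sum_le_suminf[OF sm, of "{k}"] by simp
        then have "(norm (d k x))\<^sup>2 \<le> B / 2^k" by (simp add: field_simps)
        then have "norm (d k x) \<le> sqrt (B / 2^k)" by (simp add: real_le_rsqrt)
        then show ?thesis by (simp add: real_sqrt_divide real_sqrt_power power_divide)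
      qed
      then show "\<exists>N. \<forall>k\<ge>N. norm (d k x) \<le> sqrt B * (1 / sqrt 2)^k" by auto
      show "summable (\<lambda>k. sqrt B * (1 / sqrt 2)^k)"
        by (intro summable_mult summable_geometric) auto
    qed
    then have "convergent (\<lambda>k. \<Sum>i<k. d i x)" by (simp add: summable_iff_convergent)
    moreover have "(\<Sum>i<k. d i x) = u (r k) x - u (r 0) x" for k
      unfolding d_def by (rule sum_lessThan_telescope)
    ultimately have "convergent (\<lambda>k. u (r k) x - u (r 0) x)" by simp
    then show "convergent (\<lambda>k. u (r k) x)"
      by (simp add: convergent_diff_const_right_iff)
  qed
  define g where "g x = lim (\<lambda>k. u (r k) x)" for x
  have [measurable]: "g \<in> borel_measurable borel" unfolding g_def by measurable
  have lim: "AE x in lborel. (\<lambda>k. u (r k) x) \<longlonglongrightarrow> g x"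
    using conv unfolding g_def by eventually_elim (simp add: convergent_LIMSEQ_iff)
  \<comment> \<open>Fatou along the subsequence. Membership of the difference in L2 is part of the
    conclusion, since \<open>g\<close> is not yet known to be in L2.\<close>
  have key: "L2 (\<lambda>x. g x - u n x) \<and> l2 (\<lambda>x. g x - u n x) \<le> e"
    if e: "e > 0" and M: "\<forall>m\<ge>M. l2 (\<lambda>x. u m x - u n x) \<le> e" for n e M
  proof -
    have "(\<integral>\<^sup>+x. ennreal ((norm (g x - u n x))\<^sup>2) \<partial>lborel)
       = (\<integral>\<^sup>+x. liminf (\<lambda>k. ennreal ((norm (u (r k) x - u n x))\<^sup>2)) \<partial>lborel)"
    proof (rule nn_integral_cong_AE, use lim in eventually_elim)
      fix x assume "(\<lambda>k. u (r k) x) \<longlonglongrightarrow> g x"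
      then have "(\<lambda>k. ennreal ((norm (u (r k) x - u n x))\<^sup>2)) \<longlonglongrightarrow> ennreal ((norm (g x - u n x))\<^sup>2)"
        by (intro tendsto_ennrealI tendsto_intros)
      then show "ennreal ((norm (g x - u n x))\<^sup>2) = liminf (\<lambda>k. ennreal ((norm (u (r k) x - u n x))\<^sup>2))"
        by (metis lim_imp_Liminf trivial_limit_sequentially)
    qed
    also have "\<dots> \<le> liminf (\<lambda>k. \<integral>\<^sup>+x. ennreal ((norm (u (r k) x - u n x))\<^sup>2) \<partial>lborel)"
      by (rule nn_integral_liminf) simp
    also have "\<dots> \<le> liminf (\<lambda>k. ennreal (e\<^sup>2))"
    proof (rule Liminf_mono, rule eventually_sequentiallyI[of M])
      fix k assume "M \<le> k"
      then have "r k \<ge> M" by (simp add: r_def)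
      then have "l2 (\<lambda>x. u (r k) x - u n x) \<le> e" using M by auto
      then show "(\<integral>\<^sup>+x. ennreal ((norm (u (r k) x - u n x))\<^sup>2) \<partial>lborel) \<le> ennreal (e\<^sup>2)"
        by (subst nn_integral_L2[OF L2_diff[OF u u]]) (auto intro!: ennreal_leI power_mono)
    qed
    also have "\<dots> = ennreal (e\<^sup>2)" by (simp add: Liminf_const)
    finally show ?thesis using e L2I_nn[of "\<lambda>x. g x - u n x" e] by auto
  qed
  have ev: "\<exists>N. \<forall>n\<ge>N. L2 (\<lambda>x. g x - u n x) \<and> l2 (\<lambda>x. g x - u n x) \<le> e" if "e > 0" for e
    using Cauchy[OF that] key[OF that] by (meson less_imp_le)
  obtain n0 where "L2 (\<lambda>x. g x - u n0 x)" using ev[of 1] by auto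
  from L2_add[OF this u[of n0]] have "L2 g" by simp
  moreover have "(\<lambda>n. l2 (\<lambda>x. g x - u n x)) \<longlonglongrightarrow> 0"
  proof (rule LIMSEQ_I)
    fix e :: real assume "e > 0"
    with ev[of "e/2"] show "\<exists>N. \<forall>n\<ge>N. norm (l2 (\<lambda>x. g x - u n x) - 0) < e"
      by fastforce
  qed
  ultimately show thesis by (rule that)
qed

section \<open>The scalar Fourier transform and Gaussian kernels\<close>

lemma lborel_affine_euclid:
  fixes f :: "'a::euclidean_space \<Rightarrow> 'b::{banach, second_countable_topology}"
  assumes "c \<noteq> 0" "f \<in> borel_measurable borel"
  shows "integrable lborel (\<lambda>x. f (t + c *\<^sub>R x)) \<longleftrightarrow> integrable lborel f"
    and "(\<integral>x. f x \<partial>lborel) = \<bar>c\<bar> ^ DIM('a) *\<^sub>R (\<integral>x. f (t + c *\<^sub>R x) \<partial>lborel)"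
proof -
  note [measurable] = assms(2)
  have "integrable lborel f \<longleftrightarrow> integrable (density (distr lborel borel (\<lambda>x. t + c *\<^sub>R x)) (\<lambda>_. \<bar>c\<bar> ^ DIM('a))) f"
    by (subst lborel_affine[OF assms(1), of t]) simp
  also have "\<dots> \<longleftrightarrow> integrable lborel (\<lambda>x. f (t + c *\<^sub>R x))"
  proof -
    have "integrable lborel (\<lambda>x. \<bar>c\<bar> ^ DIM('a) *\<^sub>R f (t + c *\<^sub>R x)) \<longleftrightarrow> integrable lborel (\<lambda>x. f (t + c *\<^sub>R x))" (is "?L \<longleftrightarrow> ?R")
    proof
      assume ?L
      from integrable_scaleR_right[OF this, of "inverse (\<bar>c\<bar> ^ DIM('a))"]
      show ?R using assms(1) by simp
    qed auto
    then show ?thesis by (subst integrable_density) (simp_all add: integrable_distr_eq)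
  qed
  finally show "integrable lborel (\<lambda>x. f (t + c *\<^sub>R x)) \<longleftrightarrow> integrable lborel f" by simp
  have "(\<integral>x. f x \<partial>lborel) = (\<integral>x. f x \<partial>(density (distr lborel borel (\<lambda>x. t + c *\<^sub>R x)) (\<lambda>_. \<bar>c\<bar> ^ DIM('a))))"
    by (subst lborel_affine[OF assms(1), of t]) simp
  also have "\<dots> = \<bar>c\<bar> ^ DIM('a) *\<^sub>R (\<integral>x. f (t + c *\<^sub>R x) \<partial>lborel)"
    by (subst integral_density) (auto simp: integral_distr)
  finally show "(\<integral>x. f x \<partial>lborel) = \<bar>c\<bar> ^ DIM('a) *\<^sub>R (\<integral>x. f (t + c *\<^sub>R x) \<partial>lborel)" .
qed

lemma lborel_prod_basis:
  fixes f :: "'a::euclidean_space \<Rightarrow> real \<Rightarrow> 'b::{real_normed_field, banach, second_countable_topology}"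
  assumes "\<And>b. b \<in> Basis \<Longrightarrow> integrable lborel (f b)"
  shows "integrable lborel (\<lambda>x. \<Prod>b\<in>Basis. f b (x \<bullet> b))"
    and "(\<integral>x. (\<Prod>b\<in>Basis. f b (x \<bullet> b)) \<partial>lborel) = (\<Prod>b\<in>Basis. \<integral>x. f b x \<partial>lborel)"
proof -
  interpret product_sigma_finite "\<lambda>_::'a. lborel :: real measure" by standard
  have [measurable]: "f b \<in> borel_measurable borel" if "b \<in> Basis" for b
    using borel_measurable_integrable[OF assms[OF that]] by simp
  have eq: "(\<Prod>b\<in>Basis. f b ((\<Sum>b\<in>Basis. x b *\<^sub>R b) \<bullet> b)) = (\<Prod>b\<in>Basis. f b (x b))" for x :: "'a \<Rightarrow> real"
    by (rule prod.cong) (auto simp: inner_sum_left_Basis)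
  have m: "(\<lambda>x. \<Prod>b\<in>Basis. f b (x \<bullet> b)) \<in> borel_measurable borel" by measurable
  show "integrable lborel (\<lambda>x. \<Prod>b\<in>Basis. f b (x \<bullet> b))"
    by (subst lborel_eq, subst integrable_distr_eq[OF _ m])
       (auto simp: eq intro!: product_integrable_prod assms)
  show "(\<integral>x. (\<Prod>b\<in>Basis. f b (x \<bullet> b)) \<partial>lborel) = (\<Prod>b\<in>Basis. \<integral>x. f b x \<partial>lborel)"
    by (subst lborel_eq, subst integral_distr[OF _ m])
       (auto simp: eq intro!: product_integral_prod assms)
qed

text \<open>The sum of the coordinates' absolute values is at most n |x|, so with rate c / n in each
  coordinate a product of one-dimensional exponentials dominates.\<close>

lemma integrable_exp_neg_norm:
  assumes "c > 0" shows "integrable lborel (\<lambda>x::'a::euclidean_space. exp (- c * norm x))"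
proof -
  define c' where "c' = c / DIM('a)"
  have c': "c' > 0" using assms by (simp add: c'_def)
  have "integrable lborel (\<lambda>x::real. exp (- c' * \<bar>x\<bar>))"
  proof -
    interpret prob_space "density lborel (exponential_density c')"
      by (rule prob_space_exponential_density[OF c'])
    have "(\<integral>\<^sup>+x. ennreal (exponential_density c' x) \<partial>lborel) = 1"
      using emeasure_space_1 by (simp add: emeasure_density)
    then have "integrable lborel (exponential_density c')"
      unfolding integrable_iff_bounded using c' by simp
    then have "integrable lborel (\<lambda>x. (1 / c') *\<^sub>R exponential_density c' x)" by simp
    also have "(\<lambda>x. (1 / c') *\<^sub>R exponential_density c' x) = (\<lambda>x::real. indicator {0..} x *\<^sub>R exp (- c' * \<bar>x\<bar>))"
      using c' by (auto simp: exponential_density_def indicator_def)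
    finally show ?thesis
      using has_bochner_integral_even_function[of "\<lambda>x. exp (- c' * \<bar>x\<bar>)"]
      by (auto simp: has_bochner_integral_iff)
  qed
  then have "integrable lborel (\<lambda>x::'a. \<Prod>b\<in>Basis. exp (- c' * \<bar>x \<bullet> b\<bar>))"
    by (intro lborel_prod_basis(1))
  then show ?thesis
  proof (rule Bochner_Integration.integrable_bound)
    show "AE x::'a in lborel. norm (exp (- c * norm x)) \<le> norm (\<Prod>b\<in>Basis. exp (- c' * \<bar>x \<bullet> b\<bar>))"
    proof (rule AE_I2)
      fix x :: 'a
      have "(\<Sum>b\<in>Basis. \<bar>x \<bullet> b\<bar>) \<le> DIM('a) * norm x"
        using sum_mono[of Basis "\<lambda>b. \<bar>x \<bullet> b\<bar>" "\<lambda>_. norm x"] by (simp add: Basis_le_norm)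
      then have "c' * (\<Sum>b\<in>Basis. \<bar>x \<bullet> b\<bar>) \<le> c' * (DIM('a) * norm x)" using c' by simp
      also have "\<dots> = c * norm x" by (simp add: c'_def)
      finally show "norm (exp (- c * norm x)) \<le> norm (\<Prod>b\<in>Basis. exp (- c' * \<bar>x \<bullet> b\<bar>))"
        by (simp add: exp_sum[symmetric] sum_distrib_left sum_negf)
    qed
  qed simp
qed

section \<open>The Gaussian and its transform\<close>

definition gauss :: "'a::euclidean_space \<Rightarrow> real" where
  "gauss x = exp (- (norm x)\<^sup>2 / 2)"

lemma gauss_measurable [measurable]: "gauss \<in> borel_measurable borel"
  unfolding gauss_def by measurable

lemma gauss_pos [simp]: "0 < gauss x" and gauss_nonneg [simp]: "0 \<le> gauss x" and gauss_le_1: "gauss x \<le> 1"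
  and gauss_minus [simp]: "gauss (- x) = gauss x" and gauss_0 [simp]: "gauss 0 = 1"
  by (simp_all add: gauss_def)

lemma gauss_prod: "gauss x = (\<Prod>b\<in>Basis. exp (- (x \<bullet> b)\<^sup>2 / 2))"
  unfolding gauss_def power2_norm_eq_inner
  by (subst euclidean_inner) (simp add: exp_sum[symmetric] sum_negf sum_divide_distrib power2_eq_square)

text \<open>Gaussian and character both factor over the basis, and in one dimension this is the
  characteristic function of the standard normal distribution.\<close>

lemma gauss_fourier:
  fixes \<xi> :: "'a::euclidean_space"
  shows "integrable lborel (\<lambda>x::'a. complex_of_real (gauss x))"
    and "(\<integral>x. cis (x \<bullet> \<xi>) * complex_of_real (gauss x) \<partial>lborel) = complex_of_real (sqrt (2 * pi) ^ DIM('a) * gauss \<xi>)"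
proof -
  define f where "f t x = cis (x * t) * complex_of_real (exp (- x\<^sup>2 / 2))" for t x :: real
  have fd: "f t x = sqrt (2 * pi) * (std_normal_density x *\<^sub>R iexp (t * x))" for t x
    by (simp add: f_def std_normal_density_def cis_conv_exp scaleR_conv_of_real mult_ac)
  have i: "integrable lborel (f t)" for t
    unfolding fd
    by (intro integrable_mult_right Bochner_Integration.integrable_bound[OF integrable_normal_density[where \<mu>=0 and \<sigma>=1]])
       (auto simp: normal_density_nonneg)
  have "(\<integral>x. f t x \<partial>lborel) = sqrt (2 * pi) * char std_normal_distribution t" for t
    unfolding fd char_def by (subst integral_mult_right_zero, subst integral_density) (auto simp: normal_density_nonneg)
  then have v: "(\<integral>x. f t x \<partial>lborel) = sqrt (2 * pi) * exp (- t\<^sup>2 / 2)" for t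
    by (simp add: char_std_normal_distribution)
  have prod: "cis (x \<bullet> \<xi>) * complex_of_real (gauss x) = (\<Prod>b\<in>Basis. f (\<xi> \<bullet> b) (x \<bullet> b))" for x \<xi> :: 'a
  proof -
    have "cis (x \<bullet> \<xi>) = (\<Prod>b\<in>Basis. cis ((x \<bullet> b) * (\<xi> \<bullet> b)))"
      by (subst euclidean_inner) (simp add: cis_conv_exp sum_distrib_left exp_sum)
    then show ?thesis by (simp add: f_def gauss_prod prod.distrib)
  qed
  show "integrable lborel (\<lambda>x::'a. complex_of_real (gauss x))"
    using lborel_prod_basis(1)[of "\<lambda>b. f (0 \<bullet> b)", OF i] prod[of _ 0] by simp
  show "(\<integral>x. cis (x \<bullet> \<xi>) * complex_of_real (gauss x) \<partial>lborel) = complex_of_real (sqrt (2 * pi) ^ DIM('a) * gauss \<xi>)"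
    unfolding prod lborel_prod_basis(2)[of "\<lambda>b. f (\<xi> \<bullet> b)", OF i] v
    by (simp add: gauss_prod prod.distrib)
qed

text \<open>The sign \<open>s\<close> is the direction: -1 is the Fourier transform, 1 its inverse
  up to the factor (2 pi)^n. One definition lets Plancherel and the multiplication formula serve
  both.\<close>

definition ft :: "real \<Rightarrow> ('a::euclidean_space \<Rightarrow> complex) \<Rightarrow> 'a \<Rightarrow> complex" where
  "ft s h \<xi> = (\<integral>x. cis (s * (x \<bullet> \<xi>)) * h x \<partial>lborel)"

lemma cis_measurable [measurable]: "cis \<in> borel_measurable borel"
  by (intro borel_measurable_continuous_onI continuous_intros)

lemma integrable_cis_mult:
  fixes h :: "'a::euclidean_space \<Rightarrow> complex"
  assumes "integrable lborel h" "p \<in> borel_measurable borel"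
  shows "integrable lborel (\<lambda>x. cis (p x) * h x)"
proof -
  note [measurable] = assms(2) borel_measurable_integrable[OF assms(1)]
  show ?thesis
    by (rule Bochner_Integration.integrable_bound[OF assms(1)]) (auto simp: norm_mult)
qed

lemma ft_measurable [measurable]:
  assumes "h \<in> borel_measurable borel" shows "ft s h \<in> borel_measurable borel"
proof -
  note [measurable] = assms
  show ?thesis unfolding ft_def by measurable
qed

lemma norm_ft_le: "norm (ft s h \<xi>) \<le> (\<integral>x. norm (h x) \<partial>lborel)"
  unfolding ft_def by (rule order_trans[OF integral_norm_bound]) (simp add: norm_mult)

lemma cnj_ft: "cnj (ft s h \<xi>) = ft (- s) (\<lambda>x. cnj (h x)) \<xi>"
  unfolding ft_def by (simp add: cis_cnj flip: Bochner_Integration.integral_cnj)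

lemma integrable_pair_mult:
  fixes h :: "'a::euclidean_space \<Rightarrow> real" and k :: "'b::euclidean_space \<Rightarrow> real"
  assumes "integrable lborel h" "integrable lborel k"
  shows "integrable (lborel \<Otimes>\<^sub>M lborel) (\<lambda>(x, y). h x * k y)"
proof -
  note [measurable] = borel_measurable_integrable[OF assms(1)] borel_measurable_integrable[OF assms(2)]
  show ?thesis
    by (rule lborel_pair.Fubini_integrable)
       (use assms in \<open>auto simp: abs_mult\<close>)
qed

text \<open>Fubini: the phase is symmetric in its two variables, so the transform can be moved from
  one factor to the other.\<close>

lemma ft_mult_formula:
  fixes h k :: "'a::euclidean_space \<Rightarrow> complex"
  assumes "integrable lborel h" "integrable lborel k"
  shows "(\<integral>\<xi>. ft s h \<xi> * k \<xi> \<partial>lborel) = (\<integral>x. h x * ft s k x \<partial>lborel)"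
proof -
  note [measurable] = borel_measurable_integrable[OF assms(1)] borel_measurable_integrable[OF assms(2)]
  have "integrable (lborel \<Otimes>\<^sub>M lborel) (\<lambda>(x, \<xi>). cis (s * (x \<bullet> \<xi>)) * h x * k \<xi>)"
    by (rule Bochner_Integration.integrable_bound[OF integrable_pair_mult[OF integrable_norm[OF assms(1)] integrable_norm[OF assms(2)]]])
       (auto simp: norm_mult split_beta')
  from lborel_pair.Fubini_integral[OF this]
  have "(\<integral>\<xi>. \<integral>x. cis (s * (x \<bullet> \<xi>)) * h x * k \<xi> \<partial>lborel \<partial>lborel) = (\<integral>x. \<integral>\<xi>. cis (s * (x \<bullet> \<xi>)) * h x * k \<xi> \<partial>lborel \<partial>lborel)"
    by simp
  also have "(\<lambda>x. \<integral>\<xi>. cis (s * (x \<bullet> \<xi>)) * h x * k \<xi> \<partial>lborel) = (\<lambda>x. h x * ft s k x)"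
    unfolding ft_def by (simp add: mult_ac inner_commute flip: integral_mult_right_zero)
  also have "(\<lambda>\<xi>. \<integral>x. cis (s * (x \<bullet> \<xi>)) * h x * k \<xi> \<partial>lborel) = (\<lambda>\<xi>. ft s h \<xi> * k \<xi>)"
    unfolding ft_def by simp
  finally show ?thesis .
qed

text \<open>The Fourier transform of x -> \<open>gauss (d *\<^sub>R x)\<close>, which is an
  approximate identity of mass (2 pi)^n as d tends to 0.\<close>

definition gker :: "real \<Rightarrow> 'a::euclidean_space \<Rightarrow> real" where
  "gker d z = (sqrt (2 * pi) / d) ^ DIM('a) * gauss (z /\<^sub>R d)"

lemma gker_measurable [measurable]: "gker d \<in> borel_measurable borel"
  unfolding gker_def by measurable

lemma gker_nonneg: "d > 0 \<Longrightarrow> 0 \<le> gker d z"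
  by (simp add: gker_def)

lemma gker_minus_commute: "gker d (x - y) = gker d (y - x)"
  by (metis gker_def gauss_minus minus_diff_eq scaleR_minus_right)

lemma gauss_integrable: "integrable lborel (gauss :: 'a::euclidean_space \<Rightarrow> real)"
  using gauss_fourier(1)[where 'a='a] by (simp add: complex_of_real_integrable_eq)

lemma gauss_scaled_integrable:
  assumes "d \<noteq> 0" shows "integrable lborel (\<lambda>x::'a::euclidean_space. gauss (d *\<^sub>R x))"
  using lborel_affine_euclid(1)[of d "gauss::'a\<Rightarrow>real" 0] gauss_integrable assms by simp

lemma L2_gauss_scaled:
  assumes "d \<noteq> 0" shows "L2 (\<lambda>x::'a::euclidean_space. gauss (d *\<^sub>R x))"
  unfolding L2_def
proof
  have "(norm (gauss (d *\<^sub>R x)))\<^sup>2 \<le> gauss (d *\<^sub>R x)" for x :: 'a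
    by (simp add: power2_eq_square mult_le_cancel_left1 gauss_le_1 less_imp_le)
  then show "integrable lborel (\<lambda>x::'a. (norm (gauss (d *\<^sub>R x)))\<^sup>2)"
    by (intro Bochner_Integration.integrable_bound[OF gauss_scaled_integrable[OF assms]]) auto
qed simp

lemma gker_integral:
  assumes "d > 0"
  shows "integrable lborel (gker d :: 'a::euclidean_space \<Rightarrow> real)" "(\<integral>z. gker d (z::'a) \<partial>lborel) = (2 * pi) ^ DIM('a)"
proof -
  show "integrable lborel (gker d :: 'a::euclidean_space \<Rightarrow> real)"
    unfolding gker_def using gauss_scaled_integrable[of "inverse d"] assms by simp
  have "complex_of_real (\<integral>x. gauss (x::'a) \<partial>lborel) = complex_of_real (sqrt (2 * pi) ^ DIM('a))"
    using gauss_fourier(2)[of "0::'a"] by (simp add: integral_complex_of_real)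
  then have g: "(\<integral>x. gauss (x::'a) \<partial>lborel) = sqrt (2 * pi) ^ DIM('a)"
    by (simp only: of_real_eq_iff)
  have "(\<integral>z. gker d (z::'a) \<partial>lborel) = d ^ DIM('a) * (\<integral>z. gker d (0 + d *\<^sub>R (z::'a)) \<partial>lborel)"
    using assms by (subst lborel_affine_euclid(2)[of d _ 0]) auto
  also have "(\<lambda>z::'a. gker d (0 + d *\<^sub>R z)) = (\<lambda>z. (sqrt (2 * pi) / d) ^ DIM('a) * gauss z)"
    using assms by (simp add: gker_def)
  also have "d ^ DIM('a) * (\<integral>z. (sqrt (2 * pi) / d) ^ DIM('a) * gauss (z::'a) \<partial>lborel) = (2 * pi) ^ DIM('a)"
  proof -
    have "sqrt (2 * pi) ^ DIM('a) * sqrt (2 * pi) ^ DIM('a) = (2 * pi) ^ DIM('a)"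
      by (subst power_mult_distrib[symmetric]) simp
    then show ?thesis using assms by (simp add: g power_divide)
  qed
  finally show "(\<integral>z. gker d (z::'a) \<partial>lborel) = (2 * pi) ^ DIM('a)" .
qed

text \<open>A character becomes a translation and the dilation by d is inverted. The sign can be
  pulled out since s * s = 1 and the Gaussian depends only on the norm.\<close>

lemma ft_gauss:
  fixes t \<xi> :: "'a::euclidean_space"
  assumes "d > 0" "\<bar>s\<bar> = 1"
  shows "integrable lborel (\<lambda>x. cis (t \<bullet> x) * complex_of_real (gauss (d *\<^sub>R x)))"
    and "ft s (\<lambda>x. cis (t \<bullet> x) * complex_of_real (gauss (d *\<^sub>R x))) \<xi> = complex_of_real (gker d (s *\<^sub>R t + \<xi>))"
proof -
  show i: "integrable lborel (\<lambda>x. cis (t \<bullet> x) * complex_of_real (gauss (d *\<^sub>R x)))"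
    using gauss_scaled_integrable[of d, where 'a='a] assms by (intro integrable_cis_mult) auto
  have s2: "s * s = 1" using assms(2) by (metis abs_mult_self_eq mult_1)
  define \<eta> where "\<eta> = (t + s *\<^sub>R \<xi>) /\<^sub>R d"
  have "ft s (\<lambda>x. cis (t \<bullet> x) * complex_of_real (gauss (d *\<^sub>R x))) \<xi>
     = (\<integral>x. cis (x \<bullet> (t + s *\<^sub>R \<xi>)) * complex_of_real (gauss (d *\<^sub>R x)) \<partial>lborel)"
    unfolding ft_def by (simp add: inner_right_distrib inner_commute[of t] cis_mult[symmetric] mult_ac)
  also have "\<dots> = (1/d) ^ DIM('a) *\<^sub>R (\<integral>x. cis ((0 + (1/d) *\<^sub>R x) \<bullet> (t + s *\<^sub>R \<xi>)) * complex_of_real (gauss (d *\<^sub>R (0 + (1/d) *\<^sub>R x))) \<partial>lborel)"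
    using assms by (subst lborel_affine_euclid(2)[of "1/d" _ 0]) auto
  also have "(\<lambda>x. cis ((0 + (1/d) *\<^sub>R x) \<bullet> (t + s *\<^sub>R \<xi>)) * complex_of_real (gauss (d *\<^sub>R (0 + (1/d) *\<^sub>R x))))
     = (\<lambda>x. cis (x \<bullet> \<eta>) * complex_of_real (gauss x))"
    using assms by (auto simp: \<eta>_def divide_inverse)
  also have "(1/d) ^ DIM('a) *\<^sub>R (\<integral>x. cis (x \<bullet> \<eta>) * complex_of_real (gauss x) \<partial>lborel) = complex_of_real ((sqrt (2 * pi) / d) ^ DIM('a) * gauss \<eta>)"
    unfolding gauss_fourier(2) by (simp add: power_divide scaleR_conv_of_real)
  also have "gauss \<eta> = gauss ((s *\<^sub>R t + \<xi>) /\<^sub>R d)"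
  proof -
    have "s *\<^sub>R t + \<xi> = s *\<^sub>R (t + s *\<^sub>R \<xi>)" using s2 by (simp add: scaleR_right_distrib)
    then show ?thesis by (simp add: \<eta>_def gauss_def abs_mult assms(2))
  qed
  finally show "ft s (\<lambda>x. cis (t \<bullet> x) * complex_of_real (gauss (d *\<^sub>R x))) \<xi> = complex_of_real (gker d (s *\<^sub>R t + \<xi>))"
    by (simp add: gker_def)
qed

lemma gker_translate:
  fixes x :: "'a::euclidean_space"
  assumes "d > 0"
  shows "integrable lborel (\<lambda>y. gker d (x - y))" "(\<integral>y. gker d (x - y) \<partial>lborel) = (2 * pi) ^ DIM('a)"
    "(\<integral>\<^sup>+y. ennreal (gker d (x - y)) \<partial>lborel) = ennreal ((2 * pi) ^ DIM('a))"
proof -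
  have eq: "(\<lambda>y. gker d (x - y)) = (\<lambda>y. gker d (- x + 1 *\<^sub>R y))"
    by (auto simp: gker_minus_commute[of d x])
  show i: "integrable lborel (\<lambda>y. gker d (x - y))"
    unfolding eq using gker_integral(1)[OF assms, where 'a='a] by (subst lborel_affine_euclid(1)) auto
  show v: "(\<integral>y. gker d (x - y) \<partial>lborel) = (2 * pi) ^ DIM('a)"
    unfolding eq using gker_integral(2)[OF assms, where 'a='a] lborel_affine_euclid(2)[of 1 "gker d" "-x"] by simp
  show "(\<integral>\<^sup>+y. ennreal (gker d (x - y)) \<partial>lborel) = ennreal ((2 * pi) ^ DIM('a))"
    using nn_integral_eq_integral[OF i] gker_nonneg[OF assms] v by auto
qed

section \<open>The Plancherel inequality on L1 Int L2\<close>

lemma cnj_measurable [measurable]: "cnj \<in> borel_measurable borel"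
  by (intro borel_measurable_continuous_onI continuous_intros)

text \<open>A non-integrable function has Bochner integral 0, so the bound holds
  unconditionally.\<close>

lemma norm_integral_le_nn_integral:
  fixes f :: "'a \<Rightarrow> 'b::{banach, second_countable_topology}"
  shows "ennreal (norm (integral\<^sup>L M f)) \<le> (\<integral>\<^sup>+x. ennreal (norm (f x)) \<partial>M)"
  by (cases "integrable M f") (auto intro: integral_norm_bound_ennreal simp: not_integrable_integral_eq)

text \<open>With a Gaussian weight the left-hand side is the convolution of h with a positive kernel of mass
  (2 pi)^n, paired with h; then 2|ab| <= |a|^2 + |b|^2 suffices.\<close>
lemma ft_gauss_weighted:
  fixes h :: "'a::euclidean_space \<Rightarrow> complex"
  assumes "\<bar>s\<bar> = 1" "integrable lborel h" "L2 h" "d > 0"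
  shows "(\<integral>\<^sup>+\<xi>. ennreal (gauss (d *\<^sub>R \<xi>) * (norm (ft s h \<xi>))\<^sup>2) \<partial>lborel) \<le> ennreal ((2 * pi) ^ DIM('a) * (l2 h)\<^sup>2)"
proof -
  note [measurable] = borel_measurable_integrable[OF assms(2)]
  define H where "H = ft s h"
  have [measurable]: "H \<in> borel_measurable borel" unfolding H_def by measurable
  define B where "B = (\<integral>x. norm (h x) \<partial>lborel)"
  have HB: "norm (H \<xi>) \<le> B" for \<xi> unfolding H_def B_def by (rule norm_ft_le)
  have B0: "0 \<le> B" by (simp add: B_def)
  \<comment> \<open>The transform of an integrable function is only bounded, so the Gaussian weight
    is what makes \<open>k\<close> integrable and the multiplication formula applicable; the
    conjugate makes \<open>H \<xi> * k \<xi>\<close> the weighted square.\<close>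
  define k where "k \<xi> = complex_of_real (gauss (d *\<^sub>R \<xi>)) * cnj (H \<xi>)" for \<xi>
  have k: "integrable lborel k"
  proof (rule Bochner_Integration.integrable_bound)
    show "integrable lborel (\<lambda>\<xi>::'a. B * gauss (d *\<^sub>R \<xi>))"
      using assms by (intro integrable_mult_right gauss_scaled_integrable) auto
    show "k \<in> borel_measurable lborel" unfolding k_def by measurable
    show "AE \<xi> in lborel. norm (k \<xi>) \<le> norm (B * gauss (d *\<^sub>R \<xi>))"
      using HB B0 by (auto simp: k_def norm_mult mult_mono mult.commute)
  qed
  have kH: "H \<xi> * k \<xi> = complex_of_real (gauss (d *\<^sub>R \<xi>) * (norm (H \<xi>))\<^sup>2)" for \<xi>
    unfolding k_def of_real_mult complex_norm_square by (simp add: mult_ac)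
  have iW: "integrable lborel (\<lambda>\<xi>. gauss (d *\<^sub>R \<xi>) * (norm (H \<xi>))\<^sup>2)"
  proof (rule Bochner_Integration.integrable_bound)
    show "integrable lborel (\<lambda>\<xi>::'a. B\<^sup>2 * gauss (d *\<^sub>R \<xi>))"
      using assms by (intro integrable_mult_right gauss_scaled_integrable) auto
    show "AE \<xi> in lborel. norm (gauss (d *\<^sub>R \<xi>) * (norm (H \<xi>))\<^sup>2) \<le> norm (B\<^sup>2 * gauss (d *\<^sub>R \<xi>))"
      using HB B0 by (auto simp: norm_mult mult.commute intro!: mult_left_mono power_mono)
  qed measurable
  \<comment> \<open>Conjugation reverses the sign of the transform; transforming back with the
    Gaussian weight therefore gives the convolution of \<open>cnj\<close> h with
    \<open>gker d\<close>.\<close>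
  have ftk: "ft s k x = (\<integral>y. cnj (h y) * gker d (x - y) \<partial>lborel)" for x
  proof -
    have "ft s k x = (\<integral>\<xi>. ft (-s) (\<lambda>x. cnj (h x)) \<xi> * (cis ((s *\<^sub>R x) \<bullet> \<xi>) * complex_of_real (gauss (d *\<^sub>R \<xi>))) \<partial>lborel)"
      unfolding ft_def[of s k x] k_def H_def cnj_ft by (simp add: mult_ac inner_commute)
    also have "\<dots> = (\<integral>y. cnj (h y) * ft (-s) (\<lambda>\<xi>. cis ((s *\<^sub>R x) \<bullet> \<xi>) * complex_of_real (gauss (d *\<^sub>R \<xi>))) y \<partial>lborel)"
      using assms ft_gauss(1)[OF assms(4,1), of "s *\<^sub>R x"] by (intro ft_mult_formula) auto
    also have "\<dots> = (\<integral>y. cnj (h y) * gker d (x - y) \<partial>lborel)"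
    proof -
      have "(- s * s) = -1" using assms(1) by (metis abs_mult_self_eq mult_1 mult_minus_left)
      then have "(- s) *\<^sub>R s *\<^sub>R x + y = y - x" for y by (simp add: scaleR_scaleR del: mult_minus_left)
      then show ?thesis using assms by (subst ft_gauss(2)) (auto simp: gker_minus_commute[of d x])
    qed
    finally show ?thesis .
  qed
  have "complex_of_real (\<integral>\<xi>. gauss (d *\<^sub>R \<xi>) * (norm (H \<xi>))\<^sup>2 \<partial>lborel) = (\<integral>\<xi>. H \<xi> * k \<xi> \<partial>lborel)"
    unfolding kH integral_complex_of_real ..
  also have "\<dots> = (\<integral>x. h x * ft s k x \<partial>lborel)"
    unfolding H_def by (rule ft_mult_formula[OF assms(2) k])
  finally have pairing: "complex_of_real (\<integral>\<xi>. gauss (d *\<^sub>R \<xi>) * (norm (H \<xi>))\<^sup>2 \<partial>lborel) = (\<integral>x. h x * ft s k x \<partial>lborel)" .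
  have "(\<integral>\<xi>. gauss (d *\<^sub>R \<xi>) * (norm (H \<xi>))\<^sup>2 \<partial>lborel) = norm (\<integral>x. h x * ft s k x \<partial>lborel)"
  proof -
    have "0 \<le> (\<integral>\<xi>. gauss (d *\<^sub>R \<xi>) * (norm (H \<xi>))\<^sup>2 \<partial>lborel)" by (intro Bochner_Integration.integral_nonneg) simp
    with arg_cong[OF pairing, of norm] show ?thesis unfolding norm_of_real by (simp only: abs_of_nonneg)
  qed
  then have "(\<integral>\<^sup>+\<xi>. ennreal (gauss (d *\<^sub>R \<xi>) * (norm (H \<xi>))\<^sup>2) \<partial>lborel) = ennreal (norm (\<integral>x. h x * ft s k x \<partial>lborel))"
    using nn_integral_eq_integral[OF iW] by simp
  \<comment> \<open>From here on the integrals are extended, so Tonelli applies to the double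
    integral before it is known to be finite.\<close>
  also have "\<dots> \<le> (\<integral>\<^sup>+x. ennreal (norm (h x * ft s k x)) \<partial>lborel)"
    by (rule norm_integral_le_nn_integral)
  also have "\<dots> \<le> (\<integral>\<^sup>+x. (\<integral>\<^sup>+y. ennreal ((norm (h x))\<^sup>2 / 2 * gker d (x - y)) + ennreal ((norm (h y))\<^sup>2 / 2 * gker d (x - y)) \<partial>lborel) \<partial>lborel)"
  proof (rule nn_integral_mono)
    fix x :: 'a
    have [measurable]: "(\<lambda>y. gker d (x - y)) \<in> borel_measurable borel" by measurable
    have "ennreal (norm (ft s k x)) \<le> (\<integral>\<^sup>+y. ennreal (norm (h y) * gker d (x - y)) \<partial>lborel)"
      unfolding ftk
      using norm_integral_le_nn_integral[of lborel "\<lambda>y. cnj (h y) * gker d (x - y)"]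
      by (simp add: norm_mult abs_of_nonneg[OF gker_nonneg[OF assms(4)]])
    then have "ennreal (norm (h x * ft s k x)) \<le> ennreal (norm (h x)) * (\<integral>\<^sup>+y. ennreal (norm (h y) * gker d (x - y)) \<partial>lborel)"
      by (simp add: norm_mult ennreal_mult' mult_left_mono)
    also have "\<dots> = (\<integral>\<^sup>+y. ennreal (norm (h x) * (norm (h y) * gker d (x - y))) \<partial>lborel)"
      by (subst nn_integral_cmult[symmetric]) (auto simp: ennreal_mult')
    also have "\<dots> \<le> (\<integral>\<^sup>+y. ennreal ((norm (h x))\<^sup>2 / 2 * gker d (x - y)) + ennreal ((norm (h y))\<^sup>2 / 2 * gker d (x - y)) \<partial>lborel)"
    proof (rule nn_integral_mono)
      fix y
      have "norm (h x) * norm (h y) \<le> (norm (h x))\<^sup>2 / 2 + (norm (h y))\<^sup>2 / 2"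
        using sum_squares_bound[of "norm (h x)" "norm (h y)"] by simp
      then have "norm (h x) * norm (h y) * gker d (x - y) \<le> ((norm (h x))\<^sup>2 / 2 + (norm (h y))\<^sup>2 / 2) * gker d (x - y)"
        by (rule mult_right_mono) (rule gker_nonneg[OF assms(4)])
      then show "ennreal (norm (h x) * (norm (h y) * gker d (x - y))) \<le> ennreal ((norm (h x))\<^sup>2 / 2 * gker d (x - y)) + ennreal ((norm (h y))\<^sup>2 / 2 * gker d (x - y))"
        unfolding distrib_right mult.assoc[symmetric]
        by (subst ennreal_plus[symmetric]) (use gker_nonneg[OF assms(4), of "x - y"] in \<open>auto intro!: ennreal_leI simp del: ennreal_plus\<close>)
    qed
    finally show "ennreal (norm (h x * ft s k x)) \<le> (\<integral>\<^sup>+y. ennreal ((norm (h x))\<^sup>2 / 2 * gker d (x - y)) + ennreal ((norm (h y))\<^sup>2 / 2 * gker d (x - y)) \<partial>lborel)" .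
  qed
  also have "\<dots> = (\<integral>\<^sup>+x. (\<integral>\<^sup>+y. ennreal ((norm (h x))\<^sup>2 / 2 * gker d (x - y)) \<partial>lborel) \<partial>lborel) + (\<integral>\<^sup>+x. (\<integral>\<^sup>+y. ennreal ((norm (h y))\<^sup>2 / 2 * gker d (x - y)) \<partial>lborel) \<partial>lborel)"
    by (simp add: nn_integral_add)
  also have "(\<integral>\<^sup>+x. (\<integral>\<^sup>+y. ennreal ((norm (h y))\<^sup>2 / 2 * gker d (x - y)) \<partial>lborel) \<partial>lborel) = (\<integral>\<^sup>+y. (\<integral>\<^sup>+x. ennreal ((norm (h y))\<^sup>2 / 2 * gker d (y - x)) \<partial>lborel) \<partial>lborel)"
    by (subst lborel_pair.Fubini') (auto simp: gker_minus_commute)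
  also have "(\<integral>\<^sup>+x. (\<integral>\<^sup>+y. ennreal ((norm (h x))\<^sup>2 / 2 * gker d (x - y)) \<partial>lborel) \<partial>lborel) = ennreal ((2 * pi) ^ DIM('a) * (l2 h)\<^sup>2 / 2)"
  proof -
    have "(\<integral>\<^sup>+y. ennreal ((norm (h x))\<^sup>2 / 2 * gker d (x - y)) \<partial>lborel) = ennreal ((2 * pi) ^ DIM('a) / 2) * ennreal ((norm (h x))\<^sup>2)" for x
    proof -
      have "(\<integral>\<^sup>+y. ennreal ((norm (h x))\<^sup>2 / 2 * gker d (x - y)) \<partial>lborel) = ennreal ((norm (h x))\<^sup>2 / 2) * (\<integral>\<^sup>+y. ennreal (gker d (x - y)) \<partial>lborel)"
        by (subst nn_integral_cmult[symmetric]) (auto simp: ennreal_mult' simp del: times_divide_eq_left)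
      also have "\<dots> = ennreal ((norm (h x))\<^sup>2 / 2 * (2 * pi) ^ DIM('a))"
        by (simp only: gker_translate(3)[OF assms(4)] ennreal_mult'[symmetric] zero_le_divide_iff zero_le_power2 zero_le_numeral simp_thms)
      also have "\<dots> = ennreal ((2 * pi) ^ DIM('a) / 2 * (norm (h x))\<^sup>2)" by (simp add: mult_ac)
      finally show ?thesis by (simp add: ennreal_mult' del: times_divide_eq_left)
    qed
    then have "(\<integral>\<^sup>+x. (\<integral>\<^sup>+y. ennreal ((norm (h x))\<^sup>2 / 2 * gker d (x - y)) \<partial>lborel) \<partial>lborel) = (\<integral>\<^sup>+x. ennreal ((2 * pi) ^ DIM('a) / 2) * ennreal ((norm (h x))\<^sup>2) \<partial>lborel)"
      by (simp only:)
    also have "\<dots> = ennreal ((2 * pi) ^ DIM('a) / 2) * ennreal ((l2 h)\<^sup>2)"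
      by (subst nn_integral_cmult) (simp_all add: nn_integral_L2[OF assms(3)])
    also have "\<dots> = ennreal ((2 * pi) ^ DIM('a) / 2 * (l2 h)\<^sup>2)"
      by (rule ennreal_mult'[symmetric]) simp
    finally show ?thesis by simp
  qed
  also have "ennreal ((2 * pi) ^ DIM('a) * (l2 h)\<^sup>2 / 2) + ennreal ((2 * pi) ^ DIM('a) * (l2 h)\<^sup>2 / 2) = ennreal ((2 * pi) ^ DIM('a) * (l2 h)\<^sup>2)"
    by (subst ennreal_plus[symmetric]) (auto simp del: ennreal_plus)
  finally show ?thesis unfolding H_def .
qed

lemma gauss_scaled_tendsto:
  fixes x :: "'a::euclidean_space"
  shows "(\<lambda>n. gauss ((1 / real (Suc n)) *\<^sub>R x)) \<longlonglongrightarrow> 1"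
proof -
  have "(\<lambda>n. exp (- (norm ((1 / real (Suc n)) *\<^sub>R x))\<^sup>2 / 2)) \<longlonglongrightarrow> exp (- (norm (0 *\<^sub>R x))\<^sup>2 / 2)"
    using LIMSEQ_Suc[OF lim_inverse_n'] by (intro tendsto_intros) auto
  then show ?thesis by (simp add: gauss_def)
qed

text \<open>Fatou's lemma as the Gaussian weights tend to 1.\<close>

lemma ft_plancherel_le:
  fixes h :: "'a::euclidean_space \<Rightarrow> complex"
  assumes "\<bar>s\<bar> = 1" "integrable lborel h" "L2 h"
  shows "(\<integral>\<^sup>+\<xi>. ennreal ((norm (ft s h \<xi>))\<^sup>2) \<partial>lborel) \<le> ennreal ((2 * pi) ^ DIM('a) * (l2 h)\<^sup>2)"
proof -
  note [measurable] = borel_measurable_integrable[OF assms(2)]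
  have "(\<lambda>n. ennreal (gauss ((1 / real (Suc n)) *\<^sub>R \<xi>) * (norm (ft s h \<xi>))\<^sup>2)) \<longlonglongrightarrow> ennreal (1 * (norm (ft s h \<xi>))\<^sup>2)" for \<xi>
    by (intro tendsto_ennrealI tendsto_mult tendsto_const gauss_scaled_tendsto)
  then have "ennreal ((norm (ft s h \<xi>))\<^sup>2) = liminf (\<lambda>n. ennreal (gauss ((1 / real (Suc n)) *\<^sub>R \<xi>) * (norm (ft s h \<xi>))\<^sup>2))" for \<xi>
    by (metis lim_imp_Liminf trivial_limit_sequentially mult_1)
  then have "(\<integral>\<^sup>+\<xi>. ennreal ((norm (ft s h \<xi>))\<^sup>2) \<partial>lborel)
    = (\<integral>\<^sup>+\<xi>. liminf (\<lambda>n. ennreal (gauss ((1 / real (Suc n)) *\<^sub>R \<xi>) * (norm (ft s h \<xi>))\<^sup>2)) \<partial>lborel)" by simp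
  also have "\<dots> \<le> liminf (\<lambda>n. \<integral>\<^sup>+\<xi>. ennreal (gauss ((1 / real (Suc n)) *\<^sub>R \<xi>) * (norm (ft s h \<xi>))\<^sup>2) \<partial>lborel)"
    by (rule nn_integral_liminf) measurable
  also have "\<dots> \<le> liminf (\<lambda>n. ennreal ((2 * pi) ^ DIM('a) * (l2 h)\<^sup>2))"
    by (intro Liminf_mono always_eventually allI ft_gauss_weighted assms) auto
  also have "\<dots> = ennreal ((2 * pi) ^ DIM('a) * (l2 h)\<^sup>2)" by (simp add: Liminf_const)
  finally show ?thesis .
qed

text \<open>Substituting x = y + d u moves d into the argument of psi, where continuity at y acts
  pointwise and B times the Gaussian dominates.\<close>

lemma gker_approx_bounded:
  fixes \<psi> :: "'a::euclidean_space \<Rightarrow> complex"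
  assumes [measurable]: "\<psi> \<in> borel_measurable borel" and bd: "\<And>x. norm (\<psi> x) \<le> B" and cont: "isCont \<psi> y"
  shows "(\<lambda>n. \<integral>x. \<psi> x * gker (1 / real (Suc n)) (y - x) \<partial>lborel) \<longlonglongrightarrow> (2 * pi) ^ DIM('a) * \<psi> y"
proof -
  \<comment> \<open>The square root of the mass: one factor c is left over from the kernel after
    rescaling, the other is the integral of the Gaussian.\<close>
  define c :: complex where "c = complex_of_real (sqrt (2 * pi)) ^ DIM('a)"
  have cc: "c * c = (2 * pi) ^ DIM('a)"
  proof -
    have "c * c = complex_of_real ((sqrt (2 * pi) * sqrt (2 * pi)) ^ DIM('a))"
      unfolding c_def by (simp only: power_mult_distrib of_real_mult of_real_power)
    then show ?thesis by (simp only: real_sqrt_mult_self) simp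
  qed
  have eq: "(\<integral>x. \<psi> x * gker d (y - x) \<partial>lborel) = c * (\<integral>u. \<psi> (y + d *\<^sub>R u) * gauss u \<partial>lborel)" if "d > 0" for d
  proof -
    have "(\<integral>x. \<psi> x * gker d (y - x) \<partial>lborel) = d ^ DIM('a) *\<^sub>R (\<integral>u. \<psi> (y + d *\<^sub>R u) * gker d (y - (y + d *\<^sub>R u)) \<partial>lborel)"
      using that by (subst lborel_affine_euclid(2)[of d _ y]) auto
    also have "(\<lambda>u. \<psi> (y + d *\<^sub>R u) * gker d (y - (y + d *\<^sub>R u))) = (\<lambda>u. (c / d ^ DIM('a)) * (\<psi> (y + d *\<^sub>R u) * gauss u))"
      using that by (auto simp: gker_def c_def power_divide)
    also have "d ^ DIM('a) *\<^sub>R (\<integral>u. (c / d ^ DIM('a)) * (\<psi> (y + d *\<^sub>R u) * gauss u) \<partial>lborel) = c * (\<integral>u. \<psi> (y + d *\<^sub>R u) * gauss u \<partial>lborel)"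
      using that by (simp add: scaleR_conv_of_real)
    finally show ?thesis .
  qed
  have "(\<lambda>n. \<integral>u. \<psi> (y + (1 / real (Suc n)) *\<^sub>R u) * gauss u \<partial>lborel) \<longlonglongrightarrow> (\<integral>u. \<psi> y * complex_of_real (gauss (u::'a)) \<partial>lborel)"
  proof (rule integral_dominated_convergence)
    show "integrable lborel (\<lambda>u::'a. B * gauss u)" by (intro integrable_mult_right gauss_integrable)
    show "AE u::'a in lborel. norm (\<psi> (y + (1 / real (Suc n)) *\<^sub>R u) * gauss u) \<le> B * gauss u" for n
      using bd by (auto simp: norm_mult intro!: mult_right_mono)
    show "AE u in lborel. (\<lambda>n. \<psi> (y + (1 / real (Suc n)) *\<^sub>R u) * gauss u) \<longlonglongrightarrow> \<psi> y * gauss u"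
    proof (rule AE_I2)
      fix u :: 'a
      have "(\<lambda>n. y + (1 / real (Suc n)) *\<^sub>R u) \<longlonglongrightarrow> y + 0 *\<^sub>R u"
        using LIMSEQ_Suc[OF lim_inverse_n'] by (intro tendsto_intros) auto
      then have "(\<lambda>n. \<psi> (y + (1 / real (Suc n)) *\<^sub>R u)) \<longlonglongrightarrow> \<psi> y"
        using isCont_tendsto_compose[OF cont] by auto
      then show "(\<lambda>n. \<psi> (y + (1 / real (Suc n)) *\<^sub>R u) * gauss u) \<longlonglongrightarrow> \<psi> y * gauss u"
        by (intro tendsto_intros)
    qed
  qed auto
  then have "(\<lambda>n. c * (\<integral>u. \<psi> (y + (1 / real (Suc n)) *\<^sub>R u) * gauss u \<partial>lborel)) \<longlonglongrightarrow> c * (\<integral>u. \<psi> y * complex_of_real (gauss (u::'a)) \<partial>lborel)"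
    by (intro tendsto_intros)
  also have "(\<integral>u. \<psi> y * complex_of_real (gauss (u::'a)) \<partial>lborel) = \<psi> y * c"
    using gauss_fourier(2)[of "0::'a"] by (simp add: c_def)
  also have "c * (\<psi> y * c) = (2 * pi) ^ DIM('a) * \<psi> y" using cc by (simp add: mult_ac)
  finally show ?thesis by (subst eq) auto
qed

text \<open>With N = n + 1 the exponent N^2 |z|^2 / 2 is split into halves. Since |z| >= r, one half
  gives decay in N; the other, since N >= 1, leaves a fixed Gaussian that can be paired with an L2
  function.\<close>

lemma gker_away_le:
  fixes z :: "'a::euclidean_space"
  assumes "r > 0" "r \<le> norm z"
  shows "gker (1 / real (Suc n)) z \<le> (sqrt (2 * pi) * real (Suc n)) ^ DIM('a) * exp (- (r\<^sup>2 / 4) * real (Suc n)) * gauss ((1/2) *\<^sub>R z)"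
proof -
  define N where "N = real (Suc n)"
  have N: "1 \<le> N" by (simp add: N_def)
  have "r\<^sup>2 \<le> (norm z)\<^sup>2" using assms by (intro power_mono) auto
  then have "r\<^sup>2 * N \<le> (norm z)\<^sup>2 * N\<^sup>2" using N by (intro mult_mono) (auto simp: power2_eq_square)
  moreover have "(norm z)\<^sup>2 * 1 \<le> (norm z)\<^sup>2 * N\<^sup>2" using N by (intro mult_mono) (auto intro: one_le_power)
  moreover have "(norm (N *\<^sub>R z))\<^sup>2 = (norm z)\<^sup>2 * N\<^sup>2" "(norm ((1/2) *\<^sub>R z))\<^sup>2 = (norm z)\<^sup>2 / 4"
    by (simp_all add: power_mult_distrib power_divide)
  ultimately have "- (norm (N *\<^sub>R z))\<^sup>2 / 2 \<le> - (r\<^sup>2 / 4) * N + - (norm ((1/2) *\<^sub>R z))\<^sup>2 / 2"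
    using zero_le_power2[of "norm z"] by linarith
  then have "gauss (N *\<^sub>R z) \<le> exp (- (r\<^sup>2 / 4) * N) * gauss ((1/2) *\<^sub>R z)"
    unfolding gauss_def mult_exp_exp by (subst exp_le_cancel_iff)
  then have "(sqrt (2 * pi) * N) ^ DIM('a) * gauss (N *\<^sub>R z) \<le> (sqrt (2 * pi) * N) ^ DIM('a) * (exp (- (r\<^sup>2 / 4) * N) * gauss ((1/2) *\<^sub>R z))"
    using N by (intro mult_left_mono) auto
  then show ?thesis by (simp add: gker_def mult.assoc N_def)
qed

lemma power_times_exp_neg_tendsto:
  assumes "c > 0"
  shows "(\<lambda>n. (b * real (Suc n)) ^ k * exp (- c * real (Suc n))) \<longlonglongrightarrow> 0"
proof -
  have f: "filterlim (\<lambda>n. c * real (Suc n)) at_top sequentially"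
    by (rule filterlim_tendsto_pos_mult_at_top[OF tendsto_const assms filterlim_compose[OF filterlim_real_sequentially filterlim_Suc]])
  have "(\<lambda>n. (b / c) ^ k * ((c * real (Suc n)) ^ k / exp (c * real (Suc n)))) \<longlonglongrightarrow> (b / c) ^ k * 0"
    by (intro tendsto_mult tendsto_const filterlim_compose[OF tendsto_power_div_exp_0 f])
  moreover have "(b / c) ^ k * ((c * x) ^ k / exp (c * x)) = (b * x) ^ k * exp (- c * x)" for x
  proof -
    have "(b / c) ^ k * (c * x) ^ k = (b * x) ^ k"
      unfolding power_mult_distrib[symmetric] using assms by simp
    then show ?thesis by (simp only: times_divide_eq_right) (simp add: exp_minus divide_inverse)
  qed
  ultimately show ?thesis by simp
qed

text \<open>Continuity makes h bounded near y, where the bounded case applies. Away from y,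
  Cauchy-Schwarz against the fixed Gaussian of \<open>gker_away_le\<close> leaves a factor tending
  to 0.\<close>

lemma gker_approx_L2:
  fixes h :: "'a::euclidean_space \<Rightarrow> complex"
  assumes h: "L2 h" and cont: "isCont h y"
  shows "(\<lambda>n. \<integral>x. h x * gker (1 / real (Suc n)) (y - x) \<partial>lborel) \<longlonglongrightarrow> (2 * pi) ^ DIM('a) * h y"
proof -
  note [measurable] = L2_measurable[OF h]
  obtain r where r: "r > 0" "\<And>x. dist x y < r \<Longrightarrow> dist (h x) (h y) < 1"
    using cont unfolding continuous_at_eps_delta by (metis zero_less_one)
  define h1 where "h1 x = indicator (ball y r) x *\<^sub>R h x" for x
  define h2 where "h2 x = indicator (- ball y r) x *\<^sub>R h x" for x
  have [measurable]: "h1 \<in> borel_measurable borel" "h2 \<in> borel_measurable borel"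
    unfolding h1_def h2_def by (intro borel_measurable_scaleR borel_measurable_indicator; simp)+
  have h12: "h x = h1 x + h2 x" for x by (simp add: h1_def h2_def indicator_def)
  have b1: "norm (h1 x) \<le> 1 + norm (h y)" for x
    using r(2)[of x] norm_triangle_ineq2[of "h x" "h y"]
    by (auto simp: h1_def indicator_def dist_norm norm_minus_commute[of y x] add_nonneg_nonneg)
  have "isCont h1 y"
  proof -
    have "eventually (\<lambda>x. h1 x = h x) (nhds y)"
      using eventually_nhds_ball[OF r(1), of y] by eventually_elim (simp add: h1_def)
    then show ?thesis using cont by (simp add: isCont_cong)
  qed
  from gker_approx_bounded[OF _ b1 this]
  have lim1: "(\<lambda>n. \<integral>x. h1 x * gker (1 / real (Suc n)) (y - x) \<partial>lborel) \<longlonglongrightarrow> (2 * pi) ^ DIM('a) * h1 y"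
    by simp
  have h1y: "h1 y = h y" using r by (simp add: h1_def)
  have L: "L2 (\<lambda>x. gauss ((1/2) *\<^sub>R (y - x)))"
  proof -
    have "integrable lborel (\<lambda>x. (gauss ((1/2) *\<^sub>R (y + (-1) *\<^sub>R x)))\<^sup>2)"
      using L2_gauss_scaled[of "1/2", where 'a='a] by (subst lborel_affine_euclid(1)[of "-1" "\<lambda>x. (gauss ((1/2) *\<^sub>R x))\<^sup>2"]) (auto simp: L2_def)
    then show ?thesis by (simp add: L2_def)
  qed
  define D where "D = (\<integral>x. norm (h x) * norm (gauss ((1/2) *\<^sub>R (y - x))) \<partial>lborel)"
  note iD = L2_Cauchy_Schwarz(1)[OF h L]
  define e where "e n = (sqrt (2 * pi) * real (Suc n)) ^ DIM('a) * exp (- (r\<^sup>2 / 4) * real (Suc n))" for n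
  have e0: "0 \<le> e n" for n by (simp add: e_def)
  have pw: "norm (h2 x * gker (1 / real (Suc n)) (y - x)) \<le> e n * (norm (h x) * norm (gauss ((1/2) *\<^sub>R (y - x))))" for n x
  proof (cases "x \<in> ball y r")
    case True then show ?thesis using e0 by (simp add: h2_def)
  next
    case False
    then have "r \<le> norm (y - x)" by (simp add: dist_norm)
    from gker_away_le[OF r(1) this, of n] have "gker (1 / real (Suc n)) (y - x) \<le> e n * gauss ((1/2) *\<^sub>R (y - x))"
      by (simp add: e_def)
    from mult_left_mono[OF this, of "norm (h x)"]
    show ?thesis using False gker_nonneg[of "1 / real (Suc n)" "y - x"] by (simp add: h2_def norm_mult mult_ac)
  qed
  have i2: "integrable lborel (\<lambda>x. h2 x * gker (1 / real (Suc n)) (y - x))" for n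
    by (rule Bochner_Integration.integrable_bound[OF integrable_mult_right[OF iD, of "e n"]])
       (use pw e0 in \<open>auto simp: abs_mult\<close>)
  have "norm (\<integral>x. h2 x * gker (1 / real (Suc n)) (y - x) \<partial>lborel) \<le> e n * D" for n
  proof -
    have "norm (\<integral>x. h2 x * gker (1 / real (Suc n)) (y - x) \<partial>lborel) \<le> (\<integral>x. norm (h2 x * gker (1 / real (Suc n)) (y - x)) \<partial>lborel)"
      by (rule integral_norm_bound)
    also have "\<dots> \<le> (\<integral>x. e n * (norm (h x) * norm (gauss ((1/2) *\<^sub>R (y - x)))) \<partial>lborel)"
      by (rule integral_mono[OF integrable_norm[OF i2] integrable_mult_right[OF iD] pw])
    also have "\<dots> = e n * D" by (simp only: integral_mult_right_zero D_def)
    finally show ?thesis .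
  qed
  then have le2: "\<forall>n. norm (\<integral>x. h2 x * gker (1 / real (Suc n)) (y - x) \<partial>lborel) \<le> e n * D" ..
  have "(\<lambda>n. e n * D) \<longlonglongrightarrow> 0"
    using tendsto_mult[OF power_times_exp_neg_tendsto[of "r\<^sup>2/4" "sqrt (2*pi)" "DIM('a)"] tendsto_const[of D]] r(1)
    by (simp add: e_def)
  then have lim2: "(\<lambda>n. \<integral>x. h2 x * gker (1 / real (Suc n)) (y - x) \<partial>lborel) \<longlonglongrightarrow> 0"
    by (rule Lim_null_comparison[OF always_eventually[OF le2]])
  have i1: "integrable lborel (\<lambda>x. h1 x * gker (1 / real (Suc n)) (y - x))" for n
  proof (rule Bochner_Integration.integrable_bound)
    show "integrable lborel (\<lambda>x. (1 + norm (h y)) * gker (1 / real (Suc n)) (y - x))"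
      by (intro integrable_mult_right gker_translate) simp
    show "AE x in lborel. norm (h1 x * gker (1 / real (Suc n)) (y - x)) \<le> norm ((1 + norm (h y)) * gker (1 / real (Suc n)) (y - x))"
      by (rule AE_I2) (auto simp: norm_mult abs_mult intro!: mult_mono order_trans[OF b1])
  qed measurable
  have "(\<integral>x. h x * gker (1 / real (Suc n)) (y - x) \<partial>lborel) = (\<integral>x. h1 x * gker (1 / real (Suc n)) (y - x) \<partial>lborel) + (\<integral>x. h2 x * gker (1 / real (Suc n)) (y - x) \<partial>lborel)" for n
    unfolding h12 distrib_right by (rule Bochner_Integration.integral_add[OF i1 i2])
  then show ?thesis using tendsto_add[OF lim1 lim2] by (simp add: h1y)
qed

section \<open>Injectivity of the transform on L1\<close>

lemma gker_bounded_convolution: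
  fixes \<psi> :: "'a::euclidean_space \<Rightarrow> complex"
  assumes "\<psi> \<in> borel_measurable borel" "\<And>x. norm (\<psi> x) \<le> B" "d > 0"
  shows "integrable lborel (\<lambda>y. \<psi> y * complex_of_real (gker d (x - y)))"
    and "(\<integral>y. norm (\<psi> y * complex_of_real (gker d (x - y))) \<partial>lborel) \<le> B * (2 * pi) ^ DIM('a)"
proof -
  note [measurable] = assms(1)
  have le: "norm (\<psi> y * complex_of_real (gker d (x - y))) \<le> B * gker d (x - y)" for y
    unfolding norm_mult norm_of_real abs_of_nonneg[OF gker_nonneg[OF assms(3)]]
    by (intro mult_right_mono assms(2) gker_nonneg assms(3))
  have iB: "integrable lborel (\<lambda>y. B * gker d (x - y))" by (intro integrable_mult_right gker_translate assms)
  show i: "integrable lborel (\<lambda>y. \<psi> y * complex_of_real (gker d (x - y)))"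
    by (rule Bochner_Integration.integrable_bound[OF iB]) (auto intro!: AE_I2 order_trans[OF le])
  have "(\<integral>y. norm (\<psi> y * complex_of_real (gker d (x - y))) \<partial>lborel) \<le> (\<integral>y. B * gker d (x - y) \<partial>lborel)"
    by (rule integral_mono[OF integrable_norm[OF i] iB le])
  also have "\<dots> = B * (2 * pi) ^ DIM('a)" by (simp only: integral_mult_right_zero gker_translate[OF assms(3)])
  finally show "(\<integral>y. norm (\<psi> y * complex_of_real (gker d (x - y))) \<partial>lborel) \<le> B * (2 * pi) ^ DIM('a)" .
qed

lemma integrable_pair_bounded_kernel:
  assumes "integrable lborel k" "\<psi> \<in> borel_measurable borel" "\<And>x. norm (\<psi> x) \<le> B" "d > 0"
  shows "integrable (lborel \<Otimes>\<^sub>M lborel) (\<lambda>(x, y). (k (x::'a::euclidean_space) :: complex) * (\<psi> y * complex_of_real (gker d (x - y))))"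
proof -
  note [measurable] = borel_measurable_integrable[OF assms(1)] assms(2)
  have B: "0 \<le> B" using assms(3) norm_ge_zero order_trans by blast
  show ?thesis
  proof (rule lborel_pair.Fubini_integrable)
    show "integrable lborel (\<lambda>x. \<integral>y. norm (case (x, y) of (x, y) \<Rightarrow> k x * (\<psi> y * complex_of_real (gker d (x - y)))) \<partial>lborel)"
    proof (rule Bochner_Integration.integrable_bound)
      show "integrable lborel (\<lambda>x. norm (k x) * (B * (2 * pi) ^ DIM('a)))"
        using assms(1) by simp
      show "AE x in lborel. norm (\<integral>y. norm (case (x, y) of (x, y) \<Rightarrow> k x * (\<psi> y * complex_of_real (gker d (x - y)))) \<partial>lborel) \<le> norm (norm (k x) * (B * (2 * pi) ^ DIM('a)))"
        unfolding prod.case norm_mult[of "k _"] integral_mult_right_zero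
        using B gker_bounded_convolution(2)[OF assms(2-4)]
        by (intro AE_I2) (simp add: abs_mult mult_left_mono Bochner_Integration.integral_nonneg)
    qed measurable
  qed (auto intro!: integrable_mult_right gker_bounded_convolution(1) assms)
qed

text \<open>Each translate of \<open>gker d\<close> is itself a transform, so by the multiplication
  formula k is orthogonal to it, hence by Fubini to the convolution of psi with
  \<open>gker d\<close>; these convolutions tend boundedly to a multiple of psi.\<close>

lemma ft_eq_0_imp_integral_eq_0:
  fixes k \<psi> :: "'a::euclidean_space \<Rightarrow> complex"
  assumes "integrable lborel k" "\<And>x. ft 1 k x = 0" "continuous_on UNIV \<psi>" "\<And>x. norm (\<psi> x) \<le> B"
  shows "(\<integral>x. k x * \<psi> x \<partial>lborel) = 0"
proof -
  have [measurable]: "\<psi> \<in> borel_measurable borel" using assms(3) by (rule borel_measurable_continuous_onI)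
  note [measurable] = borel_measurable_integrable[OF assms(1)]
  have B: "0 \<le> B" using assms(4) norm_ge_zero order_trans by blast
  define c :: complex where "c = (2 * pi) ^ DIM('a)"
  let ?d = "\<lambda>n. 1 / real (Suc n)"
  have z: "(\<integral>x. k x * gker d (x - y) \<partial>lborel) = 0" if "d > 0" for d y
  proof -
    have "(\<integral>x. k x * gker d (x - y) \<partial>lborel) = (\<integral>x. k x * ft 1 (\<lambda>x. cis ((- y) \<bullet> x) * complex_of_real (gauss (d *\<^sub>R x))) x \<partial>lborel)"
      by (subst ft_gauss(2)[OF that]) auto
    also have "\<dots> = (\<integral>x. ft 1 k x * (cis ((- y) \<bullet> x) * complex_of_real (gauss (d *\<^sub>R x))) \<partial>lborel)"
      by (rule ft_mult_formula[symmetric, OF assms(1) ft_gauss(1)[OF that, of 1]]) simp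
    finally show ?thesis by (simp add: assms(2))
  qed
  have "(\<integral>x. k x * (\<integral>y. \<psi> y * gker d (x - y) \<partial>lborel) \<partial>lborel) = 0" if "d > 0" for d
  proof -
    have "(\<integral>x. k x * (\<integral>y. \<psi> y * gker d (x - y) \<partial>lborel) \<partial>lborel) = (\<integral>x. \<integral>y. k x * (\<psi> y * gker d (x - y)) \<partial>lborel \<partial>lborel)"
      by simp
    also have "\<dots> = (\<integral>y. \<integral>x. k x * (\<psi> y * gker d (x - y)) \<partial>lborel \<partial>lborel)"
      using lborel_pair.Fubini_integral[OF integrable_pair_bounded_kernel[OF assms(1) _ assms(4) that]] by simp
    also have "\<dots> = (\<integral>y. \<psi> y * (\<integral>x. k x * gker d (x - y) \<partial>lborel) \<partial>lborel)"
      by (simp add: mult_ac flip: integral_mult_right_zero)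
    finally show ?thesis by (simp add: z[OF that])
  qed
  then have zero: "(\<lambda>n. \<integral>x. k x * (\<integral>y. \<psi> y * gker (?d n) (x - y) \<partial>lborel) \<partial>lborel) = (\<lambda>n. 0)" by simp
  have "(\<lambda>n. \<integral>x. k x * (\<integral>y. \<psi> y * gker (?d n) (x - y) \<partial>lborel) \<partial>lborel) \<longlonglongrightarrow> (\<integral>x. k x * (c * \<psi> x) \<partial>lborel)"
  proof (rule integral_dominated_convergence)
    show "integrable lborel (\<lambda>x. norm (k x) * (B * (2 * pi) ^ DIM('a)))" using assms(1) by simp
    show "AE x in lborel. (\<lambda>n. k x * (\<integral>y. \<psi> y * gker (?d n) (x - y) \<partial>lborel)) \<longlonglongrightarrow> k x * (c * \<psi> x)"
      unfolding c_def using assms(3) by (intro AE_I2 tendsto_mult tendsto_const gker_approx_bounded[OF _ assms(4)]) (auto simp: continuous_on_eq_continuous_at)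
    have "norm (\<integral>y. \<psi> y * complex_of_real (gker (?d n) (x - y)) \<partial>lborel) \<le> B * (2 * pi) ^ DIM('a)" for x n
      by (rule order_trans[OF integral_norm_bound gker_bounded_convolution(2)[OF _ assms(4)]]) auto
    then show "AE x in lborel. norm (k x * (\<integral>y. \<psi> y * gker (?d n) (x - y) \<partial>lborel)) \<le> norm (k x) * (B * (2 * pi) ^ DIM('a))" for n
      by (intro AE_I2) (simp only: norm_mult mult_left_mono norm_ge_zero)
  qed measurable
  then have "(\<integral>x. k x * (c * \<psi> x) \<partial>lborel) = 0" unfolding zero by (simp only: LIMSEQ_const_iff)
  then have "c * (\<integral>x. k x * \<psi> x \<partial>lborel) = 0" by (simp add: mult_ac flip: integral_mult_right_zero)
  then show ?thesis by (simp add: c_def)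
qed

text \<open>Testing with the conjugate phase of k would give its L1 norm. The phase is only
  measurable, so it is reached as a limit of bounded continuous functions, to which the previous
  lemma applies.\<close>

lemma ft_unique:
  fixes k :: "'a::euclidean_space \<Rightarrow> complex"
  assumes "integrable lborel k" "\<And>x. ft 1 k x = 0"
  shows "AE x in lborel. k x = 0"
proof -
  note [measurable] = borel_measurable_integrable[OF assms(1)]
  define \<phi> where "\<phi> x = cnj (sgn (k x))" for x
  have [measurable]: "\<phi> \<in> borel_measurable borel" unfolding \<phi>_def sgn_div_norm by measurable
  \<comment> \<open>This notion of measurability provides continuous functions converging pointwise
    off a negligible set.\<close>
  have "\<phi> measurable_on UNIV"
    by (rule lebesgue_measurable_imp_measurable_on) (auto simp: measurable_completion)
  then obtain N g where N: "negligible N" and g: "\<And>n. continuous_on UNIV (g n)"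
    "\<And>x. x \<notin> N \<Longrightarrow> (\<lambda>n. g n x) \<longlonglongrightarrow> \<phi> x"
    unfolding measurable_on_def by auto
  have AEN: "AE x in lebesgue. x \<notin> N"
    using N by (intro AE_not_in) (simp add: negligible_iff_null_sets)
  \<comment> \<open>Radial truncation to the unit disc keeps continuity and supplies the uniform
    bound; the limit is unchanged because the phase has modulus at most 1.\<close>
  define G where "G n x = g n x /\<^sub>R max 1 (norm (g n x))" for n x
  have Gc: "continuous_on UNIV (G n)" for n
    unfolding G_def by (intro continuous_intros g) (auto simp: max_def)
  have [measurable]: "G n \<in> borel_measurable borel" for n using Gc by (rule borel_measurable_continuous_onI)
  have Gb: "norm (G n x) \<le> 1" for n x
    by (simp add: G_def field_simps)
  have Glim: "AE x in lebesgue. (\<lambda>n. G n x) \<longlonglongrightarrow> \<phi> x"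
    using AEN
  proof eventually_elim
    fix x assume "x \<notin> N"
    from g(2)[OF this] have "(\<lambda>n. G n x) \<longlonglongrightarrow> \<phi> x /\<^sub>R max 1 (norm (\<phi> x))"
      unfolding G_def by (intro tendsto_intros) (auto simp: max_def)
    moreover have "norm (\<phi> x) \<le> 1" by (simp add: \<phi>_def norm_sgn)
    ultimately show "(\<lambda>n. G n x) \<longlonglongrightarrow> \<phi> x" by (simp add: max_absorb1)
  qed
  have "AE x in lborel. (\<lambda>n. G n x) \<longlonglongrightarrow> \<phi> x"
    using Glim unfolding AE_completion_iff by simp
  then have "(\<lambda>n. \<integral>x. k x * G n x \<partial>lborel) \<longlonglongrightarrow> (\<integral>x. k x * \<phi> x \<partial>lborel)"
    by (intro integral_dominated_convergence[where w="\<lambda>x. norm (k x)"])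
       (use assms(1) Gb in \<open>auto simp: norm_mult intro!: tendsto_intros mult_left_le elim: eventually_mono\<close>)
  moreover have "(\<integral>x. k x * G n x \<partial>lborel) = 0" for n
    by (rule ft_eq_0_imp_integral_eq_0[OF assms Gc Gb])
  ultimately have "(\<integral>x. k x * \<phi> x \<partial>lborel) = 0" by (simp add: LIMSEQ_const_iff)
  moreover have "k x * \<phi> x = complex_of_real (norm (k x))" for x
    by (simp add: \<phi>_def sgn_div_norm scaleR_conv_of_real complex_norm_square[symmetric] power2_eq_square field_simps)
  ultimately have "complex_of_real (\<integral>x. norm (k x) \<partial>lborel) = 0" by (simp add: integral_complex_of_real)
  then have "(\<integral>x. norm (k x) \<partial>lborel) = 0" by (simp only: of_real_eq_0_iff)
  then show ?thesis
    using integral_nonneg_eq_0_iff_AE[OF integrable_norm[OF assms(1)]] by auto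
qed

text \<open>Here g is an L2 limit of transforms of functions approximating h. The multiplication
  formula with a modulated Gaussian survives both L2 limits. As its width d tends to 0, one side
  converges by integrability of g, the other because \<open>gker\<close> is an approximate identity
  and h is continuous at y.\<close>

lemma ft_inversion:
  fixes h g :: "'a::euclidean_space \<Rightarrow> complex"
  assumes h: "L2 h" "isCont h y" and g: "L2 g" "integrable lborel g"
    and p: "\<And>n. integrable lborel (p n)" "\<And>n. L2 (p n)"
    and lim: "(\<lambda>n. l2 (\<lambda>x. h x - p n x)) \<longlonglongrightarrow> 0" "(\<lambda>n. l2 (\<lambda>\<xi>. g \<xi> - ft (-1) (p n) \<xi>)) \<longlonglongrightarrow> 0"
    and ftp: "\<And>n. L2 (ft (-1) (p n))"
  shows "(2 * pi) ^ DIM('a) * h y = ft 1 g y"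
proof -
  note [measurable] = L2_measurable[OF h(1)] L2_measurable[OF g(1)]
  have bb: "bounded_bilinear (\<lambda>a b :: complex. a * b)" "norm (a * b) \<le> norm a * norm b" for a b :: complex
    by (auto simp: norm_mult bounded_bilinear_mult)
  have lim_mult: "(\<lambda>n. \<integral>x. u n x * v x \<partial>lborel) \<longlonglongrightarrow> (\<integral>x. w x * v x \<partial>lborel)"
    if "\<And>n. L2 (u n)" "L2 v" "L2 w" "(\<lambda>n. l2 (\<lambda>x. w x - u n x)) \<longlonglongrightarrow> 0" for u and v w :: "'a \<Rightarrow> complex"
  proof -
    have le: "norm ((\<integral>x. w x * v x \<partial>lborel) - (\<integral>x. u n x * v x \<partial>lborel)) \<le> l2 (\<lambda>x. w x - u n x) * l2 v" for n
    proof -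
      have "(\<integral>x. w x * v x \<partial>lborel) - (\<integral>x. u n x * v x \<partial>lborel) = (\<integral>x. (w x - u n x) * v x \<partial>lborel)"
        using L2_bilinear(1)[OF bb that(3,2)] L2_bilinear(1)[OF bb that(1,2)] by (simp add: left_diff_distrib)
      then show ?thesis using L2_bilinear(2)[OF bb L2_diff[OF that(3,1)] that(2)] by simp
    qed
    have "(\<lambda>n. l2 (\<lambda>x. w x - u n x) * l2 v) \<longlonglongrightarrow> 0" by (rule tendsto_mult_left_zero[OF that(4)])
    then have "(\<lambda>n. (\<integral>x. w x * v x \<partial>lborel) - (\<integral>x. u n x * v x \<partial>lborel)) \<longlonglongrightarrow> 0"
      by (rule Lim_null_comparison[OF always_eventually[OF allI[OF le]]])
    from tendsto_diff[OF tendsto_const[of "\<integral>x. w x * v x \<partial>lborel"] this] show ?thesis by simp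
  qed
  have key: "(\<integral>\<xi>. g \<xi> * (cis (y \<bullet> \<xi>) * gauss (d *\<^sub>R \<xi>)) \<partial>lborel) = (\<integral>x. h x * gker d (y - x) \<partial>lborel)" if "d > 0" for d
  proof -
    define \<gamma> where "\<gamma> \<xi> = cis (y \<bullet> \<xi>) * complex_of_real (gauss (d *\<^sub>R \<xi>))" for \<xi>
    have [measurable]: "\<gamma> \<in> borel_measurable borel" unfolding \<gamma>_def by measurable
    have \<gamma>i: "integrable lborel \<gamma>" unfolding \<gamma>_def by (rule ft_gauss(1)[OF that, of 1]) simp
    have \<gamma>L: "L2 \<gamma>"
      by (rule L2_bound(1)[OF L2_gauss_scaled[of d], where c=1]) (use that in \<open>auto simp: \<gamma>_def norm_mult\<close>)
    have ft\<gamma>: "ft (-1) \<gamma> x = gker d (y - x)" for x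
      unfolding \<gamma>_def by (subst ft_gauss(2)[OF that]) (auto simp: gker_minus_commute)
    have ft\<gamma>L: "L2 (ft (-1) \<gamma>)"
      using ft_plancherel_le[OF _ \<gamma>i \<gamma>L, of "-1"] 
      by (intro L2I_nn(1)[where C="sqrt ((2 * pi) ^ DIM('a)) * l2 \<gamma>"]) (auto simp: power_mult_distrib)
    have "(\<lambda>n. \<integral>\<xi>. ft (-1) (p n) \<xi> * \<gamma> \<xi> \<partial>lborel) \<longlonglongrightarrow> (\<integral>\<xi>. g \<xi> * \<gamma> \<xi> \<partial>lborel)"
      by (rule lim_mult[OF ftp \<gamma>L g(1) lim(2)])
    moreover have "(\<lambda>n. \<integral>x. p n x * ft (-1) \<gamma> x \<partial>lborel) \<longlonglongrightarrow> (\<integral>x. h x * ft (-1) \<gamma> x \<partial>lborel)"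
      by (rule lim_mult[OF p(2) ft\<gamma>L h(1) lim(1)])
    ultimately have "(\<integral>\<xi>. g \<xi> * \<gamma> \<xi> \<partial>lborel) = (\<integral>x. h x * ft (-1) \<gamma> x \<partial>lborel)"
      unfolding ft_mult_formula[OF p(1) \<gamma>i] by (rule LIMSEQ_unique)
    then show ?thesis unfolding ft\<gamma> unfolding \<gamma>_def .
  qed
  have "(\<lambda>n. \<integral>\<xi>. g \<xi> * (cis (y \<bullet> \<xi>) * gauss ((1 / real (Suc n)) *\<^sub>R \<xi>)) \<partial>lborel) \<longlonglongrightarrow> (\<integral>\<xi>. g \<xi> * (cis (y \<bullet> \<xi>) * complex_of_real 1) \<partial>lborel)"
  proof (rule integral_dominated_convergence[where w="\<lambda>\<xi>. norm (g \<xi>)"])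
    show "AE \<xi> in lborel. (\<lambda>n. g \<xi> * (cis (y \<bullet> \<xi>) * gauss ((1 / real (Suc n)) *\<^sub>R \<xi>))) \<longlonglongrightarrow> g \<xi> * (cis (y \<bullet> \<xi>) * complex_of_real 1)"
      by (intro AE_I2 tendsto_mult tendsto_const tendsto_of_real gauss_scaled_tendsto)
    show "AE \<xi> in lborel. norm (g \<xi> * (cis (y \<bullet> \<xi>) * gauss ((1 / real (Suc n)) *\<^sub>R \<xi>))) \<le> norm (g \<xi>)" for n
      by (auto simp: norm_mult gauss_le_1 intro!: mult_left_le)
  qed (use g in auto)
  moreover have "(\<integral>\<xi>. g \<xi> * (cis (y \<bullet> \<xi>) * complex_of_real 1) \<partial>lborel) = ft 1 g y"
    by (simp add: ft_def mult_ac inner_commute)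
  ultimately have "(\<lambda>n. \<integral>x. h x * gker (1 / real (Suc n)) (y - x) \<partial>lborel) \<longlonglongrightarrow> ft 1 g y"
    by (simp add: key)
  with gker_approx_L2[OF h] show ?thesis using LIMSEQ_unique by blast
qed

section \<open>Left multiplication by vectors in the Clifford algebra\<close>

lemma clif_mult_add_left: "clif_mult (x + y) z = clif_mult x z + clif_mult y z"
  unfolding clif_mult_def vec_eq_iff
  by (simp add: sum.distrib[symmetric]) (auto intro!: sum.cong simp: algebra_simps)

lemma clif_mult_add_right: "clif_mult x (y + z) = clif_mult x y + clif_mult x z"
  unfolding clif_mult_def vec_eq_iff
  by (simp add: sum.distrib[symmetric]) (auto intro!: sum.cong simp: algebra_simps)

lemma clif_mult_cscale_left: "clif_mult (cscale c x) y = cscale c (clif_mult x y)"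
  unfolding clif_mult_def vec_eq_iff cscale_def
  by (simp add: sum_distrib_left) (auto intro!: sum.cong simp: algebra_simps)

lemma clif_mult_cscale_right: "clif_mult x (cscale c y) = cscale c (clif_mult x y)"
  unfolding clif_mult_def vec_eq_iff cscale_def
  by (simp add: sum_distrib_left) (auto intro!: sum.cong simp: algebra_simps)

lemma cscale_of_real: "cscale (complex_of_real r) x = r *\<^sub>R x"
  by (simp add: cscale_def vec_eq_iff scaleR_conv_of_real[symmetric] del: of_real_mult)

lemma clif_mult_scaleR_left: "clif_mult (r *\<^sub>R x) y = r *\<^sub>R clif_mult x y"
  by (simp add: clif_mult_cscale_left flip: cscale_of_real)

lemma clif_mult_scaleR_right: "clif_mult x (r *\<^sub>R y) = r *\<^sub>R clif_mult x y"
  by (simp add: clif_mult_cscale_right flip: cscale_of_real)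

lemma linear_clif_mult_right: "linear (clif_mult x)"
  by (rule linearI) (simp_all add: clif_mult_add_right clif_mult_scaleR_right)

lemma linear_clif_mult_left: "linear (\<lambda>x. clif_mult x y)"
  by (rule linearI) (simp_all add: clif_mult_add_left clif_mult_scaleR_left)

lemma bounded_linear_clif_mult: "bounded_linear (clif_mult x)"
  by (simp add: linear_clif_mult_right linear_conv_bounded_linear[symmetric])

lemma cscale_nth [simp]: "cscale c x $ T = c * x $ T"
  by (simp add: cscale_def)

lemma norm_vec_power2: "(norm (x :: 'm::finite clif))\<^sup>2 = (\<Sum>T\<in>UNIV. (norm (x $ T))\<^sup>2)"
  by (simp add: norm_vec_def L2_set_def sum_nonneg)

lemma norm_cscale [simp]: "norm (cscale c x) = norm c * norm x"
proof -
  have "(norm (cscale c x))\<^sup>2 = (norm c * norm x)\<^sup>2"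
    by (simp add: norm_vec_power2 norm_mult power_mult_distrib sum_distrib_left)
  then show ?thesis by simp
qed

lemma bounded_bilinear_cscale: "bounded_bilinear cscale"
  by standard (auto simp: vec_eq_iff algebra_simps intro!: exI[of _ 1])

lemma cscale_1 [simp]: "cscale 1 x = x" and cscale_cscale [simp]: "cscale a (cscale b x) = cscale (a * b) x"
  by (simp_all add: vec_eq_iff)

lemmas cscale_add_right = bounded_bilinear.add_right[OF bounded_bilinear_cscale]
lemmas cscale_diff_right = bounded_bilinear.diff_right[OF bounded_bilinear_cscale]
lemmas cscale_scaleR_right = bounded_bilinear.scaleR_right[OF bounded_bilinear_cscale]
lemmas cscale_sum_right = bounded_bilinear.sum_right[OF bounded_bilinear_cscale]

lemma cscale_measurable [measurable (raw)]:
  "f \<in> borel_measurable M \<Longrightarrow> g \<in> borel_measurable M \<Longrightarrow> (\<lambda>x. cscale (f x) (g x)) \<in> borel_measurable M"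
  by (rule borel_measurable_continuous_Pair)
     (auto intro!: bounded_bilinear.continuous_on[OF bounded_bilinear_cscale] continuous_intros)

lemma clif_mult_measurable [measurable (raw)]:
  "f \<in> borel_measurable M \<Longrightarrow> (\<lambda>x. clif_mult y (f x)) \<in> borel_measurable M"
  using borel_measurable_continuous_on[OF linear_continuous_on[OF bounded_linear_clif_mult]] by blast

section \<open>Signs and the action of the generators\<close>

definition tog :: "'m \<Rightarrow> 'm set \<Rightarrow> 'm set" where
  "tog k U = ({k} - U) \<union> (U - {k})"

lemma tog_tog [simp]: "tog k (tog k U) = U"
  and tog_commute: "tog k (tog l U) = tog l (tog k U)"
  and tog_mem: "x \<in> tog k U \<longleftrightarrow> (if x = k then k \<notin> U else x \<in> U)"
  by (auto simp: tog_def)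

text \<open>Only the index pair ({k}, \<open>tog k U\<close>) contributes to the coefficient at U,
  because \<open>tog k\<close> is an involution; a generator thus acts as a signed permutation of
  the basis.\<close>

lemma clif_mult_gen_nth:
  "clif_mult (clif_gen k) y $ U = clif_sign {k} (tog k U) * y $ tog k U"
proof -
  have t: "({k} - T) \<union> (T - {k}) = U \<longleftrightarrow> T = tog k U" for T
    by (auto simp: tog_def)
  have "(\<Sum>T\<in>UNIV. if (S - T) \<union> (T - S) = U then clif_sign S T * (clif_gen k $ S) * (y $ T) else 0)
      = (if S = {k} then clif_sign {k} (tog k U) * y $ tog k U else 0)" for S
  proof (cases "S = {k}")
    case True
    show ?thesis unfolding True t by (simp add: clif_gen_def)
  qed (simp add: clif_gen_def cong: if_cong)
  then show ?thesis unfolding clif_mult_def by simp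
qed

lemma clif_sign_single:
  "clif_sign {k} T = (-1) ^ card {t\<in>T. t < k} * (if k \<in> T then -1 else 1)" for T :: "'m::{finite,linorder} set"
proof -
  have "{(s, t). s \<in> {k} \<and> t \<in> T \<and> t < s} = Pair k ` {t\<in>T. t < k}" by auto
  then have "card {(s, t). s \<in> {k} \<and> t \<in> T \<and> t < s} = card {t\<in>T. t < k}"
    by (simp add: card_image inj_on_def)
  moreover have "card ({k} \<inter> T) = (if k \<in> T then 1 else 0)" by auto
  ultimately show ?thesis unfolding clif_sign_def by (simp add: power_add)
qed

lemma clif_sign_tog_same: "clif_sign {k} (tog k T) = - clif_sign {k} T" for T :: "'m::{finite,linorder} set"
proof -
  have "{t \<in> tog k T. t < k} = {t\<in>T. t < k}" by (auto simp: tog_mem)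
  then show ?thesis by (simp add: clif_sign_single tog_mem)
qed

text \<open>Adding or removing l changes the parity of the number of indices below k exactly when l
  < k. This asymmetry is the source of anticommutation.\<close>

lemma clif_sign_tog_other:
  fixes T :: "'m::{finite,linorder} set"
  assumes "l \<noteq> k"
  shows "clif_sign {k} (tog l T) = (if l < k then - clif_sign {k} T else clif_sign {k} T)"
proof (cases "l < k")
  case True
  have "(-1::complex) ^ card {t \<in> tog l T. t < k} = - ((-1) ^ card {t\<in>T. t < k})"
  proof (cases "l \<in> T")
    case lT: True
    then have "{t\<in>T. t < k} = insert l {t \<in> tog l T. t < k}" "l \<notin> {t \<in> tog l T. t < k}"
      using True by (auto simp: tog_mem)
    then show ?thesis by simp
  next
    case False
    then have "{t \<in> tog l T. t < k} = insert l {t \<in> T. t < k}" "l \<notin> {t \<in> T. t < k}"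
      using True by (auto simp: tog_mem)
    then show ?thesis by simp
  qed
  then show ?thesis using True assms by (simp add: clif_sign_single tog_mem)
next
  case False
  then have "{t \<in> tog l T. t < k} = {t\<in>T. t < k}" by (auto simp: tog_mem)
  then show ?thesis using False assms by (simp add: clif_sign_single tog_mem)
qed

lemma clif_sign_square: "clif_sign S T * clif_sign S T = 1"
  by (simp add: clif_sign_def flip: power_mult_distrib)

lemma clif_gen_square: "clif_mult (clif_gen k) (clif_mult (clif_gen k) w) = - w"
  by (simp add: vec_eq_iff clif_mult_gen_nth clif_sign_tog_same mult.assoc[symmetric] clif_sign_square)

text \<open>Both products reach the same coefficient; exactly one of k < l and l < k holds, so
  exactly one of the two orders picks up an extra sign.\<close>

lemma clif_gen_anticommute:
  assumes "k \<noteq> l"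
  shows "clif_mult (clif_gen k) (clif_mult (clif_gen l) w) = - clif_mult (clif_gen l) (clif_mult (clif_gen k) w)"
  unfolding vec_eq_iff
proof
  fix U
  have "clif_sign {k} (tog k U) * clif_sign {l} (tog l (tog k U)) = - (clif_sign {l} (tog l U) * clif_sign {k} (tog k (tog l U)))"
    using assms by (auto simp: clif_sign_tog_same clif_sign_tog_other)
  then show "clif_mult (clif_gen k) (clif_mult (clif_gen l) w) $ U = (- clif_mult (clif_gen l) (clif_mult (clif_gen k) w)) $ U"
    by (simp add: clif_mult_gen_nth mult.assoc[symmetric] tog_commute[of l k U])
qed

lemma clif_sign_inner: "inner (clif_sign S T * a) b = inner a (clif_sign S T * b)"
  unfolding clif_sign_def by (cases "even (card {(s, t). s \<in> S \<and> t \<in> T \<and> t < s} + card (S \<inter> T))") auto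

text \<open>The permutation is undone by reindexing along the involution \<open>tog k\<close>, and
  the sign then changes by \<open>clif_sign_tog_same\<close>.\<close>

lemma clif_gen_skew: "inner (clif_mult (clif_gen k) w) z = - inner w (clif_mult (clif_gen k) z)"
proof -
  have "inner (clif_mult (clif_gen k) w) z = (\<Sum>U\<in>UNIV. inner (clif_sign {k} (tog k U) * w $ tog k U) (z $ U))"
    by (simp add: inner_vec_def clif_mult_gen_nth)
  also have "\<dots> = (\<Sum>U\<in>UNIV. inner (clif_sign {k} U * w $ U) (z $ tog k U))"
    by (rule sum.reindex_bij_witness[of _ "tog k" "tog k"]) auto
  also have "\<dots> = - inner w (clif_mult (clif_gen k) z)"
    by (simp add: inner_vec_def clif_mult_gen_nth clif_sign_tog_same clif_sign_inner sum_negf)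
  finally show ?thesis .
qed

text \<open>Jop xi is left multiplication by i xi. Pp xi and Pm xi below are left multiplication by chi_plus xi and
  chi_minus xi (at xi = 0 they are both 1/2, since inverse 0 = 0), and Eop t xi = exp(- t Jop xi).\<close>
definition Jop :: "(real, 'm::{finite,linorder}) vec \<Rightarrow> 'm clif \<Rightarrow> 'm clif" where
  "Jop \<xi> w = cscale \<i> (clif_mult (clif_vec \<xi>) w)"

lemma clif_mult_vec: "clif_mult (clif_vec \<xi>) w = (\<Sum>k\<in>UNIV. (\<xi> $ k) *\<^sub>R clif_mult (clif_gen k) w)"
  unfolding clif_vec_def by (simp add: linear_sum[OF linear_clif_mult_left] clif_mult_scaleR_left)

text \<open>The double sum is added to its transpose so that anticommutators appear: the
  off-diagonal ones vanish and the diagonal ones give -2 times the squared coordinates.\<close>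

lemma clif_vec_square: "clif_mult (clif_vec \<xi>) (clif_mult (clif_vec \<xi>) w) = - (norm \<xi>)\<^sup>2 *\<^sub>R w"
proof -
  let ?e = "\<lambda>k. clif_mult (clif_gen k)"
  let ?X = "clif_mult (clif_vec \<xi>) (clif_mult (clif_vec \<xi>) w)"
  have X': "?X = (\<Sum>k\<in>UNIV. \<Sum>l\<in>UNIV. (\<xi> $ k * \<xi> $ l) *\<^sub>R ?e l (?e k w))"
    by (simp add: clif_mult_vec linear_sum[OF linear_clif_mult_right] clif_mult_scaleR_right scaleR_sum_right)
  also have "\<dots> = (\<Sum>k\<in>UNIV. \<Sum>l\<in>UNIV. (\<xi> $ k * \<xi> $ l) *\<^sub>R ?e k (?e l w))"
    by (subst sum.swap, intro sum.cong refl) (simp only: mult.commute)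
  finally have X: "?X = (\<Sum>k\<in>UNIV. \<Sum>l\<in>UNIV. (\<xi> $ k * \<xi> $ l) *\<^sub>R ?e k (?e l w))" .
  have "?X + ?X = (\<Sum>k\<in>UNIV. \<Sum>l\<in>UNIV. (\<xi> $ k * \<xi> $ l) *\<^sub>R (?e k (?e l w) + ?e l (?e k w)))"
    by (subst (1) X, subst X') (simp add: sum.distrib scaleR_right_distrib)
  also have "\<dots> = (\<Sum>k\<in>UNIV. \<Sum>l\<in>UNIV. if l = k then (- 2 * (\<xi> $ k)\<^sup>2) *\<^sub>R w else 0)"
  proof (intro sum.cong refl)
    fix k l
    show "(\<xi> $ k * \<xi> $ l) *\<^sub>R (?e k (?e l w) + ?e l (?e k w)) = (if l = k then (- 2 * (\<xi> $ k)\<^sup>2) *\<^sub>R w else 0)"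
    proof (cases "l = k")
      case True
      have "- w - w = (-2) *\<^sub>R w" by (metis scaleR_2 scaleR_minus_left minus_add_distrib diff_conv_add_uminus)
      then show ?thesis using True by (simp add: clif_gen_square power2_eq_square)
    next
      case False
      then show ?thesis using clif_gen_anticommute[of k l w] by simp
    qed
  qed
  also have "\<dots> = (- 2 * (norm \<xi>)\<^sup>2) *\<^sub>R w"
    by (simp add: scaleR_sum_left[symmetric] norm_vec_def L2_set_def sum_nonneg sum_negf sum_distrib_left)
  finally have "2 *\<^sub>R ?X = 2 *\<^sub>R (- (norm \<xi>)\<^sup>2 *\<^sub>R w)" by (simp add: scaleR_2)
  then show ?thesis by (simp only: real_vector.scale_left_imp_eq[of 2] zero_neq_numeral[symmetric] simp_thms scaleR_cancel_left)
qed

lemma Jop_Jop: "Jop \<xi> (Jop \<xi> w) = (norm \<xi>)\<^sup>2 *\<^sub>R w"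
proof -
  have "Jop \<xi> (Jop \<xi> w) = cscale (- 1) (- ((norm \<xi>)\<^sup>2 *\<^sub>R w))"
    by (simp add: Jop_def clif_mult_cscale_right clif_vec_square)
  then show ?thesis by (simp add: vec_eq_iff)
qed

lemma inner_cscale_i: "inner (cscale \<i> x) y = - inner x (cscale \<i> y)"
  by (simp add: inner_vec_def inner_complex_def sum_negf[symmetric])

text \<open>For the real inner product both multiplication by i and left multiplication by a vector
  are skew, and they commute, so the two signs cancel.\<close>

lemma Jop_selfadjoint: "inner (Jop \<xi> w) z = inner w (Jop \<xi> z)"
  unfolding Jop_def inner_cscale_i
  by (simp add: clif_mult_vec inner_sum_left clif_gen_skew inner_sum_right sum_negf[symmetric] clif_mult_cscale_right[symmetric]
      cscale_sum_right cscale_scaleR_right)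

lemma linear_Jop: "linear (Jop \<xi>)"
  unfolding Jop_def
  by (rule linearI) (simp_all add: clif_mult_add_right clif_mult_scaleR_right cscale_add_right cscale_scaleR_right)

lemma bounded_linear_Jop: "bounded_linear (Jop \<xi>)"
  by (simp add: linear_Jop linear_conv_bounded_linear[symmetric])

lemmas Jop_simps = linear_add[OF linear_Jop] linear_diff[OF linear_Jop] linear_scale[OF linear_Jop]

lemma norm_Jop: "norm (Jop \<xi> w) = norm \<xi> * norm w"
proof -
  have "(norm (Jop \<xi> w))\<^sup>2 = inner w (Jop \<xi> (Jop \<xi> w))" by (simp add: power2_norm_eq_inner Jop_selfadjoint)
  also have "\<dots> = (norm \<xi> * norm w)\<^sup>2" by (simp add: Jop_Jop power2_norm_eq_inner[symmetric] power_mult_distrib)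
  finally show ?thesis by simp
qed

text \<open>The shape in which \<open>Jop\<close> arises from the sum over space derivatives in the
  monogenic equation.\<close>

lemma Jop_sum: "Jop \<xi> w = (\<Sum>k\<in>UNIV. cscale (\<i> * complex_of_real (\<xi> $ k)) (clif_mult (clif_gen k) w))"
  by (simp add: Jop_def clif_mult_vec cscale_sum_right cscale_of_real[symmetric])

lemma vec_nth_measurable: "(\<lambda>\<xi>::(real, 'm::finite) vec. \<xi> $ k) \<in> borel_measurable borel"
  by (intro borel_measurable_continuous_onI continuous_intros)

lemma Jop_measurable [measurable]:
  assumes "g \<in> borel_measurable borel" shows "(\<lambda>\<xi>. Jop \<xi> (g \<xi>)) \<in> borel_measurable borel"
proof -
  note [measurable] = assms vec_nth_measurable
  show ?thesis unfolding Jop_sum by measurable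
qed

section \<open>Spectral projections and the exponential of left multiplication\<close>

definition Pp :: "(real, 'm::{finite,linorder}) vec \<Rightarrow> 'm clif \<Rightarrow> 'm clif" where
  "Pp \<xi> w = (1/2) *\<^sub>R (w + inverse (norm \<xi>) *\<^sub>R Jop \<xi> w)"

definition Pm :: "(real, 'm::{finite,linorder}) vec \<Rightarrow> 'm clif \<Rightarrow> 'm clif" where
  "Pm \<xi> w = (1/2) *\<^sub>R (w - inverse (norm \<xi>) *\<^sub>R Jop \<xi> w)"

definition Eop :: "real \<Rightarrow> (real, 'm::{finite,linorder}) vec \<Rightarrow> 'm clif \<Rightarrow> 'm clif" where
  "Eop t \<xi> w = exp (- t * norm \<xi>) *\<^sub>R Pp \<xi> w + exp (t * norm \<xi>) *\<^sub>R Pm \<xi> w"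

lemma clif_mult_one: "clif_mult clif_one w = w"
proof -
  have "(\<Sum>T\<in>UNIV. if (S - T) \<union> (T - S) = U then clif_sign S T * (clif_one $ S) * (w $ T) else 0)
      = (if S = {} then w $ U else 0)" for S U
    by (cases "S = {}") (simp_all add: clif_one_def clif_sign_def cong: if_cong)
  then show ?thesis by (simp add: vec_eq_iff clif_mult_def)
qed

lemma clif_mult_chi_plus: "clif_mult (chi_plus \<xi>) w = Pp \<xi> w"
  unfolding chi_plus_def Pp_def
  by (simp add: clif_mult_cscale_left clif_mult_add_left clif_mult_one Jop_def clif_mult_scaleR_left cscale_scaleR_right)
     (simp add: cscale_of_real[of "1/2", simplified])

lemma clif_mult_chi_minus: "clif_mult (chi_minus \<xi>) w = Pm \<xi> w"
  unfolding chi_minus_def Pm_def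
  by (simp add: clif_mult_cscale_left linear_diff[OF linear_clif_mult_left] clif_mult_one Jop_def clif_mult_scaleR_left cscale_scaleR_right)
     (simp add: cscale_of_real[of "1/2", simplified])

lemma clif_mult_ekern: "clif_mult (ekern x \<xi>) w = cscale (cis (snd x \<bullet> \<xi>)) (Eop (fst x) \<xi> w)"
  by (simp add: ekern_def clif_mult_cscale_left clif_mult_add_left clif_mult_scaleR_left clif_mult_chi_plus
      clif_mult_chi_minus Eop_def cis_conv_exp)

lemma Jop_zero: "Jop 0 w = 0"
  using norm_Jop[of 0 w] by simp

text \<open>At xi = 0 both sides vanish, so the eigenvalue equation is compatible with the value 1/2
  of the projection there.\<close>

lemma Jop_Pp: "Jop \<xi> (Pp \<xi> w) = norm \<xi> *\<^sub>R Pp \<xi> w"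
  by (cases "\<xi> = 0") (simp_all add: Jop_zero Pp_def Jop_simps Jop_Jop scaleR_right_distrib power2_eq_square algebra_simps)

lemma Jop_Pm: "Jop \<xi> (Pm \<xi> w) = - norm \<xi> *\<^sub>R Pm \<xi> w"
  by (cases "\<xi> = 0") (simp_all add: Jop_zero Pm_def Jop_simps Jop_Jop scaleR_right_distrib power2_eq_square algebra_simps)

lemma norm_inverse_Jop_le: "norm (inverse (norm \<xi>) *\<^sub>R Jop \<xi> w) \<le> norm w"
  by (cases "\<xi> = 0") (simp_all add: norm_Jop field_simps)

lemma norm_Pp_le: "norm (Pp \<xi> w) \<le> norm w"
  using norm_inverse_Jop_le[of \<xi> w] norm_triangle_ineq[of w "inverse (norm \<xi>) *\<^sub>R Jop \<xi> w"]
  by (simp add: Pp_def del: norm_scaleR) simp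

lemma norm_Pm_le: "norm (Pm \<xi> w) \<le> norm w"
  using norm_inverse_Jop_le[of \<xi> w] norm_triangle_ineq4[of w "inverse (norm \<xi>) *\<^sub>R Jop \<xi> w"]
  by (simp add: Pm_def del: norm_scaleR) simp

lemma Pp_measurable [measurable]:
  assumes "g \<in> borel_measurable borel" shows "(\<lambda>\<xi>. Pp \<xi> (g \<xi>)) \<in> borel_measurable borel"
proof -
  note [measurable] = assms Jop_measurable[OF assms]
  show ?thesis unfolding Pp_def by measurable
qed

lemma Pm_measurable [measurable]:
  assumes "g \<in> borel_measurable borel" shows "(\<lambda>\<xi>. Pm \<xi> (g \<xi>)) \<in> borel_measurable borel"
proof -
  note [measurable] = assms Jop_measurable[OF assms]
  show ?thesis unfolding Pm_def by measurable
qed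

lemma Eop_measurable [measurable]:
  assumes "g \<in> borel_measurable borel" shows "(\<lambda>\<xi>. Eop t \<xi> (g \<xi>)) \<in> borel_measurable borel"
proof -
  note [measurable] = assms Pp_measurable[OF assms] Pm_measurable[OF assms]
  show ?thesis unfolding Eop_def by measurable
qed

lemma linear_Eop: "linear (Eop t \<xi>)"
  unfolding Eop_def Pp_def Pm_def
  by (rule linearI) (simp_all add: Jop_simps algebra_simps)

text \<open>The exponential series split by parity, using that \<open>Jop\<close> squares to |xi|^2.
  Without projections, the group law, self-adjointness and the time derivative become computations
  with cosh and sinh.\<close>

lemma Eop_cosh: "Eop t \<xi> w = cosh (t * norm \<xi>) *\<^sub>R w - (sinh (t * norm \<xi>) * inverse (norm \<xi>)) *\<^sub>R Jop \<xi> w"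
proof -
  define p where "p = exp (t * norm \<xi>)"
  define q where "q = exp (- (t * norm \<xi>))"
  have c: "cosh (t * norm \<xi>) = (1/2) * p + (1/2) * q" "sinh (t * norm \<xi>) = (1/2) * p - (1/2) * q"
    by (simp_all add: cosh_def sinh_def p_def q_def)
  show ?thesis unfolding Eop_def Pp_def Pm_def c mult_minus_left p_def[symmetric] q_def[symmetric]
    by (simp add: algebra_simps)
qed

lemma Eop_0 [simp]: "Eop 0 \<xi> w = w"
  by (simp add: Eop_cosh)

text \<open>The addition theorems of cosh and sinh; xi = 0 is treated apart because
  \<open>inverse (norm \<xi>)\<close> is not a reciprocal there.\<close>

lemma Eop_add: "Eop s \<xi> (Eop t \<xi> w) = Eop (s + t) \<xi> w"
proof (cases "\<xi> = 0")
  case True then show ?thesis by (simp add: Eop_cosh Jop_zero)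
next
  case False
  have J2: "inverse (norm \<xi>) * (inverse (norm \<xi>) * (norm \<xi>)\<^sup>2) = 1" using False by (simp add: power2_eq_square field_simps)
  define n where "n = inverse (norm \<xi>)"
  define c where "c = cosh (s * norm \<xi>)" define c' where "c' = cosh (t * norm \<xi>)"
  define u where "u = sinh (s * norm \<xi>)" define u' where "u' = sinh (t * norm \<xi>)"
  have a: "cosh ((s + t) * norm \<xi>) = c * c' + u * u'" "sinh ((s + t) * norm \<xi>) = u * c' + c * u'"
    by (simp_all add: distrib_right cosh_add sinh_add c_def c'_def u_def u'_def)
  have J2': "(u * n * (u' * n * (norm \<xi>)\<^sup>2)) = u * u'"
    using J2 unfolding n_def[symmetric] by (metis (no_types, opaque_lifting) mult.assoc mult.commute mult.left_neutral mult.right_neutral)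
  have "Eop s \<xi> (Eop t \<xi> w) = c *\<^sub>R (c' *\<^sub>R w - (u' * n) *\<^sub>R Jop \<xi> w) - (u * n) *\<^sub>R (c' *\<^sub>R Jop \<xi> w - (u' * n * (norm \<xi>)\<^sup>2) *\<^sub>R w)"
    unfolding Eop_cosh n_def[symmetric] c_def[symmetric] c'_def[symmetric] u_def[symmetric] u'_def[symmetric]
    by (simp add: Jop_simps Jop_Jop)
  also have "\<dots> = (c * c') *\<^sub>R w - (c * (u' * n)) *\<^sub>R Jop \<xi> w - (u * n * c') *\<^sub>R Jop \<xi> w + (u * n * (u' * n * (norm \<xi>)\<^sup>2)) *\<^sub>R w"
    by (simp add: scaleR_right_diff_distrib)
  also have "\<dots> = (c * c' + u * u') *\<^sub>R w - ((u * c' + c * u') * n) *\<^sub>R Jop \<xi> w"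
    unfolding J2' by (simp add: algebra_simps)
  finally show ?thesis unfolding Eop_cosh a n_def .
qed

lemma Eop_selfadjoint: "inner (Eop t \<xi> w) z = inner w (Eop t \<xi> z)"
  by (simp add: Eop_cosh inner_diff_left inner_diff_right Jop_selfadjoint)

lemma norm_Eop_le: "norm (Eop t \<xi> w) \<le> 2 * exp (\<bar>t\<bar> * norm \<xi>) * norm w"
proof -
  have "- t * norm \<xi> \<le> \<bar>t\<bar> * norm \<xi>" "t * norm \<xi> \<le> \<bar>t\<bar> * norm \<xi>" by (intro mult_right_mono; simp)+
  then have "exp (- t * norm \<xi>) * norm (Pp \<xi> w) \<le> exp (\<bar>t\<bar> * norm \<xi>) * norm w" "exp (t * norm \<xi>) * norm (Pm \<xi> w) \<le> exp (\<bar>t\<bar> * norm \<xi>) * norm w"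
    by (intro mult_mono norm_Pp_le norm_Pm_le; simp)+
  then show ?thesis unfolding Eop_def
    using norm_triangle_ineq[of "exp (- t * norm \<xi>) *\<^sub>R Pp \<xi> w" "exp (t * norm \<xi>) *\<^sub>R Pm \<xi> w"] by simp
qed

text \<open>By the parallelogram law the cross terms cancel between the heights a and - a, leaving 2
  cosh(2 a |xi|) |w|^2. Either height alone would damp one spectral part.\<close>

lemma Eop_norm_lower: "exp (2 * a * norm \<xi>) * (norm w)\<^sup>2 \<le> (norm (Eop a \<xi> w))\<^sup>2 + (norm (Eop (- a) \<xi> w))\<^sup>2"
proof -
  have par: "(norm (x - y))\<^sup>2 + (norm (x + y))\<^sup>2 = 2 * (norm x)\<^sup>2 + 2 * (norm y)\<^sup>2" for x y :: "'a clif"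
    by (simp add: power2_norm_eq_inner algebra_simps inner_commute)
  define z where "z = (sinh (a * norm \<xi>) * inverse (norm \<xi>)) *\<^sub>R Jop \<xi> w"
  have "(norm (Eop a \<xi> w))\<^sup>2 + (norm (Eop (- a) \<xi> w))\<^sup>2 = 2 * (norm (cosh (a * norm \<xi>) *\<^sub>R w))\<^sup>2 + 2 * (norm z)\<^sup>2"
    using par[of "cosh (a * norm \<xi>) *\<^sub>R w" z] by (simp add: Eop_cosh z_def)
  moreover have "(norm z)\<^sup>2 = (sinh (a * norm \<xi>))\<^sup>2 * (norm w)\<^sup>2"
    by (cases "\<xi> = 0") (simp_all add: z_def norm_Jop power_mult_distrib power_divide field_simps)
  ultimately have "(norm (Eop a \<xi> w))\<^sup>2 + (norm (Eop (- a) \<xi> w))\<^sup>2 = (2 * ((cosh (a * norm \<xi>))\<^sup>2 + (sinh (a * norm \<xi>))\<^sup>2)) * (norm w)\<^sup>2"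
    by (simp add: power_mult_distrib algebra_simps)
  also have "2 * ((cosh (a * norm \<xi>))\<^sup>2 + (sinh (a * norm \<xi>))\<^sup>2) = exp (2 * a * norm \<xi>) + exp (- (2 * a * norm \<xi>))"
    using cosh_double[of "a * norm \<xi>"] by (simp add: cosh_def mult.assoc)
  finally show ?thesis by (simp add: distrib_right)
qed

section \<open>The Fourier transform of Clifford-valued functions\<close>

text \<open>Along sequences tending to 0 the difference quotients of the integrand converge
  pointwise, and the operator norm bound makes dominated convergence applicable in all directions at
  once.\<close>

lemma has_derivative_integral:
  fixes f :: "'x::real_normed_vector \<Rightarrow> 'b \<Rightarrow> 'c::{banach,second_countable_topology}"
  assumes r: "r > 0"
    and int: "\<And>y. y \<in> ball x r \<Longrightarrow> integrable M (f y)"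
    and der: "\<And>y \<omega>. y \<in> ball x r \<Longrightarrow> ((\<lambda>y. f y \<omega>) has_derivative F y \<omega>) (at y)"
    and bd: "\<And>y \<omega>. y \<in> ball x r \<Longrightarrow> onorm (F y \<omega>) \<le> B \<omega>"
    and B: "integrable M B"
    and F: "\<And>v. integrable M (\<lambda>\<omega>. F x \<omega> v)"
  shows "((\<lambda>y. \<integral>\<omega>. f y \<omega> \<partial>M) has_derivative (\<lambda>v. \<integral>\<omega>. F x \<omega> v \<partial>M)) (at x)"
proof -
  have x: "x \<in> ball x r" using r by simp
  have bl: "bounded_linear (F y \<omega>)" if "y \<in> ball x r" for y \<omega>
    using der[OF that] by (rule has_derivative_bounded_linear)
  have Fb: "norm (F y \<omega> v) \<le> B \<omega> * norm v" if "y \<in> ball x r" for y \<omega> v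
    by (rule order_trans[OF onorm[OF bl[OF that]] mult_right_mono[OF bd[OF that]]]) simp
  define D where "D v = (\<integral>\<omega>. F x \<omega> v \<partial>M)" for v
  have Db: "bounded_linear D"
  proof (rule bounded_linear_intro[where K="\<integral>\<omega>. B \<omega> \<partial>M"])
    show "D (u + v) = D u + D v" for u v
      unfolding D_def linear_simps(1)[OF bl[OF x]] by (rule Bochner_Integration.integral_add[OF F F])
    show "D (c *\<^sub>R v) = c *\<^sub>R D v" for c v
      unfolding D_def linear_simps(5)[OF bl[OF x]] by simp
    show "norm (D v) \<le> norm v * (\<integral>\<omega>. B \<omega> \<partial>M)" for v
    proof -
      have "norm (D v) \<le> (\<integral>\<omega>. B \<omega> * norm v \<partial>M)"
        unfolding D_def
        by (rule order_trans[OF integral_norm_bound integral_mono[OF integrable_norm[OF F] integrable_mult_left[OF B] Fb[OF x]]])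
      then show ?thesis by (simp add: mult.commute)
    qed
  qed
  have lim: "(\<lambda>n. norm ((\<integral>\<omega>. f (x + h n) \<omega> \<partial>M) - (\<integral>\<omega>. f x \<omega> \<partial>M) - D (h n)) / norm (h n)) \<longlonglongrightarrow> 0"
    if h: "\<And>n. h n \<noteq> 0" "h \<longlonglongrightarrow> 0" "\<And>n. norm (h n) < r" for h :: "nat \<Rightarrow> 'x"
  proof -
    have xh: "x + h n \<in> ball x r" for n using h(3)[of n] by (simp add: dist_norm)
    define R where "R n \<omega> = f (x + h n) \<omega> - f x \<omega> - F x \<omega> (h n)" for n \<omega>
    have Ri: "integrable M (R n)" for n
      unfolding R_def by (intro Bochner_Integration.integrable_diff int xh x F)
    have "(\<lambda>n. \<integral>\<omega>. norm (R n \<omega>) / norm (h n) \<partial>M) \<longlonglongrightarrow> (\<integral>\<omega>. 0 \<partial>M)"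
    proof (rule integral_dominated_convergence[where w="\<lambda>\<omega>. 2 * B \<omega>"])
      show "AE \<omega> in M. (\<lambda>n. norm (R n \<omega>) / norm (h n)) \<longlonglongrightarrow> 0"
      proof (rule AE_I2)
        fix \<omega>
        have "((\<lambda>v. norm (f (x + v) \<omega> - f x \<omega> - F x \<omega> v) / norm v) \<longlongrightarrow> 0) (at 0)"
          using der[OF x, of \<omega>] unfolding has_derivative_at by simp
        then have "((\<lambda>v. norm (f (x + v) \<omega> - f x \<omega> - F x \<omega> v) / norm v) \<circ> h) \<longlonglongrightarrow> 0"
          using h(1,2) unfolding tendsto_at_iff_sequentially by auto
        then show "(\<lambda>n. norm (R n \<omega>) / norm (h n)) \<longlonglongrightarrow> 0" by (simp add: R_def o_def)
      qed
      show "AE \<omega> in M. norm (norm (R n \<omega>) / norm (h n)) \<le> 2 * B \<omega>" for n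
      proof (rule AE_I2)
        fix \<omega>
        \<comment> \<open>The mean value inequality on the convex ball bounds the increment by B,
          and the linear part is bounded by B as well, whence the majorant 2 B.\<close>
        have "norm (f (x + h n) \<omega> - f x \<omega>) \<le> B \<omega> * norm (x + h n - x)"
          by (rule differentiable_bound[of "ball x r" "\<lambda>y. f y \<omega>" "\<lambda>y. F y \<omega>"])
             (use r in \<open>auto intro!: bd xh x has_derivative_at_withinI[OF der] simp del: mem_ball\<close>)
        then have "norm (R n \<omega>) \<le> 2 * B \<omega> * norm (h n)"
          using norm_triangle_ineq4[of "f (x + h n) \<omega> - f x \<omega>" "F x \<omega> (h n)"] Fb[OF x, of \<omega> "h n"] by (simp add: R_def)
        then show "norm (norm (R n \<omega>) / norm (h n)) \<le> 2 * B \<omega>" using h(1)[of n] by (simp add: field_simps)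
      qed
      show "(\<lambda>\<omega>. norm (R n \<omega>) / norm (h n)) \<in> borel_measurable M" for n
        using borel_measurable_integrable[OF Ri] by measurable
    qed (use B in auto)
    then have l0: "(\<lambda>n. \<integral>\<omega>. norm (R n \<omega>) / norm (h n) \<partial>M) \<longlonglongrightarrow> 0" by simp
    have le: "norm (norm ((\<integral>\<omega>. f (x + h n) \<omega> \<partial>M) - (\<integral>\<omega>. f x \<omega> \<partial>M) - D (h n)) / norm (h n)) \<le> (\<integral>\<omega>. norm (R n \<omega>) / norm (h n) \<partial>M)" for n
    proof -
      have "(\<integral>\<omega>. f (x + h n) \<omega> \<partial>M) - (\<integral>\<omega>. f x \<omega> \<partial>M) - D (h n) = (\<integral>\<omega>. R n \<omega> \<partial>M)"
        unfolding R_def D_def by (simp add: int[OF xh] int[OF x] F)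
      then show ?thesis using integral_norm_bound[of M "R n"] by (simp add: divide_right_mono)
    qed
    show ?thesis by (rule Lim_null_comparison[OF always_eventually[OF allI[OF le]] l0])
  qed
  have "((\<lambda>h. norm ((\<integral>\<omega>. f (x + h) \<omega> \<partial>M) - (\<integral>\<omega>. f x \<omega> \<partial>M) - D h) / norm h) \<longlongrightarrow> 0) (at 0)"
    unfolding tendsto_at_iff_sequentially
  proof (intro allI impI)
    fix X :: "nat \<Rightarrow> 'x" assume X: "\<forall>i. X i \<in> UNIV - {0}" "X \<longlonglongrightarrow> 0"
    obtain N where N: "\<And>n. n \<ge> N \<Longrightarrow> norm (X n) < r"
      using LIMSEQ_D[OF X(2) r] by auto
    show "((\<lambda>h. norm ((\<integral>\<omega>. f (x + h) \<omega> \<partial>M) - (\<integral>\<omega>. f x \<omega> \<partial>M) - D h) / norm h) \<circ> X) \<longlonglongrightarrow> 0"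
      unfolding o_def
      by (rule LIMSEQ_offset[of _ N], rule lim) (use X N in \<open>auto intro: LIMSEQ_ignore_initial_segment\<close>)
  qed
  then show ?thesis unfolding has_derivative_at D_def[symmetric] using Db by simp
qed

lemma has_vector_derivative_integral:
  fixes f :: "real \<Rightarrow> 'b \<Rightarrow> 'c::{banach,second_countable_topology}"
  assumes r: "r > 0"
    and int: "\<And>y. \<bar>y - x\<bar> < r \<Longrightarrow> integrable M (f y)"
    and der: "\<And>y \<omega>. \<bar>y - x\<bar> < r \<Longrightarrow> ((\<lambda>y. f y \<omega>) has_vector_derivative F y \<omega>) (at y)"
    and bd: "\<And>y \<omega>. \<bar>y - x\<bar> < r \<Longrightarrow> norm (F y \<omega>) \<le> B \<omega>"
    and B: "integrable M B"
    and F: "integrable M (F x)"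
  shows "((\<lambda>y. \<integral>\<omega>. f y \<omega> \<partial>M) has_vector_derivative (\<integral>\<omega>. F x \<omega> \<partial>M)) (at x)"
proof -
  have "((\<lambda>y. \<integral>\<omega>. f y \<omega> \<partial>M) has_derivative (\<lambda>v. \<integral>\<omega>. v *\<^sub>R F x \<omega> \<partial>M)) (at x)"
  proof (rule has_derivative_integral[OF r, where B=B])
    show "onorm (\<lambda>v. v *\<^sub>R F y \<omega>) \<le> B \<omega>" if "y \<in> ball x r" for y \<omega>
    proof -
      have "onorm (\<lambda>v. v *\<^sub>R F y \<omega>) \<le> norm (F y \<omega>)" by (rule onorm_bound) (auto simp: mult.commute)
      then show ?thesis using bd[of y \<omega>] that by (simp add: dist_real_def abs_minus_commute)
    qed
  qed (use int der B F in \<open>auto simp: has_vector_derivative_def dist_real_def abs_minus_commute\<close>)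
  then show ?thesis by (simp add: has_vector_derivative_def)
qed

section \<open>The componentwise transform and its Plancherel inequality\<close>

definition cft :: "real \<Rightarrow> ((real, 'm::finite) vec \<Rightarrow> 'm clif) \<Rightarrow> (real, 'm) vec \<Rightarrow> 'm clif" where
  "cft s h \<xi> = (\<integral>x. cscale (cis (s * (x \<bullet> \<xi>))) (h x) \<partial>lborel)"

lemma integrable_cscale_cis:
  assumes "integrable lborel h" "p \<in> borel_measurable borel"
  shows "integrable lborel (\<lambda>x::'a::euclidean_space. cscale (cis (p x)) (h x))"
proof -
  note [measurable] = assms(2) borel_measurable_integrable[OF assms(1)]
  show ?thesis
    by (rule Bochner_Integration.integrable_bound[OF assms(1)]) auto
qed

lemma integrable_nth: "integrable M h \<Longrightarrow> integrable M (\<lambda>x. (h x :: 'm::finite clif) $ T)"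
  by (rule integrable_bounded_linear[OF bounded_linear_vec_nth])

lemma integrable_cft: "integrable lborel h \<Longrightarrow> integrable lborel (\<lambda>x. cscale (cis (s * (x \<bullet> \<xi>))) (h x))"
  by (rule integrable_cscale_cis) auto

lemma cft_nth: "integrable lborel h \<Longrightarrow> cft s h \<xi> $ T = ft s (\<lambda>x. h x $ T) \<xi>"
  unfolding cft_def ft_def
  by (subst integral_bounded_linear[OF bounded_linear_vec_nth integrable_cft, symmetric]) auto

lemma cft_measurable [measurable]:
  assumes "h \<in> borel_measurable borel" shows "cft s h \<in> borel_measurable borel"
proof -
  note [measurable] = assms
  show ?thesis unfolding cft_def by measurable
qed

lemma cft_diff: "integrable lborel h \<Longrightarrow> integrable lborel k \<Longrightarrow> cft s (\<lambda>x. h x - k x) \<xi> = cft s h \<xi> - cft s k \<xi>"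
  unfolding cft_def by (simp add: cscale_diff_right integrable_cft)

lemma norm_cft_le: "norm (cft s h \<xi>) \<le> (\<integral>x. norm (h x) \<partial>lborel)"
  unfolding cft_def by (rule order_trans[OF integral_norm_bound]) simp

lemma nth_measurable [measurable (raw)]:
  "h \<in> borel_measurable M \<Longrightarrow> (\<lambda>x. (h x :: 'm::finite clif) $ T) \<in> borel_measurable M"
  by (rule borel_measurable_continuous_on[where f="\<lambda>x. x $ T"]) (auto intro!: continuous_intros)

lemma L2_nth:
  assumes "L2 (h :: _ \<Rightarrow> 'm::finite clif)"
  shows "L2 (\<lambda>x. h x $ T)" "l2 (\<lambda>x. h x $ T) \<le> l2 h"
proof -
  note [measurable] = L2_measurable[OF assms]
  note b = L2_bound[OF assms, of "\<lambda>x. h x $ T" 1]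
  show "L2 (\<lambda>x. h x $ T)" by (rule b(1)) (auto intro!: Finite_Cartesian_Product.norm_nth_le)
  have "l2 (\<lambda>x. h x $ T) \<le> 1 * l2 h" by (rule b(2)) (auto intro!: Finite_Cartesian_Product.norm_nth_le)
  then show "l2 (\<lambda>x. h x $ T) \<le> l2 h" by simp
qed

lemma cft_plancherel_le:
  fixes h :: "(real, 'm::finite) vec \<Rightarrow> 'm clif"
  assumes "\<bar>s\<bar> = 1" "integrable lborel h" "L2 h"
  shows "L2 (cft s h)" "l2 (cft s h) \<le> sqrt ((2 * pi) ^ CARD('m)) * l2 h"
proof -
  note [measurable] = borel_measurable_integrable[OF assms(2)]
  have "(\<integral>\<^sup>+\<xi>. ennreal ((norm (cft s h \<xi>))\<^sup>2) \<partial>lborel) = (\<integral>\<^sup>+\<xi>. (\<Sum>T\<in>UNIV. ennreal ((norm (ft s (\<lambda>x. h x $ T) \<xi>))\<^sup>2)) \<partial>lborel)"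
    by (simp add: norm_vec_power2 cft_nth[OF assms(2)])
  also have "\<dots> = (\<Sum>T\<in>UNIV. \<integral>\<^sup>+\<xi>. ennreal ((norm (ft s (\<lambda>x. h x $ T) \<xi>))\<^sup>2) \<partial>lborel)"
    by (rule nn_integral_sum) measurable
  also have "\<dots> \<le> (\<Sum>T\<in>UNIV. ennreal ((2 * pi) ^ CARD('m) * (l2 (\<lambda>x. h x $ T))\<^sup>2))"
    using ft_plancherel_le[OF assms(1) integrable_nth[OF assms(2)] L2_nth(1)[OF assms(3)]]
    by (intro sum_mono) simp
  also have "\<dots> = ennreal ((2 * pi) ^ CARD('m) * (\<Sum>T\<in>UNIV. (l2 (\<lambda>x. h x $ T))\<^sup>2))"
    by (subst sum_ennreal) (auto simp: sum_distrib_left)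
  also have "(\<Sum>T\<in>UNIV. (l2 (\<lambda>x. h x $ T))\<^sup>2) = (l2 h)\<^sup>2"
    unfolding l2_power2 norm_vec_power2
    by (rule Bochner_Integration.integral_sum[symmetric]) (rule L2_integrable[OF L2_nth(1)[OF assms(3)]])
  also have "(2 * pi) ^ CARD('m) * (l2 h)\<^sup>2 = (sqrt ((2 * pi) ^ CARD('m)) * l2 h)\<^sup>2"
    by (simp add: power_mult_distrib)
  finally have le: "(\<integral>\<^sup>+\<xi>. ennreal ((norm (cft s h \<xi>))\<^sup>2) \<partial>lborel) \<le> ennreal ((sqrt ((2 * pi) ^ CARD('m)) * l2 h)\<^sup>2)" .
  show "L2 (cft s h)" by (rule L2I_nn(1)[OF _ le]) auto
  show "l2 (cft s h) \<le> sqrt ((2 * pi) ^ CARD('m)) * l2 h" by (rule L2I_nn(2)[OF _ le]) auto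
qed

lemma cft_unique:
  fixes k :: "(real, 'm::finite) vec \<Rightarrow> 'm clif"
  assumes "integrable lborel k" "\<And>x. cft 1 k x = 0"
  shows "AE x in lborel. k x = 0"
proof -
  have "AE x in lborel. k x $ T = 0" for T
    using assms(2) by (intro ft_unique integrable_nth assms(1)) (simp flip: cft_nth[OF assms(1)])
  then have "AE x in lborel. \<forall>T\<in>UNIV. k x $ T = 0"
    by (intro AE_finite_allI) auto
  then show ?thesis by eventually_elim (simp add: vec_eq_iff)
qed

text \<open>Cauchy-Schwarz of f against the indicator of the supporting ball.\<close>

lemma L2_integrable_bounded_support:
  fixes f :: "'a::euclidean_space \<Rightarrow> 'b::euclidean_space"
  assumes "L2 f" "u \<in> borel_measurable borel" "\<And>x. norm (u x) \<le> c * norm (f x)" "\<And>x. norm x > R \<Longrightarrow> u x = (0::'b)"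
  shows "integrable lborel u"
proof -
  note [measurable] = L2_measurable[OF assms(1)] assms(2)
  have ic: "integrable lborel (indicator (cball 0 R) :: 'a \<Rightarrow> real)"
    using emeasure_lborel_cball_finite[of 0 R] by (intro integrable_real_indicator) auto
  have ind: "L2 (indicator (cball 0 R) :: 'a \<Rightarrow> real)"
  proof -
    have "(\<lambda>x::'a. (norm (indicator (cball 0 R) x :: real))\<^sup>2) = indicator (cball 0 R)" by (auto simp: indicator_def)
    with ic show ?thesis unfolding L2_def by auto
  qed
  show ?thesis
  proof (rule Bochner_Integration.integrable_bound[OF integrable_mult_right[OF L2_Cauchy_Schwarz(1)[OF assms(1) ind], of c]])
    show "AE x in lborel. norm (u x) \<le> norm (c * (norm (f x) * norm (indicator (cball 0 R) x :: real)))"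
    proof (rule AE_I2)
      fix x show "norm (u x) \<le> norm (c * (norm (f x) * norm (indicator (cball 0 R) x :: real)))"
        using assms(3)[of x] assms(4)[of x] by (cases "norm x > R") (auto simp: indicator_def)
    qed
  qed simp
qed

text \<open>The family of factors is kept general: the sharp truncation to balls defines the L2
  transform, whereas the evolution equation needs a differentiable one.\<close>

lemma l2_cutoff_tendsto:
  fixes f :: "'a::euclidean_space \<Rightarrow> 'b::euclidean_space" and \<rho> :: "real \<Rightarrow> 'a \<Rightarrow> real"
  assumes f: "L2 f" and [measurable]: "\<And>R. \<rho> R \<in> borel_measurable borel"
    and bd: "\<And>R x. \<bar>\<rho> R x\<bar> \<le> 1" and lim: "\<And>x. ((\<lambda>R. \<rho> R x) \<longlongrightarrow> 1) at_top"
  shows "((\<lambda>R. l2 (\<lambda>x. f x - \<rho> R x *\<^sub>R f x)) \<longlongrightarrow> 0) at_top"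
proof -
  note [measurable] = L2_measurable[OF f]
  have "((\<lambda>R. \<integral>x. (norm (f x - \<rho> R x *\<^sub>R f x))\<^sup>2 \<partial>lborel) \<longlongrightarrow> (\<integral>x. 0 \<partial>(lborel::'a measure))) at_top"
  proof (rule integral_dominated_convergence_at_top[where w="\<lambda>x. 4 * (norm (f x))\<^sup>2"])
    show "AE x in lborel. ((\<lambda>R. (norm (f x - \<rho> R x *\<^sub>R f x))\<^sup>2) \<longlongrightarrow> 0) at_top"
    proof (rule AE_I2)
      fix x
      have "((\<lambda>R. (norm (f x - \<rho> R x *\<^sub>R f x))\<^sup>2) \<longlongrightarrow> (norm (f x - 1 *\<^sub>R f x))\<^sup>2) at_top"
        by (intro tendsto_intros lim)
      then show "((\<lambda>R. (norm (f x - \<rho> R x *\<^sub>R f x))\<^sup>2) \<longlongrightarrow> 0) at_top" by simp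
    qed
    show "\<forall>\<^sub>F R in at_top. AE x in lborel. norm ((norm (f x - \<rho> R x *\<^sub>R f x))\<^sup>2) \<le> 4 * (norm (f x))\<^sup>2"
    proof (intro always_eventually allI AE_I2)
      fix R x
      have "norm (f x - \<rho> R x *\<^sub>R f x) \<le> norm (f x) + \<bar>\<rho> R x\<bar> * norm (f x)"
        using norm_triangle_ineq4[of "f x" "\<rho> R x *\<^sub>R f x"] by simp
      also have "\<dots> \<le> 2 * norm (f x)" using mult_right_mono[OF bd[of R x], of "norm (f x)"] by simp
      finally have "(norm (f x - \<rho> R x *\<^sub>R f x))\<^sup>2 \<le> (2 * norm (f x))\<^sup>2" by (intro power_mono) auto
      then show "norm ((norm (f x - \<rho> R x *\<^sub>R f x))\<^sup>2) \<le> 4 * (norm (f x))\<^sup>2" by (simp add: power_mult_distrib)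
    qed
  qed (use L2_integrable[OF f] in auto)
  then have "((\<lambda>R. sqrt (\<integral>x. (norm (f x - \<rho> R x *\<^sub>R f x))\<^sup>2 \<partial>lborel)) \<longlongrightarrow> sqrt 0) at_top"
    by (intro tendsto_real_sqrt) simp
  then show ?thesis by (simp add: l2_def)
qed

lemma indicator_cball_tendsto:
  "((\<lambda>R. indicator (cball 0 R) (x::'a::euclidean_space) :: real) \<longlongrightarrow> 1) at_top"
  by (rule tendsto_eventually) (auto simp: eventually_at_top_linorder indicator_def intro!: exI[of _ "norm x"])

lemma L2_indicator:
  assumes "L2 f"
  shows "L2 (\<lambda>x. indicator (cball 0 R) x *\<^sub>R f x)" "integrable lborel (\<lambda>x. indicator (cball 0 R) x *\<^sub>R f x)"
    "((\<lambda>R. l2 (\<lambda>x. f x - indicator (cball 0 R) x *\<^sub>R f x)) \<longlongrightarrow> 0) at_top"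
proof -
  note [measurable] = L2_measurable[OF assms]
  show "L2 (\<lambda>x. indicator (cball 0 R) x *\<^sub>R f x)"
    by (rule L2_bound(1)[OF assms, where c=1]) (auto simp: indicator_def)
  show "integrable lborel (\<lambda>x. indicator (cball 0 R) x *\<^sub>R f x)"
    by (rule L2_integrable_bounded_support[OF assms, where c=1 and R=R]) (auto simp: indicator_def)
  show "((\<lambda>R. l2 (\<lambda>x. f x - indicator (cball 0 R) x *\<^sub>R f x)) \<longlongrightarrow> 0) at_top"
  proof (rule l2_cutoff_tendsto[OF assms])
    show "((\<lambda>R. indicator (cball 0 R) x :: real) \<longlongrightarrow> 1) at_top" for x :: 'a
      by (rule indicator_cball_tendsto)
    show "(indicator (cball 0 R) :: 'a \<Rightarrow> real) \<in> borel_measurable borel" for R :: real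
      by (rule borel_measurable_indicator) simp
    show "\<bar>indicator (cball 0 R) x :: real\<bar> \<le> 1" for R and x :: 'a by (simp add: indicator_def)
  qed
qed

text \<open>The second clause characterises g as the value at f of the unique continuous extension
  of the Fourier transform from L1 Int L2 to L2, without reference to an approximating sequence.\<close>
definition is_ft :: "((real, 'm::finite) vec \<Rightarrow> 'm clif) \<Rightarrow> ((real, 'm) vec \<Rightarrow> 'm clif) \<Rightarrow> bool" where
  "is_ft f g \<longleftrightarrow> L2 g \<and> (\<forall>p. integrable lborel p \<longrightarrow> L2 p \<longrightarrow>
     l2 (\<lambda>\<xi>. g \<xi> - cft (-1) p \<xi>) \<le> sqrt ((2 * pi) ^ CARD('m)) * l2 (\<lambda>x. f x - p x))"

text \<open>The transforms of the truncations of f are Cauchy by the Plancherel inequality.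
  Comparing their limit with the transform of an arbitrary q through the n-th truncation costs only
  terms that vanish with n.\<close>

lemma is_ft_exists:
  fixes f :: "(real, 'm::finite) vec \<Rightarrow> 'm clif"
  assumes f: "L2 f"
  obtains g where "is_ft f g"
proof -
  define K where "K = sqrt ((2 * pi) ^ CARD('m))"
  have K: "0 \<le> K" by (simp add: K_def)
  define p where "p n x = indicator (cball 0 (real n)) x *\<^sub>R f x" for n x
  have p: "integrable lborel (p n)" "L2 (p n)" for n
    unfolding p_def by (rule L2_indicator[OF f])+
  have lim: "(\<lambda>n. l2 (\<lambda>x. f x - p n x)) \<longlonglongrightarrow> 0"
    unfolding p_def by (rule filterlim_compose[OF L2_indicator(3)[OF f] filterlim_real_sequentially])
  have ftp: "L2 (cft (-1) (p n))" for n by (rule cft_plancherel_le[OF _ p]) simp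
  have contr: "l2 (\<lambda>\<xi>. cft (-1) h \<xi> - cft (-1) k \<xi>) \<le> K * l2 (\<lambda>x. h x - k x)"
    if "integrable lborel h" "L2 h" "integrable lborel k" "L2 k" for h k :: "(real, 'm) vec \<Rightarrow> 'm clif"
    using cft_plancherel_le(2)[of "-1" "\<lambda>x. h x - k x"] that
    by (simp add: cft_diff[OF that(1,3), abs_def] L2_diff K_def)
  obtain g where g: "L2 g" "(\<lambda>n. l2 (\<lambda>x. g x - cft (-1) (p n) x)) \<longlonglongrightarrow> 0"
  proof (rule L2_complete[OF ftp])
    fix e :: real assume e: "e > 0"
    \<comment> \<open>Dividing by K + 1 rather than K makes the last comparison strict: 2 K e' < 2
      (K + 1) e' = e.\<close>
    define e' where "e' = (e / 2) / (K + 1)"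
    have e': "e' > 0" using e K by (simp add: e'_def)
    then obtain N where N: "\<And>n. n \<ge> N \<Longrightarrow> l2 (\<lambda>x. f x - p n x) < e'"
      using LIMSEQ_D[OF lim e'] by auto
    show "\<exists>N. \<forall>m\<ge>N. \<forall>n\<ge>N. l2 (\<lambda>x. cft (-1) (p m) x - cft (-1) (p n) x) < e"
    proof (intro exI allI impI)
      fix m n assume mn: "N \<le> m" "N \<le> n"
      have "l2 (\<lambda>x. cft (-1) (p m) x - cft (-1) (p n) x) \<le> K * l2 (\<lambda>x. p m x - p n x)"
        by (rule contr[OF p p])
      also have "\<dots> \<le> K * (l2 (\<lambda>x. p m x - f x) + l2 (\<lambda>x. f x - p n x))"
        by (rule mult_left_mono[OF l2_triangle_diff[OF p(2) f p(2)] K])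
      also have "\<dots> \<le> K * (e' + e')"
        using N[OF mn(1)] N[OF mn(2)] by (intro mult_left_mono K add_mono) (auto simp: l2_minus_commute[of "p m"])
      also have "\<dots> < (K + 1) * (2 * e')" using e' by (simp add: algebra_simps)
      also have "\<dots> = e" using K by (simp add: e'_def divide_simps)
      finally show "l2 (\<lambda>x. cft (-1) (p m) x - cft (-1) (p n) x) < e" .
    qed
  qed blast
  have "l2 (\<lambda>\<xi>. g \<xi> - cft (-1) q \<xi>) \<le> K * l2 (\<lambda>x. f x - q x)" if q: "integrable lborel q" "L2 q" for q
  proof (rule LIMSEQ_le_const)
    show "(\<lambda>n. l2 (\<lambda>\<xi>. g \<xi> - cft (-1) (p n) \<xi>) + K * (l2 (\<lambda>x. f x - p n x) + l2 (\<lambda>x. f x - q x))) \<longlonglongrightarrow> K * l2 (\<lambda>x. f x - q x)"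
      by (rule tendsto_eq_intros g(2) lim refl | simp)+
    have "l2 (\<lambda>\<xi>. g \<xi> - cft (-1) q \<xi>) \<le> l2 (\<lambda>\<xi>. g \<xi> - cft (-1) (p n) \<xi>) + K * (l2 (\<lambda>x. f x - p n x) + l2 (\<lambda>x. f x - q x))" for n
    proof -
      have "l2 (\<lambda>\<xi>. g \<xi> - cft (-1) q \<xi>) \<le> l2 (\<lambda>\<xi>. g \<xi> - cft (-1) (p n) \<xi>) + l2 (\<lambda>\<xi>. cft (-1) (p n) \<xi> - cft (-1) q \<xi>)"
        by (rule l2_triangle_diff[OF g(1) ftp]) (rule cft_plancherel_le[OF _ q], simp)
      moreover have "l2 (\<lambda>\<xi>. cft (-1) (p n) \<xi> - cft (-1) q \<xi>) \<le> K * (l2 (\<lambda>x. p n x - f x) + l2 (\<lambda>x. f x - q x))"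
        by (rule order_trans[OF contr[OF p q] mult_left_mono[OF l2_triangle_diff[OF p(2) f q(2)] K]])
      ultimately show ?thesis by (simp add: l2_minus_commute[of "p n"])
    qed
    then show "\<exists>N. \<forall>n\<ge>N. l2 (\<lambda>\<xi>. g \<xi> - cft (-1) q \<xi>) \<le> l2 (\<lambda>\<xi>. g \<xi> - cft (-1) (p n) \<xi>) + K * (l2 (\<lambda>x. f x - p n x) + l2 (\<lambda>x. f x - q x))"
      by blast
  qed
  then have "is_ft f g" using g(1) by (simp add: is_ft_def K_def)
  then show thesis by (rule that)
qed

lemma is_ft_tendsto:
  assumes "is_ft f g" "\<And>n. integrable lborel (p n)" "\<And>n. L2 (p n)" "((\<lambda>n. l2 (\<lambda>x. f x - p n x)) \<longlongrightarrow> 0) F"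
  shows "((\<lambda>n. l2 (\<lambda>\<xi>. g \<xi> - cft (-1) (p n) \<xi>)) \<longlongrightarrow> 0) F"
proof (rule Lim_null_comparison)
  show "\<forall>\<^sub>F n in F. norm (l2 (\<lambda>\<xi>. g \<xi> - cft (-1) (p n) \<xi>)) \<le> sqrt ((2 * pi) ^ CARD('a)) * l2 (\<lambda>x. f x - p n x)"
    using assms(1-3) by (simp add: is_ft_def)
  show "((\<lambda>n. sqrt ((2 * pi) ^ CARD('a)) * l2 (\<lambda>x. f x - p n x)) \<longlongrightarrow> 0) F"
    by (rule tendsto_mult_right_zero[OF assms(4)])
qed

text \<open>The defining inequality tested with p = 0.\<close>

lemma is_ft_l2_le:
  fixes f :: "(real, 'm::finite) vec \<Rightarrow> 'm clif"
  assumes "is_ft f g" shows "l2 g \<le> sqrt ((2 * pi) ^ CARD('m)) * l2 f"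
proof -
  have "cft (-1) (\<lambda>x. 0) \<xi> = (0 :: 'm clif)" for \<xi> by (simp add: cft_def vec_eq_iff cscale_def zero_vec_def[symmetric])
  then show ?thesis using assms unfolding is_ft_def by (auto dest: spec[of _ "\<lambda>x. 0"])
qed

text \<open>In each component the truncations of h to balls serve as the approximating sequence of
  \<open>ft_inversion\<close>.\<close>

lemma cft_inversion:
  fixes h g :: "(real, 'm::finite) vec \<Rightarrow> 'm clif"
  assumes h: "L2 h" "isCont h y" and g: "is_ft h g" "integrable lborel g"
  shows "h y = (1 / (2 * pi) ^ CARD('m)) *\<^sub>R cft 1 g y"
  unfolding vec_eq_iff
proof
  fix T
  define p where "p n x = indicator (cball 0 (real n)) x *\<^sub>R h x" for n x
  have p: "integrable lborel (p n)" "L2 (p n)" for n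
    unfolding p_def by (rule L2_indicator[OF h(1)])+
  have lim: "(\<lambda>n. l2 (\<lambda>x. h x - p n x)) \<longlonglongrightarrow> 0"
    unfolding p_def by (rule filterlim_compose[OF L2_indicator(3)[OF h(1)] filterlim_real_sequentially])
  have gL: "L2 g" using g(1) by (simp add: is_ft_def)
  have ftp: "L2 (cft (-1) (p n))" for n by (rule cft_plancherel_le[OF _ p]) simp
  have comp: "(\<lambda>n. l2 (\<lambda>x. u x $ T - v n x $ T)) \<longlonglongrightarrow> 0" if "(\<lambda>n. l2 (\<lambda>x. u x - v n x)) \<longlonglongrightarrow> 0" "L2 u" "\<And>n. L2 (v n)"
    for u :: "(real, 'm) vec \<Rightarrow> 'm clif" and v
  proof (rule Lim_null_comparison[OF always_eventually that(1)], rule allI)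
    fix n show "norm (l2 (\<lambda>x. u x $ T - v n x $ T)) \<le> l2 (\<lambda>x. u x - v n x)"
      using L2_nth(2)[OF L2_diff[OF that(2,3)]] by simp
  qed
  have "(2 * pi) ^ DIM((real, 'm) vec) * h y $ T = ft 1 (\<lambda>x. g x $ T) y"
  proof (rule ft_inversion[where p="\<lambda>n x. p n x $ T"])
    show "(\<lambda>n. l2 (\<lambda>\<xi>. g \<xi> $ T - ft (-1) (\<lambda>x. p n x $ T) \<xi>)) \<longlonglongrightarrow> 0"
      using comp[OF is_ft_tendsto[OF g(1) p lim] gL ftp] by (simp add: cft_nth[OF p(1)])
    show "L2 (ft (-1) (\<lambda>x. p n x $ T))" for n
      using L2_nth(1)[OF ftp, where T=T] by (simp add: cft_nth[OF p(1)])
    show "isCont (\<lambda>x. h x $ T) y" using h(2) by (intro continuous_intros)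
  qed (intro L2_nth(1) h gL p integrable_nth g comp[OF lim])+
  then have "(2 * pi) ^ CARD('m) * h y $ T = cft 1 g y $ T" by (simp add: cft_nth[OF g(2)])
  then show "h y $ T = ((1 / (2 * pi) ^ CARD('m)) *\<^sub>R cft 1 g y) $ T"
    unfolding vector_scaleR_component by (simp add: scaleR_conv_of_real[of _ "_::complex"] field_simps)
qed

section \<open>Monogenic functions on slabs\<close>

text \<open>With an existential derivative, candidates can be supplied directly; uniqueness of the
  derivative identifies them with \<open>frechet_derivative\<close>.\<close>

lemma left_monogenic_iff:
  fixes F :: "real \<times> ((real, 'm::{finite,linorder}) vec) \<Rightarrow> 'm clif"
  shows "left_monogenic \<Omega> F \<longleftrightarrow> open \<Omega> \<and> (\<exists>D. (\<forall>x\<in>\<Omega>. (F has_derivative D x) (at x)) \<and>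
    continuous_on \<Omega> (\<lambda>x. D x (1, 0)) \<and> (\<forall>k. continuous_on \<Omega> (\<lambda>x. D x (0, axis k 1))) \<and>
    (\<forall>x\<in>\<Omega>. D x (1, 0) + (\<Sum>k\<in>UNIV. clif_mult (clif_gen k) (D x (0, axis k 1))) = 0))"
  (is "?L \<longleftrightarrow> ?R")
proof
  assume L: ?L
  have "(F has_derivative frechet_derivative F (at x)) (at x)" if "x \<in> \<Omega>" for x
    using L that unfolding left_monogenic_def by (simp add: frechet_derivative_works)
  then show ?R using L unfolding left_monogenic_def pd0_def[abs_def] pdk_def[abs_def]
    by (intro conjI exI[of _ "\<lambda>x. frechet_derivative F (at x)"]) auto
next
  assume ?R
  then obtain D where o: "open \<Omega>" and D: "\<And>x. x \<in> \<Omega> \<Longrightarrow> (F has_derivative D x) (at x)"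
    and c: "continuous_on \<Omega> (\<lambda>x. D x (1, 0))" "\<And>k. continuous_on \<Omega> (\<lambda>x. D x (0, axis k 1))"
    and e: "\<And>x. x \<in> \<Omega> \<Longrightarrow> D x (1, 0) + (\<Sum>k\<in>UNIV. clif_mult (clif_gen k) (D x (0, axis k 1))) = 0"
    by blast
  have fd: "frechet_derivative F (at x) = D x" if "x \<in> \<Omega>" for x
    using frechet_derivative_at[OF D[OF that]] by simp
  have "continuous_on \<Omega> (pd0 F)"
    using c(1) by (rule continuous_on_eq) (simp add: pd0_def fd)
  moreover have "continuous_on \<Omega> (pdk F k)" for k
    using c(2)[of k] by (rule continuous_on_eq) (simp add: pdk_def fd)
  ultimately show ?L unfolding left_monogenic_def
    using o D e by (auto simp: pd0_def pdk_def fd differentiable_def)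
qed

lemma left_monogenic_add:
  assumes "left_monogenic \<Omega> F" "left_monogenic \<Omega> G" shows "left_monogenic \<Omega> (\<lambda>x. F x + G x)"
proof -
  from assms(1) obtain D where D: "\<forall>x\<in>\<Omega>. (F has_derivative D x) (at x)"
    "continuous_on \<Omega> (\<lambda>x. D x (1, 0))" "\<forall>k. continuous_on \<Omega> (\<lambda>x. D x (0, axis k 1))"
    "\<forall>x\<in>\<Omega>. D x (1, 0) + (\<Sum>k\<in>UNIV. clif_mult (clif_gen k) (D x (0, axis k 1))) = 0"
    unfolding left_monogenic_iff by blast
  from assms(2) obtain E where E: "\<forall>x\<in>\<Omega>. (G has_derivative E x) (at x)"
    "continuous_on \<Omega> (\<lambda>x. E x (1, 0))" "\<forall>k. continuous_on \<Omega> (\<lambda>x. E x (0, axis k 1))"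
    "\<forall>x\<in>\<Omega>. E x (1, 0) + (\<Sum>k\<in>UNIV. clif_mult (clif_gen k) (E x (0, axis k 1))) = 0"
    unfolding left_monogenic_iff by blast
  show ?thesis unfolding left_monogenic_iff
  proof (intro conjI exI[of _ "\<lambda>x v. D x v + E x v"] ballI allI)
    show "open \<Omega>" using assms(1) by (simp add: left_monogenic_def)
    show "((\<lambda>x. F x + G x) has_derivative (\<lambda>v. D x v + E x v)) (at x)" if "x \<in> \<Omega>" for x
      using D(1) E(1) that by (intro has_derivative_add) auto
    show "D x (1, 0) + E x (1, 0) + (\<Sum>k\<in>UNIV. clif_mult (clif_gen k) (D x (0, axis k 1) + E x (0, axis k 1))) = 0" if "x \<in> \<Omega>" for x
      using bspec[OF D(4) that] bspec[OF E(4) that]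
      by (simp add: clif_mult_add_right sum.distrib) (metis (no_types, lifting) add.assoc add.left_commute add_0)
  qed (use D E in \<open>auto intro!: continuous_intros\<close>)
qed

lemma left_monogenic_scaleR:
  assumes "left_monogenic \<Omega> F" shows "left_monogenic \<Omega> (\<lambda>x. c *\<^sub>R F x)"
proof -
  from assms(1) obtain D where D: "\<forall>x\<in>\<Omega>. (F has_derivative D x) (at x)"
    "continuous_on \<Omega> (\<lambda>x. D x (1, 0))" "\<forall>k. continuous_on \<Omega> (\<lambda>x. D x (0, axis k 1))"
    "\<forall>x\<in>\<Omega>. D x (1, 0) + (\<Sum>k\<in>UNIV. clif_mult (clif_gen k) (D x (0, axis k 1))) = 0"
    unfolding left_monogenic_iff by blast
  show ?thesis unfolding left_monogenic_iff
  proof (intro conjI exI[of _ "\<lambda>x v. c *\<^sub>R D x v"] ballI allI)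
    show "open \<Omega>" using assms(1) by (simp add: left_monogenic_def)
    show "((\<lambda>x. c *\<^sub>R F x) has_derivative (\<lambda>v. c *\<^sub>R D x v)) (at x)" if "x \<in> \<Omega>" for x
      using D(1) that by (intro has_derivative_scaleR_right) auto
    show "c *\<^sub>R D x (1, 0) + (\<Sum>k\<in>UNIV. clif_mult (clif_gen k) (c *\<^sub>R D x (0, axis k 1))) = 0" if "x \<in> \<Omega>" for x
      using bspec[OF D(4) that]
      by (simp add: clif_mult_scaleR_right scaleR_sum_right[symmetric] scaleR_right_distrib[symmetric])
  qed (use D in \<open>auto intro!: continuous_intros\<close>)
qed

lemma left_monogenic_subset:
  "left_monogenic \<Omega> F \<Longrightarrow> open \<Omega>' \<Longrightarrow> \<Omega>' \<subseteq> \<Omega> \<Longrightarrow> left_monogenic \<Omega>' F"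
  unfolding left_monogenic_def by (blast intro: continuous_on_subset)

lemma left_monogenic_cong:
  assumes "left_monogenic \<Omega> F" "\<And>x. x \<in> \<Omega> \<Longrightarrow> G x = F x" shows "left_monogenic \<Omega> G"
proof -
  from assms(1) obtain D where D: "\<forall>x\<in>\<Omega>. (F has_derivative D x) (at x)"
    "continuous_on \<Omega> (\<lambda>x. D x (1, 0))" "\<forall>k. continuous_on \<Omega> (\<lambda>x. D x (0, axis k 1))"
    "\<forall>x\<in>\<Omega>. D x (1, 0) + (\<Sum>k\<in>UNIV. clif_mult (clif_gen k) (D x (0, axis k 1))) = 0"
    and o: "open \<Omega>"
    unfolding left_monogenic_iff by blast
  have "(G has_derivative D x) (at x)" if "x \<in> \<Omega>" for x
    by (rule has_derivative_transform_within_open[OF bspec[OF D(1) that] o that]) (simp add: assms(2))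
  then show ?thesis unfolding left_monogenic_iff using D o by blast
qed

text \<open>Monogenicity is local; this glues the two half-space functions in the uniqueness
  proof.\<close>

lemma left_monogenic_Un:
  assumes "left_monogenic \<Omega> F" "left_monogenic \<Omega>' F" shows "left_monogenic (\<Omega> \<union> \<Omega>') F"
  using assms unfolding left_monogenic_def
  by (auto intro!: continuous_on_open_Un open_Un)

text \<open>One form for the strips, both half spaces and the whole space, with the set of slice
  heights as parameter.\<close>

definition slab :: "real set \<Rightarrow> (real \<times> ((real, 'm::finite) vec)) set" where
  "slab A = {x. fst x \<in> A}"

lemma strip_slab: "strip a = slab {-a<..<a}"
  and halfplus_slab: "halfplus a = slab {-a<..}"
  and halfminus_slab: "halfminus a = slab {..<a}"
  by (auto simp: strip_def halfplus_def halfminus_def slab_def)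

lemma fst_slab: "fst ` (slab A :: (real \<times> ((real, 'm::finite) vec)) set) = A"
proof -
  have "t \<in> fst ` (slab A :: (real \<times> ((real, 'm::finite) vec)) set)" if "t \<in> A" for t
    by (rule image_eqI[of _ _ "(t, 0)"]) (use that in \<open>auto simp: slab_def\<close>)
  then show ?thesis by (auto simp: slab_def)
qed

lemma open_slab: "open A \<Longrightarrow> open (slab A)"
  using open_vimage[of A fst] by (simp add: slab_def vimage_def continuous_on_fst)

lemma left_monogenic_continuous: "left_monogenic \<Omega> F \<Longrightarrow> continuous_on \<Omega> F"
  unfolding left_monogenic_def
  by (intro continuous_at_imp_continuous_on ballI differentiable_imp_continuous_within) auto

lemma left_monogenic_slice:
  assumes "left_monogenic (slab A) F" "t \<in> A"
  shows "continuous_on UNIV (\<lambda>y. F (t, y))" "(\<lambda>y. F (t, y)) \<in> borel_measurable borel"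
proof -
  show "continuous_on UNIV (\<lambda>y. F (t, y))"
    by (rule continuous_on_compose2[OF left_monogenic_continuous[OF assms(1)]])
       (use assms(2) in \<open>auto intro!: continuous_intros simp: slab_def\<close>)
  then show "(\<lambda>y. F (t, y)) \<in> borel_measurable borel" by (rule borel_measurable_continuous_onI)
qed

text \<open>Slices of monogenic functions are continuous, hence measurable, so the supremum of
  extended integrals can be traded for one real constant.\<close>

lemma H2_slab_iff:
  fixes F :: "real \<times> ((real, 'm::{finite,linorder}) vec) \<Rightarrow> 'm clif"
  assumes "A \<noteq> {}"
  shows "H2 (slab A) F \<longleftrightarrow> left_monogenic (slab A) F \<and> (\<exists>C. \<forall>t\<in>A. L2 (\<lambda>y. F (t, y)) \<and> l2 (\<lambda>y. F (t, y)) \<le> C)"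
proof (cases "left_monogenic (slab A) F")
  case True
  let ?N = "\<lambda>t. \<integral>\<^sup>+ y. ennreal ((norm (F (t, y)))\<^sup>2) \<partial>lborel"
  have "(SUP t\<in>A. ?N t) < \<infinity> \<longleftrightarrow> (\<exists>C. \<forall>t\<in>A. L2 (\<lambda>y. F (t, y)) \<and> l2 (\<lambda>y. F (t, y)) \<le> C)"
  proof
    assume fin: "(SUP t\<in>A. ?N t) < \<infinity>"
    define C where "C = sqrt (enn2real (SUP t\<in>A. ?N t))"
    have C: "0 \<le> C" "ennreal (C\<^sup>2) = (SUP t\<in>A. ?N t)" using fin by (auto simp: C_def)
    have "L2 (\<lambda>y. F (t, y)) \<and> l2 (\<lambda>y. F (t, y)) \<le> C" if "t \<in> A" for t
      using L2I_nn[OF left_monogenic_slice(2)[OF True that] _ C(1)] SUP_upper[OF that, of ?N] C(2) by auto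
    then show "\<exists>C. \<forall>t\<in>A. L2 (\<lambda>y. F (t, y)) \<and> l2 (\<lambda>y. F (t, y)) \<le> C" by blast
  next
    assume "\<exists>C. \<forall>t\<in>A. L2 (\<lambda>y. F (t, y)) \<and> l2 (\<lambda>y. F (t, y)) \<le> C"
    then obtain C where C: "\<And>t. t \<in> A \<Longrightarrow> L2 (\<lambda>y. F (t, y))" "\<And>t. t \<in> A \<Longrightarrow> l2 (\<lambda>y. F (t, y)) \<le> C" by blast
    have "(SUP t\<in>A. ?N t) \<le> ennreal (C\<^sup>2)"
      using C by (intro SUP_least) (auto simp: nn_integral_L2 intro!: ennreal_leI power_mono)
    then show "(SUP t\<in>A. ?N t) < \<infinity>" by (rule order_le_less_trans) simp
  qed
  then show ?thesis using True by (simp add: H2_def fst_slab)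
qed (simp add: H2_def)

lemma H2_slab_add:
  assumes "A \<noteq> {}" "H2 (slab A) F" "H2 (slab A) G" shows "H2 (slab A) (\<lambda>x. F x + G x)"
proof -
  from assms obtain C where C: "\<And>t. t \<in> A \<Longrightarrow> L2 (\<lambda>y. F (t, y))" "\<And>t. t \<in> A \<Longrightarrow> l2 (\<lambda>y. F (t, y)) \<le> C"
    by (auto simp: H2_slab_iff)
  from assms obtain C' where C': "\<And>t. t \<in> A \<Longrightarrow> L2 (\<lambda>y. G (t, y))" "\<And>t. t \<in> A \<Longrightarrow> l2 (\<lambda>y. G (t, y)) \<le> C'"
    by (auto simp: H2_slab_iff)
  have "l2 (\<lambda>y. F (t, y) + G (t, y)) \<le> C + C'" if "t \<in> A" for t
    using l2_triangle[OF C(1)[OF that] C'(1)[OF that]] C(2)[OF that] C'(2)[OF that] by linarith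
  then show ?thesis using assms C(1) C'(1) unfolding H2_slab_iff[OF assms(1)]
    by (auto intro!: left_monogenic_add L2_add exI[of _ "C + C'"])
qed

lemma H2_slab_uminus:
  assumes "H2 (slab A) F" shows "H2 (slab A) (\<lambda>x. - F x)"
  using assms left_monogenic_scaleR[of "slab A" F "-1"] unfolding H2_def by simp

lemma H2_slab_diff:
  assumes "A \<noteq> {}" "H2 (slab A) F" "H2 (slab A) G" shows "H2 (slab A) (\<lambda>x. F x - G x)"
  using H2_slab_add[OF assms(1,2) H2_slab_uminus[OF assms(3)]] by simp

lemma H2_slab_subset:
  assumes "H2 (slab A) F" "open B" "B \<subseteq> A" shows "H2 (slab B) F"
proof -
  have "(SUP t\<in>B. \<integral>\<^sup>+ y. ennreal ((norm (F (t, y)))\<^sup>2) \<partial>lborel) \<le> (SUP t\<in>A. \<integral>\<^sup>+ y. ennreal ((norm (F (t, y)))\<^sup>2) \<partial>lborel)"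
    using assms(3) by (rule SUP_subset_mono) simp
  then show ?thesis using assms left_monogenic_subset[of "slab A" F "slab B"] open_slab[of B]
    unfolding H2_def fst_slab by (auto simp: slab_def)
qed

section \<open>Exponential weights\<close>

lemma L2_exp_neg_norm:
  assumes "c > 0" shows "L2 (\<lambda>x::'a::euclidean_space. exp (- c * norm x))"
  unfolding L2_def
proof
  have "(norm (exp (- c * norm x)))\<^sup>2 = exp (- (2 * c) * norm x)" for x :: 'a
    by (simp add: power2_eq_square mult_exp_exp)
  then show "integrable lborel (\<lambda>x::'a. (norm (exp (- c * norm x)))\<^sup>2)"
    using integrable_exp_neg_norm[of "2 * c", where 'a='a] assms by simp
qed simp

text \<open>Part of the weight is given up: exp(- (a - b) |xi|) is in L2, and Cauchy-Schwarz leads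
  from L2 to L1.\<close>

lemma weighted_integrable:
  fixes w :: "'a::euclidean_space \<Rightarrow> 'b::euclidean_space"
  assumes "L2 (\<lambda>\<xi>. exp (a * norm \<xi>) *\<^sub>R w \<xi>)" "b < a"
  shows "integrable lborel (\<lambda>\<xi>. exp (b * norm \<xi>) *\<^sub>R w \<xi>)"
proof -
  have "integrable lborel (\<lambda>\<xi>. exp (- (a - b) * norm \<xi>) *\<^sub>R (exp (a * norm \<xi>) *\<^sub>R w \<xi>))"
    using assms by (intro L2_bilinear(1)[OF bounded_bilinear_scaleR _ L2_exp_neg_norm]) auto
  then show ?thesis by (simp add: mult_exp_exp left_diff_distrib)
qed

lemma weighted_measurable:
  fixes w :: "'a::euclidean_space \<Rightarrow> 'b::euclidean_space"
  assumes "L2 (\<lambda>\<xi>. exp (a * norm \<xi>) *\<^sub>R w \<xi>)" shows "w \<in> borel_measurable borel"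
proof -
  note [measurable] = L2_measurable[OF assms]
  have "(\<lambda>\<xi>. exp (- a * norm \<xi>) *\<^sub>R (exp (a * norm \<xi>) *\<^sub>R w \<xi>)) \<in> borel_measurable borel" by measurable
  then show ?thesis by (simp add: mult_exp_exp)
qed

lemma weighted_mono:
  fixes w :: "'a::euclidean_space \<Rightarrow> 'b::euclidean_space"
  assumes "L2 (\<lambda>\<xi>. exp (a * norm \<xi>) *\<^sub>R w \<xi>)" "b \<le> a" "v \<in> borel_measurable borel" "\<And>\<xi>. norm (v \<xi>) \<le> c * norm (w \<xi>)" "0 \<le> c"
  shows "L2 (\<lambda>\<xi>. exp (b * norm \<xi>) *\<^sub>R v \<xi>)" "l2 (\<lambda>\<xi>. exp (b * norm \<xi>) *\<^sub>R v \<xi>) \<le> c * l2 (\<lambda>\<xi>. exp (a * norm \<xi>) *\<^sub>R w \<xi>)"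
proof -
  note [measurable] = assms(3)
  have "norm (exp (b * norm \<xi>) *\<^sub>R v \<xi>) \<le> c * norm (exp (a * norm \<xi>) *\<^sub>R w \<xi>)" for \<xi>
  proof -
    have "exp (b * norm \<xi>) * norm (v \<xi>) \<le> exp (a * norm \<xi>) * (c * norm (w \<xi>))"
      using assms(2,4) by (intro mult_mono) (auto intro: mult_right_mono)
    then show ?thesis by (simp add: mult_ac)
  qed
  then have "AE \<xi> in lborel. norm (exp (b * norm \<xi>) *\<^sub>R v \<xi>) \<le> c * norm (exp (a * norm \<xi>) *\<^sub>R w \<xi>)" by simp
  from L2_bound[OF assms(1) _ this assms(5)]
  show "L2 (\<lambda>\<xi>. exp (b * norm \<xi>) *\<^sub>R v \<xi>)" "l2 (\<lambda>\<xi>. exp (b * norm \<xi>) *\<^sub>R v \<xi>) \<le> c * l2 (\<lambda>\<xi>. exp (a * norm \<xi>) *\<^sub>R w \<xi>)"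
    by simp_all
qed

text \<open>A factor |xi|, the price of one derivative, is absorbed by an arbitrarily small part of
  the weight, since |xi| <= exp((a - b) |xi|) / (a - b).\<close>

lemma weighted_norm:
  fixes w :: "'a::euclidean_space \<Rightarrow> 'b::euclidean_space"
  assumes "L2 (\<lambda>\<xi>. exp (a * norm \<xi>) *\<^sub>R w \<xi>)" "b < a" "v \<in> borel_measurable borel" "\<And>\<xi>. norm (v \<xi>) \<le> norm \<xi> * norm (w \<xi>)"
  shows "L2 (\<lambda>\<xi>. exp (b * norm \<xi>) *\<^sub>R v \<xi>)"
proof -
  note [measurable] = assms(3)
  have "norm (exp (b * norm \<xi>) *\<^sub>R v \<xi>) \<le> (1 / (a - b)) * norm (exp (a * norm \<xi>) *\<^sub>R w \<xi>)" for \<xi>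
  proof -
    have "(a - b) * norm \<xi> \<le> exp ((a - b) * norm \<xi>)"
      using exp_ge_add_one_self[of "(a - b) * norm \<xi>"] by linarith
    then have "norm \<xi> \<le> exp ((a - b) * norm \<xi>) / (a - b)" using assms(2) by (simp add: field_simps)
    then have "exp (b * norm \<xi>) * norm (v \<xi>) \<le> exp (b * norm \<xi>) * (exp ((a - b) * norm \<xi>) / (a - b) * norm (w \<xi>))"
      using assms(4)[of \<xi>] by (intro mult_left_mono order_trans[OF assms(4)] mult_right_mono) auto
    also have "\<dots> = (exp (b * norm \<xi>) * exp ((a - b) * norm \<xi>)) / (a - b) * norm (w \<xi>)" by simp
    also have "exp (b * norm \<xi>) * exp ((a - b) * norm \<xi>) = exp (a * norm \<xi>)"
      unfolding mult_exp_exp by (simp add: algebra_simps)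
    finally show ?thesis by simp
  qed
  then show ?thesis
    by (intro L2_bound(1)[OF assms(1), where c="1 / (a - b)"]) (use assms(2) in auto)
qed

section \<open>Extensions to half spaces\<close>

text \<open>For sigma = 1 and sigma = -1 the function exp(phase sigma xi x) is the scalar factor of the
  kernels e^+ and e^- respectively.\<close>
definition phase :: "real \<Rightarrow> (real, 'm::finite) vec \<Rightarrow> real \<times> ((real, 'm) vec) \<Rightarrow> complex" where
  "phase \<sigma> \<xi> x = complex_of_real (- \<sigma> * fst x * norm \<xi>) + \<i> * complex_of_real (snd x \<bullet> \<xi>)"

text \<open>Extension by one of the kernels. The sign lets the condition - a < sigma x0 describe
  both half spaces, so they are treated at once.\<close>

definition hext :: "real \<Rightarrow> ((real, 'm::finite) vec \<Rightarrow> 'm clif) \<Rightarrow> real \<times> ((real, 'm) vec) \<Rightarrow> 'm clif" where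
  "hext \<sigma> w x = (1 / (2 * pi) ^ CARD('m)) *\<^sub>R (\<integral>\<xi>. cscale (exp (phase \<sigma> \<xi> x)) (w \<xi>) \<partial>lborel)"

lemma linear_phase: "linear (phase \<sigma> \<xi>)"
  by (rule linearI) (simp_all add: phase_def algebra_simps scaleR_conv_of_real[of _ "_::complex"])

lemma bounded_linear_phase: "bounded_linear (phase \<sigma> \<xi>)"
  by (simp add: linear_phase linear_conv_bounded_linear[symmetric])

lemma exp_phase: "cscale (exp (phase \<sigma> \<xi> x)) w = cscale (cis (snd x \<bullet> \<xi>)) (exp (- \<sigma> * fst x * norm \<xi>) *\<^sub>R w)"
  by (simp add: phase_def exp_add cis_conv_exp exp_of_real[symmetric] cscale_of_real[symmetric] mult.commute del: of_real_mult of_real_minus)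

lemma norm_exp_phase: "norm (exp (phase \<sigma> \<xi> x)) = exp (- \<sigma> * fst x * norm \<xi>)"
  by (simp add: phase_def norm_exp_eq_Re)

lemma norm_phase_le:
  assumes "\<bar>\<sigma>\<bar> = 1" shows "norm (phase \<sigma> \<xi> v) \<le> 2 * norm \<xi> * norm v"
proof -
  have "norm (phase \<sigma> \<xi> v) \<le> \<bar>- \<sigma> * fst v * norm \<xi>\<bar> + \<bar>snd v \<bullet> \<xi>\<bar>"
    unfolding phase_def using norm_triangle_ineq[of "complex_of_real (- \<sigma> * fst v * norm \<xi>)" "\<i> * complex_of_real (snd v \<bullet> \<xi>)"]
    by (simp only: norm_of_real norm_mult norm_ii mult_1)
  also have "\<dots> \<le> norm (fst v) * norm \<xi> + norm (snd v) * norm \<xi>"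
    using assms Cauchy_Schwarz_ineq2[of "snd v" \<xi>] by (simp add: abs_mult)
  also have "\<dots> \<le> norm v * norm \<xi> + norm v * norm \<xi>"
    using norm_fst_le[of "fst v" "snd v"] norm_snd_le[of "snd v" "fst v"] by (intro add_mono mult_right_mono) auto
  finally show ?thesis by (simp add: mult_ac)
qed

lemma phase_measurable [measurable]: "(\<lambda>\<xi>. phase \<sigma> \<xi> x) \<in> borel_measurable borel"
  unfolding phase_def by measurable

lemma exp_complex_measurable [measurable (raw)]:
  "f \<in> borel_measurable M \<Longrightarrow> (\<lambda>x. exp (f x :: complex)) \<in> borel_measurable M"
  by (rule borel_measurable_continuous_on[where f=exp]) (auto intro!: continuous_intros)

lemma hext_integrable:
  fixes w :: "(real, 'm::finite) vec \<Rightarrow> 'm clif"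
  assumes w: "L2 (\<lambda>\<xi>. exp (a * norm \<xi>) *\<^sub>R w \<xi>)" and x: "- a < \<sigma> * fst x"
  shows "integrable lborel (\<lambda>\<xi>. cscale (exp (phase \<sigma> \<xi> x)) (w \<xi>))"
proof -
  have "integrable lborel (\<lambda>\<xi>. exp (- \<sigma> * fst x * norm \<xi>) *\<^sub>R w \<xi>)"
    using x by (intro weighted_integrable[OF w]) simp
  then show ?thesis unfolding exp_phase by (rule integrable_cscale_cis) auto
qed

lemma hext_has_derivative:
  fixes w :: "(real, 'm::finite) vec \<Rightarrow> 'm clif"
  assumes w: "L2 (\<lambda>\<xi>. exp (a * norm \<xi>) *\<^sub>R w \<xi>)" and \<sigma>: "\<bar>\<sigma>\<bar> = 1" and x: "- a < \<sigma> * fst x"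
  shows "(hext \<sigma> w has_derivative (\<lambda>v. hext \<sigma> (\<lambda>\<xi>. cscale (phase \<sigma> \<xi> v) (w \<xi>)) x)) (at x)"
proof -
  note [measurable] = weighted_measurable[OF w]
  \<comment> \<open>Half the distance from x to the boundary of the half space. On the ball of this
    radius the exponent stays below b, which is still less than a.\<close>
  define r where "r = (a + \<sigma> * fst x) / 2"
  define b where "b = - \<sigma> * fst x + r"
  have r: "r > 0" and ba: "b < a" using x by (auto simp: r_def b_def field_simps)
  have near: "- \<sigma> * fst y \<le> b" if "y \<in> ball x r" for y
  proof -
    have "norm (fst x - fst y) \<le> norm (x - y)" using norm_fst_le[of "fst (x - y)" "snd (x - y)"] unfolding prod.collapse by simp
    then have "\<bar>fst x - fst y\<bar> < r" using that by (simp add: dist_norm)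
    moreover have "\<sigma> * (fst x - fst y) \<le> \<bar>fst x - fst y\<bar>"
      using abs_ge_self[of "\<sigma> * (fst x - fst y)"] \<sigma> by (simp add: abs_mult)
    ultimately show ?thesis by (simp add: b_def algebra_simps)
  qed
  have near': "- a < \<sigma> * fst y" if "y \<in> ball x r" for y using near[OF that] ba by simp
  \<comment> \<open>The weight is spent twice: from a to b' to absorb |xi|, and from b' to b to gain
    integrability.\<close>
  obtain b' where b': "b < b'" "b' < a" using dense[OF ba] by blast
  have L': "L2 (\<lambda>\<xi>. exp (b' * norm \<xi>) *\<^sub>R (norm \<xi> *\<^sub>R w \<xi>))"
    by (rule weighted_norm[OF w b'(2)]) auto
  have iB: "integrable lborel (\<lambda>\<xi>. 2 * norm (exp (b * norm \<xi>) *\<^sub>R (norm \<xi> *\<^sub>R w \<xi>)))"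
    using weighted_integrable[OF L' b'(1)] by (intro integrable_mult_right integrable_norm)
  have "((\<lambda>y. \<integral>\<xi>. cscale (exp (phase \<sigma> \<xi> y)) (w \<xi>) \<partial>lborel) has_derivative
      (\<lambda>v. \<integral>\<xi>. cscale (exp (phase \<sigma> \<xi> x) * phase \<sigma> \<xi> v) (w \<xi>) \<partial>lborel)) (at x)"
  proof (rule has_derivative_integral[OF r _ _ _ iB])
    show "integrable lborel (\<lambda>\<xi>. cscale (exp (phase \<sigma> \<xi> y)) (w \<xi>))" if "y \<in> ball x r" for y
      by (rule hext_integrable[OF w near'[OF that]])
    show "((\<lambda>y. cscale (exp (phase \<sigma> \<xi> y)) (w \<xi>)) has_derivative (\<lambda>v. cscale (exp (phase \<sigma> \<xi> y) * phase \<sigma> \<xi> v) (w \<xi>))) (at y)" for y \<xi>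
    proof -
      have "((\<lambda>y. exp (phase \<sigma> \<xi> y)) has_derivative (\<lambda>v. exp (phase \<sigma> \<xi> y) * phase \<sigma> \<xi> v)) (at y)"
        by (rule has_derivative_compose[OF bounded_linear_imp_has_derivative[OF bounded_linear_phase] DERIV_exp[unfolded has_field_derivative_def]])
      from bounded_linear.has_derivative[OF bounded_bilinear.bounded_linear_left[OF bounded_bilinear_cscale] this]
      show ?thesis .
    qed
    have pw: "norm (cscale (exp (phase \<sigma> \<xi> y) * phase \<sigma> \<xi> v) (w \<xi>)) \<le> 2 * norm (exp (b * norm \<xi>) *\<^sub>R (norm \<xi> *\<^sub>R w \<xi>)) * norm v" if "y \<in> ball x r" for y \<xi> v
    proof -
      have "norm (exp (phase \<sigma> \<xi> y)) \<le> exp (b * norm \<xi>)"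
        unfolding norm_exp_phase exp_le_cancel_iff by (rule mult_right_mono[OF near[OF that]]) simp
      then have "norm (exp (phase \<sigma> \<xi> y)) * norm (phase \<sigma> \<xi> v) * norm (w \<xi>) \<le> exp (b * norm \<xi>) * (2 * norm \<xi> * norm v) * norm (w \<xi>)"
        by (intro mult_right_mono mult_mono norm_phase_le \<sigma>) auto
      then show ?thesis by (simp add: norm_mult mult_ac)
    qed
    show "onorm (\<lambda>v. cscale (exp (phase \<sigma> \<xi> y) * phase \<sigma> \<xi> v) (w \<xi>)) \<le> 2 * norm (exp (b * norm \<xi>) *\<^sub>R (norm \<xi> *\<^sub>R w \<xi>))" if "y \<in> ball x r" for y \<xi>
      by (rule onorm_bound) (use pw[OF that] in auto)
    show "integrable lborel (\<lambda>\<xi>. cscale (exp (phase \<sigma> \<xi> x) * phase \<sigma> \<xi> v) (w \<xi>))" for v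
    proof (rule Bochner_Integration.integrable_bound[OF integrable_mult_left[OF iB, of "norm v"]])
      show "AE \<xi> in lborel. norm (cscale (exp (phase \<sigma> \<xi> x) * phase \<sigma> \<xi> v) (w \<xi>)) \<le> norm (2 * norm (exp (b * norm \<xi>) *\<^sub>R (norm \<xi> *\<^sub>R w \<xi>)) * norm v)"
        using r by (intro AE_I2 order_trans[OF pw]) auto
    qed simp
  qed
  then show ?thesis
    unfolding hext_def[abs_def] by (intro has_derivative_scaleR_right) simp
qed

lemma phase_time: "phase \<sigma> \<xi> (1, 0) = complex_of_real (- \<sigma> * norm \<xi>)"
  and phase_axis: "phase \<sigma> \<xi> (0, axis k 1) = \<i> * complex_of_real (\<xi> $ k)"
  by (simp_all add: phase_def inner_axis')

text \<open>Meant for the data v of partial derivatives. They lose a factor |xi| but keep every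
  weight below a, so their extension is differentiable and in particular continuous.\<close>

lemma hext_continuous_on:
  fixes w :: "(real, 'm::finite) vec \<Rightarrow> 'm clif"
  assumes w: "L2 (\<lambda>\<xi>. exp (a * norm \<xi>) *\<^sub>R w \<xi>)" and \<sigma>: "\<bar>\<sigma>\<bar> = 1"
    and v: "v \<in> borel_measurable borel" "\<And>\<xi>. norm (v \<xi>) \<le> norm \<xi> * norm (w \<xi>)"
  shows "continuous_on {x. - a < \<sigma> * fst x} (hext \<sigma> v)"
proof (rule continuous_at_imp_continuous_on, rule ballI)
  fix x :: "real \<times> (real, 'm) vec" assume "x \<in> {x. - a < \<sigma> * fst x}"
  then obtain b where b: "- \<sigma> * fst x < b" "b < a" using dense[of "- \<sigma> * fst x" a] by auto
  from hext_has_derivative[OF weighted_norm[OF w b(2) v] \<sigma>, of x] b(1)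
  show "isCont (hext \<sigma> v) x" by (auto intro: has_derivative_continuous)
qed

text \<open>The Dirac operator acts on the integrand as - sigma |xi| + \<open>Jop \<xi>\<close>,
  which the eigenvector condition on w makes zero.\<close>

lemma hext_monogenic:
  fixes w :: "(real, 'm::{finite,linorder}) vec \<Rightarrow> 'm clif"
  assumes w: "L2 (\<lambda>\<xi>. exp (a * norm \<xi>) *\<^sub>R w \<xi>)" and \<sigma>: "\<bar>\<sigma>\<bar> = 1"
    and J: "\<And>\<xi>. Jop \<xi> (w \<xi>) = (\<sigma> * norm \<xi>) *\<^sub>R w \<xi>"
  shows "left_monogenic {x. - a < \<sigma> * fst x} (hext \<sigma> w)"
  unfolding left_monogenic_iff
proof (intro conjI exI[of _ "\<lambda>x v. hext \<sigma> (\<lambda>\<xi>. cscale (phase \<sigma> \<xi> v) (w \<xi>)) x"] ballI allI)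
  note [measurable] = weighted_measurable[OF w] vec_nth_measurable
  show "open {x :: real \<times> (real, 'm) vec. - a < \<sigma> * fst x}"
    by (intro open_Collect_less continuous_intros)
  show "(hext \<sigma> w has_derivative (\<lambda>v. hext \<sigma> (\<lambda>\<xi>. cscale (phase \<sigma> \<xi> v) (w \<xi>)) x)) (at x)" if "x \<in> {x. - a < \<sigma> * fst x}" for x
    using that by (intro hext_has_derivative[OF w \<sigma>]) auto
  have n1: "norm (cscale (phase \<sigma> \<xi> (1, 0)) (w \<xi>)) \<le> norm \<xi> * norm (w \<xi>)" for \<xi>
    using \<sigma> by (simp add: phase_time abs_mult norm_mult)
  have n2: "norm (cscale (phase \<sigma> \<xi> (0, axis k 1)) (w \<xi>)) \<le> norm \<xi> * norm (w \<xi>)" for \<xi> k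
    by (simp add: phase_axis norm_mult component_le_norm_cart mult_right_mono)
  show "continuous_on {x. - a < \<sigma> * fst x} (\<lambda>x. hext \<sigma> (\<lambda>\<xi>. cscale (phase \<sigma> \<xi> (1, 0)) (w \<xi>)) x)"
    by (rule hext_continuous_on[OF w \<sigma> _ n1]) measurable
  show "continuous_on {x. - a < \<sigma> * fst x} (\<lambda>x. hext \<sigma> (\<lambda>\<xi>. cscale (phase \<sigma> \<xi> (0, axis k 1)) (w \<xi>)) x)" for k
    by (rule hext_continuous_on[OF w \<sigma> _ n2]) measurable
  fix x :: "real \<times> (real, 'm) vec" assume x: "x \<in> {x. - a < \<sigma> * fst x}"
  then obtain b where b': "- \<sigma> * fst x < b" and "b < a" using dense[of "- \<sigma> * fst x" a] by auto
  then have b: "- b < \<sigma> * fst x" "b < a" by auto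
  define I where "I v = (\<lambda>\<xi>. cscale (exp (phase \<sigma> \<xi> x)) (cscale (phase \<sigma> \<xi> v) (w \<xi>)))" for v
  have i1: "integrable lborel (I (1, 0))" unfolding I_def
    by (rule hext_integrable[OF weighted_norm[OF w b(2) _ n1] b(1)]) measurable
  have i2: "integrable lborel (I (0, axis k 1))" for k unfolding I_def
    by (rule hext_integrable[OF weighted_norm[OF w b(2) _ n2] b(1)]) measurable
  have pt: "I (1, 0) \<xi> + (\<Sum>k\<in>UNIV. clif_mult (clif_gen k) (I (0, axis k 1) \<xi>)) = 0" for \<xi>
  proof -
    have "I (1, 0) \<xi> + (\<Sum>k\<in>UNIV. clif_mult (clif_gen k) (I (0, axis k 1) \<xi>))
       = cscale (exp (phase \<sigma> \<xi> x)) ((- \<sigma> * norm \<xi>) *\<^sub>R w \<xi> + Jop \<xi> (w \<xi>))"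
      unfolding I_def phase_time phase_axis Jop_sum clif_mult_cscale_right cscale_of_real
      by (simp only: cscale_add_right cscale_sum_right)
    then show ?thesis by (simp add: J vec_eq_iff)
  qed
  have "(\<integral>\<xi>. I (1, 0) \<xi> \<partial>lborel) + (\<Sum>k\<in>UNIV. clif_mult (clif_gen k) (\<integral>\<xi>. I (0, axis k 1) \<xi> \<partial>lborel))
      = (\<integral>\<xi>. I (1, 0) \<xi> + (\<Sum>k\<in>UNIV. clif_mult (clif_gen k) (I (0, axis k 1) \<xi>)) \<partial>lborel)"
  proof -
    have i3: "integrable lborel (\<lambda>\<xi>. clif_mult (clif_gen k) (I (0, axis k 1) \<xi>))" for k
      by (rule integrable_bounded_linear[OF bounded_linear_clif_mult i2])
    show ?thesis
      by (simp add: Bochner_Integration.integral_add[OF i1 Bochner_Integration.integrable_sum[OF i3]]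
          Bochner_Integration.integral_sum[OF i3] integral_bounded_linear[OF bounded_linear_clif_mult i2])
  qed
  then have "(\<integral>\<xi>. I (1, 0) \<xi> \<partial>lborel) + (\<Sum>k\<in>UNIV. clif_mult (clif_gen k) (\<integral>\<xi>. I (0, axis k 1) \<xi> \<partial>lborel)) = 0"
    by (simp add: pt)
  then show "hext \<sigma> (\<lambda>\<xi>. cscale (phase \<sigma> \<xi> (1, 0)) (w \<xi>)) x + (\<Sum>k\<in>UNIV. clif_mult (clif_gen k) (hext \<sigma> (\<lambda>\<xi>. cscale (phase \<sigma> \<xi> (0, axis k 1)) (w \<xi>)) x)) = 0"
    unfolding hext_def I_def clif_mult_scaleR_right scaleR_sum_right[symmetric] scaleR_right_distrib[symmetric]
    by (simp del: cscale_cscale)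
qed

lemma hext_slice: "hext \<sigma> w (t, y) = (1 / (2 * pi) ^ CARD('m)) *\<^sub>R cft 1 (\<lambda>\<xi>. exp (- \<sigma> * t * norm \<xi>) *\<^sub>R w \<xi>) y"
  for w :: "(real, 'm::finite) vec \<Rightarrow> 'm clif"
  unfolding hext_def exp_phase cft_def by (simp add: inner_commute)

text \<open>The slice at height t is the inverse transform of exp(- sigma t |xi|) w, whose L2 norm
  is bounded uniformly because - sigma t <= a.\<close>

lemma hext_H2:
  fixes w :: "(real, 'm::{finite,linorder}) vec \<Rightarrow> 'm clif"
  assumes w: "L2 (\<lambda>\<xi>. exp (a * norm \<xi>) *\<^sub>R w \<xi>)" and \<sigma>: "\<bar>\<sigma>\<bar> = 1"
    and J: "\<And>\<xi>. Jop \<xi> (w \<xi>) = (\<sigma> * norm \<xi>) *\<^sub>R w \<xi>"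
  shows "H2 (slab {t. - a < \<sigma> * t}) (hext \<sigma> w)"
proof -
  note [measurable] = weighted_measurable[OF w]
  define c where "c = 1 / (2 * pi) ^ CARD('m)"
  define K where "K = sqrt ((2 * pi) ^ CARD('m))"
  have ne: "{t. - a < \<sigma> * t} \<noteq> {}"
  proof -
    \<comment> \<open>Since sigma squared is 1, the height sigma (1 - a) witnesses that the domain
      is not empty.\<close>
    have "\<sigma> * (\<sigma> * (1 - a)) = 1 - a" using \<sigma> by (metis abs_mult_self_eq mult.assoc mult_1)
    then have "\<sigma> * (1 - a) \<in> {t. - a < \<sigma> * t}" unfolding mem_Collect_eq by linarith
    then show ?thesis by blast
  qed
  have sl: "slab {t. - a < \<sigma> * t} = {x :: real \<times> (real, 'm) vec. - a < \<sigma> * fst x}" by (simp add: slab_def)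
  have "L2 (\<lambda>y. hext \<sigma> w (t, y)) \<and> l2 (\<lambda>y. hext \<sigma> w (t, y)) \<le> c * (K * l2 (\<lambda>\<xi>. exp (a * norm \<xi>) *\<^sub>R w \<xi>))" if t: "- a < \<sigma> * t" for t
  proof -
    let ?v = "\<lambda>\<xi>. exp (- \<sigma> * t * norm \<xi>) *\<^sub>R w \<xi>"
    have ta: "- \<sigma> * t \<le> a" using t by simp
    have v1: "L2 ?v" by (rule weighted_mono(1)[OF w ta, where c=1]) auto
    have v2: "l2 ?v \<le> 1 * l2 (\<lambda>\<xi>. exp (a * norm \<xi>) *\<^sub>R w \<xi>)"
      by (rule weighted_mono(2)[OF w ta, where c=1]) auto
    note v = v1 v2
    have vi: "integrable lborel ?v" by (rule weighted_integrable[OF w]) (use t in simp)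
    note P = cft_plancherel_le[of 1, OF _ vi v(1)]
    have le: "AE y in lborel. norm (hext \<sigma> w (t, y)) \<le> c * norm (cft 1 ?v y)"
      by (simp add: hext_slice c_def)
    have m: "(\<lambda>y. hext \<sigma> w (t, y)) \<in> borel_measurable borel" unfolding hext_slice by measurable
    have c0: "0 \<le> c" by (simp add: c_def)
    have P1: "L2 (cft 1 ?v)" by (rule P(1)) simp
    have P2: "l2 (cft 1 ?v) \<le> K * l2 ?v" unfolding K_def by (rule P(2)) simp
    note L2_bound[OF P1 m le c0]
    moreover have "c * l2 (cft 1 ?v) \<le> c * (K * l2 (\<lambda>\<xi>. exp (a * norm \<xi>) *\<^sub>R w \<xi>))"
      using v(2) by (intro mult_left_mono c0 order_trans[OF P2]) (auto simp: K_def)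
    ultimately show ?thesis by auto
  qed
  then show ?thesis unfolding H2_slab_iff[OF ne]
    using hext_monogenic[OF w \<sigma> J] unfolding sl by blast
qed

definition fplus :: "((real, 'm::{finite,linorder}) vec \<Rightarrow> 'm clif) \<Rightarrow> real \<times> ((real, 'm) vec) \<Rightarrow> 'm clif" where
  "fplus g = hext 1 (\<lambda>\<xi>. Pp \<xi> (g \<xi>))"

definition fminus :: "((real, 'm::{finite,linorder}) vec \<Rightarrow> 'm clif) \<Rightarrow> real \<times> ((real, 'm) vec) \<Rightarrow> 'm clif" where
  "fminus g = hext (-1) (\<lambda>\<xi>. Pm \<xi> (g \<xi>))"

lemma weighted_projections:
  assumes "L2 (\<lambda>\<xi>. exp (a * norm \<xi>) *\<^sub>R g \<xi>)"
  shows "L2 (\<lambda>\<xi>. exp (a * norm \<xi>) *\<^sub>R Pp \<xi> (g \<xi>))" "L2 (\<lambda>\<xi>. exp (a * norm \<xi>) *\<^sub>R Pm \<xi> (g \<xi>))"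
proof -
  note [measurable] = weighted_measurable[OF assms]
  show "L2 (\<lambda>\<xi>. exp (a * norm \<xi>) *\<^sub>R Pp \<xi> (g \<xi>))"
    by (rule weighted_mono(1)[OF assms order_refl, where c=1]) (auto simp: norm_Pp_le)
  show "L2 (\<lambda>\<xi>. exp (a * norm \<xi>) *\<^sub>R Pm \<xi> (g \<xi>))"
    by (rule weighted_mono(1)[OF assms order_refl, where c=1]) (auto simp: norm_Pm_le)
qed

text \<open>\<open>Jop_Pp\<close> is the eigenvector condition of \<open>hext_H2\<close> for sigma =
  1; for \<open>fminus\<close> it is \<open>Jop_Pm\<close> with sigma = -1.\<close>

lemma fplus_H2:
  assumes "L2 (\<lambda>\<xi>. exp (a * norm \<xi>) *\<^sub>R g \<xi>)" shows "H2 (halfplus a) (fplus g)"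
proof -
  have "{t::real. - a < 1 * t} = {-a<..}" by auto
  then show ?thesis using hext_H2[OF weighted_projections(1)[OF assms], of 1]
    unfolding halfplus_slab fplus_def by (simp add: Jop_Pp)
qed

lemma fminus_H2:
  assumes "L2 (\<lambda>\<xi>. exp (a * norm \<xi>) *\<^sub>R g \<xi>)" shows "H2 (halfminus a) (fminus g)"
proof -
  have "{t::real. - a < - 1 * t} = {..<a}" by auto
  then show ?thesis using hext_H2[OF weighted_projections(2)[OF assms], of "-1"]
    unfolding halfminus_slab fminus_def by (simp add: Jop_Pm)
qed

lemma cauchy_ext_split:
  assumes g: "L2 (\<lambda>\<xi>. exp (a * norm \<xi>) *\<^sub>R g \<xi>)" and x: "x \<in> strip a"
  shows "cauchy_ext g x = fplus g x + fminus g x"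
proof -
  have "\<bar>fst x\<bar> < a" using x by (simp add: strip_def)
  then have i: "integrable lborel (\<lambda>\<xi>. cscale (exp (phase 1 \<xi> x)) (Pp \<xi> (g \<xi>)))"
    "integrable lborel (\<lambda>\<xi>. cscale (exp (phase (-1) \<xi> x)) (Pm \<xi> (g \<xi>)))"
    using weighted_projections[OF g] by (auto intro!: hext_integrable)
  have "clif_mult (ekern x \<xi>) (g \<xi>) = cscale (exp (phase 1 \<xi> x)) (Pp \<xi> (g \<xi>)) + cscale (exp (phase (-1) \<xi> x)) (Pm \<xi> (g \<xi>))" for \<xi>
    unfolding clif_mult_ekern Eop_def exp_phase by (simp add: cscale_add_right)
  then show ?thesis unfolding cauchy_ext_def fplus_def fminus_def hext_def
    by (simp add: Bochner_Integration.integral_add[OF i] scaleR_right_distrib)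
qed

lemma cauchy_ext_H2:
  assumes a: "a > 0" and g: "L2 (\<lambda>\<xi>. exp (a * norm \<xi>) *\<^sub>R g \<xi>)"
  shows "H2 (strip a) (cauchy_ext g)"
proof -
  have ne: "{-a<..<a} \<noteq> {}" using a by simp
  have H: "H2 (slab {-a<..<a}) (\<lambda>x. fplus g x + fminus g x)"
    using fplus_H2[OF g] fminus_H2[OF g] unfolding halfplus_slab halfminus_slab
    by (intro H2_slab_add[OF ne]) (auto elim!: H2_slab_subset)
  have eq: "cauchy_ext g x = fplus g x + fminus g x" if "x \<in> slab {-a<..<a}" for x
    using cauchy_ext_split[OF g] that by (simp add: strip_slab)
  have "(\<lambda>y. cauchy_ext g (t, y)) = (\<lambda>y. fplus g (t, y) + fminus g (t, y))" if "t \<in> {-a<..<a}" for t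
    using that by (intro ext eq) (simp add: slab_def)
  then show ?thesis using H left_monogenic_cong[of "slab {-a<..<a}" "\<lambda>x. fplus g x + fminus g x" "cauchy_ext g"] eq
    unfolding strip_slab H2_slab_iff[OF ne] by auto
qed

lemma cauchy_ext_slice:
  "cauchy_ext g (t, y) = (1 / (2 * pi) ^ CARD('m)) *\<^sub>R cft 1 (\<lambda>\<xi>. Eop t \<xi> (g \<xi>)) y"
  for g :: "(real, 'm::{finite,linorder}) vec \<Rightarrow> 'm clif"
  unfolding cauchy_ext_def clif_mult_ekern cft_def by (simp add: inner_commute)

section \<open>Evolution of the transform across the slices\<close>

lemma max0_square_derivative: "((\<lambda>s::real. (max 0 s)\<^sup>2) has_real_derivative 2 * max 0 s) (at s)"
proof -
  consider "s > 0" | "s < 0" | "s = 0" by linarith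
  then show ?thesis
  proof cases
    case 1
    have "((\<lambda>s::real. s\<^sup>2) has_real_derivative 2 * s) (at s)" by (auto intro!: derivative_eq_intros)
    then show ?thesis using 1
      by (subst DERIV_cong_ev[OF refl _ refl, where g="\<lambda>s. s\<^sup>2"])
         (auto intro!: eventually_mono[OF eventually_nhds_in_open[of "{0<..}" s]])
  next
    case 2
    then show ?thesis
      by (subst DERIV_cong_ev[OF refl _ refl, where g="\<lambda>s. 0"])
         (auto intro!: eventually_mono[OF eventually_nhds_in_open[of "{..<0}" s]])
  next
    case 3
    have "((\<lambda>h. (max 0 h)\<^sup>2 / h) \<longlongrightarrow> 0) (at (0::real))"
    proof (rule Lim_null_comparison)
      show "\<forall>\<^sub>F h in at (0::real). norm ((max 0 h)\<^sup>2 / h) \<le> \<bar>h\<bar>"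
        by (intro always_eventually allI) (auto simp: max_def power2_eq_square)
      show "((\<lambda>h. \<bar>h\<bar>) \<longlongrightarrow> 0) (at (0::real))" by (auto intro!: tendsto_eq_intros)
    qed
    then show ?thesis using 3 by (simp add: DERIV_def)
  qed
qed

text \<open>A compactly supported C1 bump with an explicit derivative: the square removes the kink
  of the positive part on the sphere of radius R.\<close>

definition cutoff :: "real \<Rightarrow> 'a::euclidean_space \<Rightarrow> real" where
  "cutoff R x = (max 0 (1 - (norm x)\<^sup>2 / R\<^sup>2))\<^sup>2"

definition cutoff' :: "real \<Rightarrow> 'a::euclidean_space \<Rightarrow> 'a \<Rightarrow> real" where
  "cutoff' R x v = - 4 * max 0 (1 - (norm x)\<^sup>2 / R\<^sup>2) * (x \<bullet> v) / R\<^sup>2"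

lemma cutoff_has_derivative: "(cutoff R has_derivative cutoff' R x) (at x)"
proof -
  define k where "k = 1 / R\<^sup>2"
  have "((\<lambda>x::'a. 1 - k * (x \<bullet> x)) has_derivative (\<lambda>v. - (k * (2 * (x \<bullet> v))))) (at x)"
    by (auto intro!: derivative_eq_intros simp: inner_commute)
  from has_derivative_compose[OF this max0_square_derivative[unfolded has_field_derivative_def]]
  have "((\<lambda>x. (max 0 (1 - k * (x \<bullet> x)))\<^sup>2) has_derivative (\<lambda>v. 2 * max 0 (1 - k * (x \<bullet> x)) * - (k * (2 * (x \<bullet> v))))) (at x)" .
  moreover have "cutoff R = (\<lambda>x::'a. (max 0 (1 - k * (x \<bullet> x)))\<^sup>2)"
    by (simp add: cutoff_def fun_eq_iff k_def power2_norm_eq_inner)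
  moreover have "cutoff' R x = (\<lambda>v. 2 * max 0 (1 - k * (x \<bullet> x)) * - (k * (2 * (x \<bullet> v))))"
    by (simp add: cutoff'_def fun_eq_iff k_def power2_norm_eq_inner)
  ultimately show ?thesis by simp
qed

lemma cutoff_outside: "R > 0 \<Longrightarrow> norm x \<ge> R \<Longrightarrow> cutoff R x = 0"
  and cutoff'_outside: "R > 0 \<Longrightarrow> norm x \<ge> R \<Longrightarrow> cutoff' R x v = 0"
  by (auto simp: cutoff_def cutoff'_def max_def field_simps not_le dest: power_mono[of R "norm x" 2])

lemma cutoff_nonneg: "0 \<le> cutoff R x" and cutoff_le_1: "cutoff R x \<le> 1"
proof -
  show "0 \<le> cutoff R x" by (simp add: cutoff_def)
  have "(max 0 (1 - (norm x)\<^sup>2 / R\<^sup>2))\<^sup>2 \<le> 1\<^sup>2" by (intro power_mono) auto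
  then show "cutoff R x \<le> 1" by (simp add: cutoff_def)
qed

text \<open>On the support |x . v| <= R, so R^2 in the denominator leaves 1 / R. This is the decay
  that eventually removes the remainder.\<close>

lemma cutoff'_le:
  assumes "R > 0" "norm v \<le> 1" shows "\<bar>cutoff' R x v\<bar> \<le> 4 / R"
proof (cases "norm x \<ge> R")
  case True then show ?thesis using assms by (simp add: cutoff'_outside)
next
  case False
  have "\<bar>x \<bullet> v\<bar> \<le> norm x * norm v" by (rule Cauchy_Schwarz_ineq2)
  also have "\<dots> \<le> R * 1" using False assms by (intro mult_mono) auto
  finally have "\<bar>max 0 (1 - (norm x)\<^sup>2 / R\<^sup>2)\<bar> * \<bar>x \<bullet> v\<bar> \<le> 1 * R" by (intro mult_mono) auto
  then have "4 * (\<bar>max 0 (1 - (norm x)\<^sup>2 / R\<^sup>2)\<bar> * \<bar>x \<bullet> v\<bar>) / R\<^sup>2 \<le> 4 * (1 * R) / R\<^sup>2"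
    by (intro divide_right_mono mult_left_mono) auto
  also have "4 * (1 * R) / R\<^sup>2 = 4 / R" using assms by (simp add: power2_eq_square)
  finally show ?thesis by (simp add: cutoff'_def abs_mult)
qed

lemma cutoff_continuous: "continuous_on UNIV (cutoff R)"
  using cutoff_has_derivative by (intro continuous_at_imp_continuous_on) (auto intro: has_derivative_continuous)

lemma cutoff'_continuous: "continuous_on UNIV (\<lambda>x. cutoff' R x v)"
  unfolding cutoff'_def by (cases "R = 0") (auto intro!: continuous_intros)

lemma cutoff_measurable [measurable]: "cutoff R \<in> borel_measurable borel"
  and cutoff'_measurable [measurable]: "(\<lambda>x. cutoff' R x v) \<in> borel_measurable borel"
  by (intro borel_measurable_continuous_onI cutoff_continuous cutoff'_continuous)+

lemma cutoff_tendsto: "((\<lambda>R. cutoff R x) \<longlongrightarrow> 1) at_top"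
proof -
  have "((\<lambda>R. (norm x)\<^sup>2 / R\<^sup>2) \<longlongrightarrow> 0) at_top"
    by (rule tendsto_divide_0[OF tendsto_const]) (intro filterlim_at_top_imp_at_infinity filterlim_pow_at_top filterlim_ident, simp)
  then have "((\<lambda>R. (max 0 (1 - (norm x)\<^sup>2 / R\<^sup>2))\<^sup>2) \<longlongrightarrow> (max 0 (1 - 0))\<^sup>2) at_top"
    by (intro tendsto_intros)
  then show ?thesis by (simp add: cutoff_def)
qed

lemma integrable_compact_support:
  fixes u :: "'a::euclidean_space \<Rightarrow> 'b::euclidean_space"
  assumes "continuous_on UNIV u" "\<And>x. norm x > R \<Longrightarrow> u x = 0"
  shows "integrable lborel u" "\<exists>C\<ge>0. \<forall>x. norm (u x) \<le> C * indicator (cball 0 R) x"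
proof -
  have "compact (u ` cball 0 R)" using assms(1) by (intro compact_continuous_image) (auto intro: continuous_on_subset)
  then obtain C where C: "\<And>x. x \<in> cball 0 R \<Longrightarrow> norm (u x) \<le> C" using compact_imp_bounded bounded_iff by (metis imageI)
  have le: "norm (u x) \<le> max C 0 * indicator (cball 0 R) x" for x
    using C[of x] assms(2)[of x] by (cases "norm x > R") (auto simp: indicator_def)
  then show "\<exists>C\<ge>0. \<forall>x. norm (u x) \<le> C * indicator (cball 0 R) x" by (intro exI[of _ "max C 0"]) auto
  have [measurable]: "u \<in> borel_measurable borel" using assms(1) by (rule borel_measurable_continuous_onI)
  have ic: "integrable lborel (indicator (cball 0 R) :: 'a \<Rightarrow> real)"
    using emeasure_lborel_cball_finite[of 0 R] by (intro integrable_real_indicator) auto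
  show "integrable lborel u"
    by (rule Bochner_Integration.integrable_bound[OF integrable_mult_right[OF ic, of "max C 0"]])
       (use le in \<open>auto intro!: AE_I2 order_trans[OF le]\<close>)
qed

text \<open>Integration by parts without boundary terms: differentiate the translation invariance
  of the integral.\<close>
lemma integral_derivative_eq_0:
  fixes H :: "'a::euclidean_space \<Rightarrow> 'b::euclidean_space"
  assumes H: "\<And>x. (H has_derivative H' x) (at x)" and c: "continuous_on UNIV (\<lambda>x. H' x e)"
    and s: "\<And>x. norm x > R \<Longrightarrow> H x = 0"
  shows "(\<integral>x. H' x e \<partial>lborel) = 0"
proof -
  have Hc: "continuous_on UNIV H"
    using H by (intro continuous_at_imp_continuous_on) (auto intro: has_derivative_continuous)
  have [measurable]: "H \<in> borel_measurable borel" using Hc by (rule borel_measurable_continuous_onI)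
  have s': "H' x e = 0" if "norm x > R" for x
  proof -
    have "(H has_derivative (\<lambda>_. 0)) (at x)"
      by (rule has_derivative_transform_within_open[of "\<lambda>_. 0" _ _ _ "{x. R < norm x}"])
         (use that s in \<open>auto intro!: open_Collect_less continuous_intros\<close>)
    then show ?thesis using has_derivative_unique[OF H[of x]] by metis
  qed
  obtain C where C: "C \<ge> 0" "\<And>x. norm (H' x e) \<le> C * indicator (cball 0 R) x"
    using integrable_compact_support(2)[OF c s'] by blast
  \<comment> \<open>For |t| < 1 all translates of the support lie in the ball of radius R + |e|,
    which gives a majorant uniform in t.\<close>
  have ic: "integrable lborel (indicator (cball 0 (R + norm e)) :: 'a \<Rightarrow> real)"
    using emeasure_lborel_cball_finite[of 0 "R + norm e"] by (intro integrable_real_indicator) auto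
  have tr: "integrable lborel (\<lambda>x. H (t *\<^sub>R e + x))" "(\<integral>x. H (t *\<^sub>R e + x) \<partial>lborel) = (\<integral>x. H x \<partial>lborel)" for t
    using lborel_affine_euclid[of 1 H "t *\<^sub>R e"] integrable_compact_support(1)[OF Hc s] by auto
  have "((\<lambda>t. \<integral>x. H (t *\<^sub>R e + x) \<partial>lborel) has_vector_derivative (\<integral>x. H' (0 *\<^sub>R e + x) e \<partial>lborel)) (at 0)"
  proof (rule has_vector_derivative_integral[where r=1 and B="\<lambda>x. C * indicator (cball 0 (R + norm e)) x"])
    show "((\<lambda>t. H (t *\<^sub>R e + x)) has_vector_derivative H' (t *\<^sub>R e + x) e) (at t)" for t x
    proof -
      have "((\<lambda>t. t *\<^sub>R e + x) has_derivative (\<lambda>h. h *\<^sub>R e)) (at t)" by (auto intro!: derivative_eq_intros)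
      from has_derivative_compose[OF this H]
      show ?thesis unfolding has_vector_derivative_def
        by (rule has_derivative_eq_rhs) (auto simp: linear_scale[OF has_derivative_linear[OF H]])
    qed
    show "norm (H' (t *\<^sub>R e + x) e) \<le> C * indicator (cball 0 (R + norm e)) x" if "\<bar>t - 0\<bar> < 1" for t x
    proof (cases "norm x \<le> R + norm e")
      case True
      have "norm (H' (t *\<^sub>R e + x) e) \<le> C * 1"
        by (rule order_trans[OF C(2)]) (use C(1) in \<open>auto intro!: mult_left_mono simp: indicator_def\<close>)
      then show ?thesis using True by simp
    next
      case False
      have "norm (t *\<^sub>R e) \<le> norm e" using that by (simp add: mult_left_le_one_le)
      then have "norm (t *\<^sub>R e + x) > R" using False norm_diff_ineq[of x "t *\<^sub>R e"] by (simp add: add.commute)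
      then show ?thesis using C(1) by (simp add: s')
    qed
    show "integrable lborel (\<lambda>x. H' (0 *\<^sub>R e + x) e)" using integrable_compact_support(1)[OF c s'] by simp
  qed (use tr ic in auto)
  moreover have "((\<lambda>t. \<integral>x. H (t *\<^sub>R e + x) \<partial>lborel) has_vector_derivative 0) (at 0)"
    unfolding tr(2) by (rule has_vector_derivative_const)
  ultimately show ?thesis using vector_derivative_unique_at by fastforce
qed

lemma norm_clif_gen: "norm (clif_mult (clif_gen k) w) = norm w"
proof -
  have "(norm (clif_mult (clif_gen k) w))\<^sup>2 = (norm w)\<^sup>2"
    by (simp add: power2_norm_eq_inner clif_gen_skew clif_gen_square)
  then show ?thesis by simp
qed

text \<open>The integrating factor: if u' = r - \<open>Jop\<close> u, then \<open>Eop (- t)\<close>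
  applied to u has derivative \<open>Eop (- t)\<close> applied to r.\<close>

lemma Eop_neg_has_vector_derivative:
  assumes u: "(u has_vector_derivative u') (at t)"
  shows "((\<lambda>t. Eop (- t) \<eta> (u t)) has_vector_derivative Eop (- t) \<eta> (Jop \<eta> (u t) + u')) (at t)"
proof -
  define n where "n = norm \<eta>"
  have Ju: "((\<lambda>t. Jop \<eta> (u t)) has_vector_derivative Jop \<eta> u') (at t)"
    by (rule bounded_linear.has_vector_derivative[OF bounded_linear_Jop u])
  have E: "Eop (- t) \<eta> w = cosh (t * n) *\<^sub>R w + (sinh (t * n) * inverse n) *\<^sub>R Jop \<eta> w" for t w
    by (simp add: Eop_cosh n_def)
  have c: "((\<lambda>t. cosh (t * n)) has_real_derivative sinh (t * n) * n) (at t)"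
    "((\<lambda>t. sinh (t * n) * inverse n) has_real_derivative cosh (t * n) * n * inverse n) (at t)"
    by (auto intro!: derivative_eq_intros)
  have "((\<lambda>t. cosh (t * n) *\<^sub>R u t + (sinh (t * n) * inverse n) *\<^sub>R Jop \<eta> (u t)) has_vector_derivative
     (cosh (t * n) *\<^sub>R u' + (sinh (t * n) * n) *\<^sub>R u t) + ((sinh (t * n) * inverse n) *\<^sub>R Jop \<eta> u' + (cosh (t * n) * n * inverse n) *\<^sub>R Jop \<eta> (u t))) (at t)"
    by (intro has_vector_derivative_add has_vector_derivative_scaleR c u Ju)
  moreover have "(cosh (t * n) *\<^sub>R u' + (sinh (t * n) * n) *\<^sub>R u t) + ((sinh (t * n) * inverse n) *\<^sub>R Jop \<eta> u' + (cosh (t * n) * n * inverse n) *\<^sub>R Jop \<eta> (u t))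
    = Eop (- t) \<eta> (Jop \<eta> (u t) + u')"
  proof (cases "\<eta> = 0")
    case True then show ?thesis by (simp add: Eop_cosh n_def Jop_zero)
  next
    case False
    then have "n \<noteq> 0" by (simp add: n_def)
    then have ni: "n * (inverse n * y) = y" for y by (simp add: field_simps)
    show ?thesis unfolding E Jop_simps Jop_Jop n_def[symmetric]
      by (simp add: algebra_simps power2_eq_square ni)
  qed
  ultimately show ?thesis unfolding E by simp
qed

text \<open>The error caused by the gradient of the cutoff in the evolution equation of the transform.\<close>
definition rem :: "real \<Rightarrow> (real \<times> ((real, 'm::{finite,linorder}) vec) \<Rightarrow> 'm clif) \<Rightarrow> real \<Rightarrow> (real, 'm) vec \<Rightarrow> 'm clif" where
  "rem R F t \<eta> = (\<Sum>k\<in>UNIV. clif_mult (clif_gen k) (cft (-1) (\<lambda>x. cutoff' R x (axis k 1) *\<^sub>R F (t, x)) \<eta>))"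

lemma cis_phase_has_derivative:
  fixes \<eta> :: "'a::euclidean_space"
  shows "((\<lambda>x. cis (- (x \<bullet> \<eta>))) has_derivative (\<lambda>v. cis (- (x \<bullet> \<eta>)) * (- \<i> * complex_of_real (v \<bullet> \<eta>)))) (at x)"
proof -
  have "bounded_linear (\<lambda>x. - \<i> * complex_of_real (x \<bullet> \<eta>))"
    by (intro bounded_linear_mult_const bounded_linear_const_mult bounded_linear_compose[OF bounded_linear_of_real] bounded_linear_inner_left)
  from has_derivative_compose[OF bounded_linear_imp_has_derivative[OF this] DERIV_exp[unfolded has_field_derivative_def]]
  show ?thesis by (simp add: cis_conv_exp)
qed

text \<open>The time derivative passes under the integral, the monogenic equation replaces it by
  space derivatives, and these are integrated by parts. Falling on the phase they produce
  \<open>Jop\<close>, falling on the cutoff they produce \<open>rem\<close>.\<close>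

lemma transform_ode:
  fixes F :: "real \<times> ((real, 'm::{finite,linorder}) vec) \<Rightarrow> 'm clif"
  assumes F: "left_monogenic (slab A) F" and A: "open A" and t: "t \<in> A" and R: "R > 0"
  shows "((\<lambda>s. cft (-1) (\<lambda>x. cutoff R x *\<^sub>R F (s, x)) \<eta>) has_vector_derivative
     (rem R F t \<eta> - Jop \<eta> (cft (-1) (\<lambda>x. cutoff R x *\<^sub>R F (t, x)) \<eta>))) (at t)"
proof -
  obtain D where D: "\<And>x. x \<in> slab A \<Longrightarrow> (F has_derivative D x) (at x)"
    and D0: "continuous_on (slab A) (\<lambda>x. D x (1, 0))" and Dk: "\<And>k. continuous_on (slab A) (\<lambda>x. D x (0, axis k 1))"
    and De: "\<And>x. x \<in> slab A \<Longrightarrow> D x (1, 0) + (\<Sum>k\<in>UNIV. clif_mult (clif_gen k) (D x (0, axis k 1))) = 0"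
    using F unfolding left_monogenic_iff by blast
  \<comment> \<open>Cutoff and phase form one compactly supported C1 factor, so the derivatives of F
    need only be continuous for the integrals to exist.\<close>
  define \<phi> where "\<phi> x = complex_of_real (cutoff R x) * cis (- (x \<bullet> \<eta>))" for x
  define \<phi>' where "\<phi>' x v = complex_of_real (cutoff R x) * (cis (- (x \<bullet> \<eta>)) * (- \<i> * complex_of_real (v \<bullet> \<eta>))) + complex_of_real (cutoff' R x v) * cis (- (x \<bullet> \<eta>))" for x v
  have \<phi>c: "continuous_on UNIV \<phi>" unfolding \<phi>_def by (intro continuous_intros cutoff_continuous)
  have \<phi>'c: "continuous_on UNIV (\<lambda>x. \<phi>' x v)" for v unfolding \<phi>'_def by (intro continuous_intros cutoff_continuous cutoff'_continuous)
  have \<phi>0: "\<phi> x = 0" if "norm x > R" for x using cutoff_outside[OF R, of x] that by (simp add: \<phi>_def)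
  have \<phi>1: "norm (\<phi> x) \<le> 1" for x by (simp add: \<phi>_def norm_mult cutoff_nonneg cutoff_le_1)
  have \<phi>d: "(\<phi> has_derivative \<phi>' x) (at x)" for x
    unfolding \<phi>_def[abs_def] \<phi>'_def[abs_def]
    by (rule has_derivative_mult[OF has_derivative_of_real[OF cutoff_has_derivative] cis_phase_has_derivative])
  have cftE: "cft (-1) (\<lambda>x. cutoff R x *\<^sub>R G x) \<eta> = (\<integral>x. cscale (\<phi> x) (G x) \<partial>lborel)" for G :: "(real, 'm) vec \<Rightarrow> 'm clif"
    unfolding cft_def \<phi>_def by (simp add: mult.commute flip: cscale_of_real)
  have sl: "(s, x) \<in> slab A \<longleftrightarrow> s \<in> A" for s and x :: "(real, 'm) vec" by (simp add: slab_def)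
  have cs: "continuous_on UNIV (\<lambda>x. G (s, x))" if "continuous_on (slab A) G" "s \<in> A" for G :: "real \<times> ((real, 'm) vec) \<Rightarrow> 'm clif" and s
    by (rule continuous_on_compose2[OF that(1)]) (use that(2) in \<open>auto intro!: continuous_intros simp: sl\<close>)
  have cc: "continuous_on UNIV (\<lambda>x. cscale (\<phi> x) (G x))" if "continuous_on UNIV G" for G :: "(real, 'm) vec \<Rightarrow> 'm clif"
    by (rule bounded_bilinear.continuous_on[OF bounded_bilinear_cscale \<phi>c that])
  have ci: "integrable lborel (\<lambda>x. cscale (\<phi> x) (G x))" if "continuous_on UNIV G" for G :: "(real, 'm) vec \<Rightarrow> 'm clif"
    by (rule integrable_compact_support(1)[OF cc[OF that], of R]) (simp add: \<phi>0 cscale_def zero_vec_def)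
  note Fc = left_monogenic_continuous[OF F]
  obtain e where e: "e > 0" "cball t e \<subseteq> A" using A t open_contains_cball by blast
  \<comment> \<open>Continuity on a compact box of heights and points supplies the majorant of the
    time derivative.\<close>
  have "compact ((\<lambda>x. D x (1, 0)) ` (cball t e \<times> cball 0 R))"
    by (intro compact_continuous_image compact_Times compact_cball continuous_on_subset[OF D0]) (use e in \<open>auto simp: slab_def\<close>)
  from compact_imp_bounded[OF this] obtain C where C': "\<forall>y\<in>(\<lambda>x. D x (1, 0)) ` (cball t e \<times> cball 0 R). norm y \<le> C"
    unfolding bounded_iff by blast
  have C: "norm (D (s, x) (1, 0)) \<le> C" if "s \<in> cball t e" "x \<in> cball 0 R" for s x
    using bspec[OF C', OF imageI[of "(s, x)"]] that by simp
  have inA: "s \<in> A" if "\<bar>s - t\<bar> < e" for s using e(2) that by (auto simp: dist_real_def abs_minus_commute subset_iff)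
  have ic: "integrable lborel (\<lambda>x::(real, 'm) vec. max C 0 * indicator (cball 0 R) x)"
    using emeasure_lborel_cball_finite[of "0::(real, 'm) vec" R] by (intro integrable_mult_right integrable_real_indicator) auto
  have ode: "((\<lambda>s. \<integral>x. cscale (\<phi> x) (F (s, x)) \<partial>lborel) has_vector_derivative (\<integral>x. cscale (\<phi> x) (D (t, x) (1, 0)) \<partial>lborel)) (at t)"
  proof (rule has_vector_derivative_integral[OF e(1) _ _ _ ic])
    show "integrable lborel (\<lambda>x. cscale (\<phi> x) (F (s, x)))" if "\<bar>s - t\<bar> < e" for s
      by (rule ci[OF cs[OF Fc inA[OF that]]])
    show "((\<lambda>s. cscale (\<phi> x) (F (s, x))) has_vector_derivative cscale (\<phi> x) (D (s, x) (1, 0))) (at s)" if "\<bar>s - t\<bar> < e" for s x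
    proof -
      have d: "(F has_derivative D (s, x)) (at (s, x))" using D inA[OF that] by (simp add: sl)
      have "((\<lambda>s. (s, x)) has_derivative (\<lambda>h. (h, 0))) (at s)" by (intro has_derivative_Pair has_derivative_ident has_derivative_const)
      from has_derivative_compose[OF this d]
      have d2: "((\<lambda>s. F (s, x)) has_derivative (\<lambda>h. D (s, x) (h, 0))) (at s)" .
      have lin: "D (s, x) (h, 0) = h *\<^sub>R D (s, x) (1, 0)" for h
        using linear_scale[OF has_derivative_linear[OF d], of h "(1, 0)"] by simp
      have "((\<lambda>s. F (s, x)) has_vector_derivative D (s, x) (1, 0)) (at s)"
        unfolding has_vector_derivative_def by (rule has_derivative_eq_rhs[OF d2]) (rule ext, rule lin)
      then show ?thesis
        by (rule bounded_linear.has_vector_derivative[OF bounded_bilinear.bounded_linear_right[OF bounded_bilinear_cscale]])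
    qed
    show "norm (cscale (\<phi> x) (D (s, x) (1, 0))) \<le> max C 0 * indicator (cball 0 R) x" if "\<bar>s - t\<bar> < e" for s x
    proof (cases "norm x \<le> R")
      case True
      have "norm (cscale (\<phi> x) (D (s, x) (1, 0))) \<le> 1 * norm (D (s, x) (1, 0))"
        unfolding norm_cscale by (intro mult_right_mono \<phi>1) simp
      also have "\<dots> \<le> C" using C[of s x] that True by (simp add: dist_real_def abs_minus_commute)
      finally show ?thesis using True by simp
    qed (simp add: \<phi>0)
    show "integrable lborel (\<lambda>x. cscale (\<phi> x) (D (t, x) (1, 0)))" by (rule ci[OF cs[OF D0 t]])
  qed
  have parts: "(\<integral>x. cscale (\<phi> x) (D (t, x) (0, axis k 1)) \<partial>lborel)
     = cscale (\<i> * complex_of_real (\<eta> $ k)) (cft (-1) (\<lambda>x. cutoff R x *\<^sub>R F (t, x)) \<eta>) - cft (-1) (\<lambda>x. cutoff' R x (axis k 1) *\<^sub>R F (t, x)) \<eta>" for k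
  proof -
    have Hd: "((\<lambda>x. cscale (\<phi> x) (F (t, x))) has_derivative (\<lambda>v. cscale (\<phi> x) (D (t, x) (0, v)) + cscale (\<phi>' x v) (F (t, x)))) (at x)" for x
    proof -
      have "((\<lambda>x. (t, x)) has_derivative (\<lambda>v. (0, v))) (at x)" by (intro has_derivative_Pair has_derivative_ident has_derivative_const)
      moreover have "(F has_derivative D (t, x)) (at (t, x))" using D t by (simp add: sl)
      ultimately have "((\<lambda>x. F (t, x)) has_derivative (\<lambda>v. D (t, x) (0, v))) (at x)" by (rule has_derivative_compose)
      from bounded_bilinear.FDERIV[OF bounded_bilinear_cscale \<phi>d this] show ?thesis .
    qed
    have c2: "continuous_on UNIV (\<lambda>x. cscale (\<phi>' x (axis k 1)) (F (t, x)))"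
      by (rule bounded_bilinear.continuous_on[OF bounded_bilinear_cscale \<phi>'c cs[OF Fc t]])
    have z: "\<phi>' x v = 0" if "norm x > R" for x v
      using cutoff_outside[OF R, of x] cutoff'_outside[OF R, of x v] that by (simp add: \<phi>'_def)
    have i2: "integrable lborel (\<lambda>x. cscale (\<phi>' x (axis k 1)) (F (t, x)))"
      by (rule integrable_compact_support(1)[OF c2, of R]) (simp add: z cscale_def zero_vec_def)
    have "(\<integral>x. cscale (\<phi> x) (D (t, x) (0, axis k 1)) + cscale (\<phi>' x (axis k 1)) (F (t, x)) \<partial>lborel) = 0"
    proof (rule integral_derivative_eq_0[OF Hd, of _ R])
      show "continuous_on UNIV (\<lambda>x. cscale (\<phi> x) (D (t, x) (0, axis k 1)) + cscale (\<phi>' x (axis k 1)) (F (t, x)))"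
        by (rule continuous_on_add[OF cc[OF cs[OF Dk t]] c2])
    qed (simp add: \<phi>0 cscale_def zero_vec_def)
    then have "(\<integral>x. cscale (\<phi> x) (D (t, x) (0, axis k 1)) \<partial>lborel) = - (\<integral>x. cscale (\<phi>' x (axis k 1)) (F (t, x)) \<partial>lborel)"
      by (simp add: Bochner_Integration.integral_add[OF ci[OF cs[OF Dk t]] i2] eq_neg_iff_add_eq_0)
    also have "(\<integral>x. cscale (\<phi>' x (axis k 1)) (F (t, x)) \<partial>lborel)
       = cft (-1) (\<lambda>x. cutoff' R x (axis k 1) *\<^sub>R F (t, x)) \<eta> - cscale (\<i> * complex_of_real (\<eta> $ k)) (cft (-1) (\<lambda>x. cutoff R x *\<^sub>R F (t, x)) \<eta>)"
    proof -
      have eq: "cscale (\<phi>' x (axis k 1)) (F (t, x)) = cscale (cis (- 1 * (x \<bullet> \<eta>))) (cutoff' R x (axis k 1) *\<^sub>R F (t, x)) - cscale (\<i> * complex_of_real (\<eta> $ k)) (cscale (\<phi> x) (F (t, x)))" for x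
        by (simp add: vec_eq_iff \<phi>'_def \<phi>_def inner_axis' scaleR_conv_of_real[of _ "_::complex"] algebra_simps)
      have i3: "integrable lborel (\<lambda>x. cscale (cis (- 1 * (x \<bullet> \<eta>))) (cutoff' R x (axis k 1) *\<^sub>R F (t, x)))"
      proof (rule integrable_cft, rule integrable_compact_support(1)[of _ R])
        show "continuous_on UNIV (\<lambda>x. cutoff' R x (axis k 1) *\<^sub>R F (t, x))"
          by (intro continuous_on_scaleR cutoff'_continuous cs[OF Fc t])
      qed (simp add: cutoff'_outside[OF R])
      have i4: "integrable lborel (\<lambda>x. cscale (\<phi> x) (F (t, x)))" by (rule ci[OF cs[OF Fc t]])
      note bl = bounded_bilinear.bounded_linear_right[OF bounded_bilinear_cscale, of "\<i> * complex_of_real (\<eta> $ k)"]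
      show ?thesis
        unfolding eq Bochner_Integration.integral_diff[OF i3 integrable_bounded_linear[OF bl i4]] integral_bounded_linear[OF bl i4]
        by (simp only: cftE) (simp add: cft_def)
    qed
    finally show ?thesis by simp
  qed
  have "(\<integral>x. cscale (\<phi> x) (D (t, x) (1, 0)) \<partial>lborel) = (\<integral>x. - (\<Sum>k\<in>UNIV. clif_mult (clif_gen k) (cscale (\<phi> x) (D (t, x) (0, axis k 1)))) \<partial>lborel)"
  proof (rule Bochner_Integration.integral_cong[OF refl])
    fix x
    have "D (t, x) (1, 0) = - (\<Sum>k\<in>UNIV. clif_mult (clif_gen k) (D (t, x) (0, axis k 1)))"
      using De[of "(t, x)"] t by (simp add: sl eq_neg_iff_add_eq_0)
    then show "cscale (\<phi> x) (D (t, x) (1, 0)) = - (\<Sum>k\<in>UNIV. clif_mult (clif_gen k) (cscale (\<phi> x) (D (t, x) (0, axis k 1))))"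
      by (simp add: clif_mult_cscale_right cscale_sum_right[symmetric] bounded_bilinear.minus_right[OF bounded_bilinear_cscale])
  qed
  also have "\<dots> = - (\<Sum>k\<in>UNIV. clif_mult (clif_gen k) (\<integral>x. cscale (\<phi> x) (D (t, x) (0, axis k 1)) \<partial>lborel))"
  proof -
    have i: "integrable lborel (\<lambda>x. clif_mult (clif_gen k) (cscale (\<phi> x) (D (t, x) (0, axis k 1))))" for k
      by (rule integrable_bounded_linear[OF bounded_linear_clif_mult ci[OF cs[OF Dk t]]])
    show ?thesis
      by (simp add: Bochner_Integration.integral_sum[OF i] integral_bounded_linear[OF bounded_linear_clif_mult ci[OF cs[OF Dk t]]])
  qed
  also have "\<dots> = rem R F t \<eta> - Jop \<eta> (cft (-1) (\<lambda>x. cutoff R x *\<^sub>R F (t, x)) \<eta>)"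
    unfolding parts rem_def Jop_sum
    by (simp add: linear_diff[OF linear_clif_mult_right] clif_mult_cscale_right sum_subtractf)
  finally show ?thesis using ode by (simp add: cftE)
qed

section \<open>Bounds for the truncated transforms and the remainder\<close>

lemma L2_sum:
  fixes c :: real
  assumes "finite I" "\<And>i. i \<in> I \<Longrightarrow> L2 (f i)" "\<And>i. i \<in> I \<Longrightarrow> l2 (f i) \<le> c"
  shows "L2 (\<lambda>x. \<Sum>i\<in>I. f i x) \<and> l2 (\<lambda>x. \<Sum>i\<in>I. f i x) \<le> real (card I) * c"
  using assms
proof (induction I rule: finite_induct)
  case empty
  then show ?case by (simp add: l2_def)
next
  case (insert i I)
  then have "L2 (f i)" "L2 (\<lambda>x. \<Sum>i\<in>I. f i x)" "l2 (f i) \<le> c" "l2 (\<lambda>x. \<Sum>i\<in>I. f i x) \<le> real (card I) * c" by auto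
  with l2_triangle[OF this(1,2)] L2_add[OF this(1,2)] insert(1,2) show ?case by (simp add: algebra_simps)
qed

lemma L2_indicator_cball: "L2 (indicator (cball 0 R) :: 'a::euclidean_space \<Rightarrow> real)"
proof -
  have "integrable lborel (indicator (cball 0 R) :: 'a \<Rightarrow> real)"
    using emeasure_lborel_cball_finite[of 0 R] by (intro integrable_real_indicator) auto
  moreover have "(\<lambda>x::'a. (norm (indicator (cball 0 R) x :: real))\<^sup>2) = indicator (cball 0 R)" by (auto simp: indicator_def)
  ultimately show ?thesis unfolding L2_def by auto
qed

text \<open>Used with c = 1 and c = 4 / R. The L2 bound retains the factor c without any dependence
  on the size of the support; the pointwise bound involves the ball and supplies integrability and
  domination for fixed R.\<close>

lemma compact_support_transform:
  fixes f :: "(real, 'm::finite) vec \<Rightarrow> 'm clif" and q :: "(real, 'm) vec \<Rightarrow> real"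
  assumes f: "L2 f" and q: "q \<in> borel_measurable borel" "\<And>x. \<bar>q x\<bar> \<le> c" and q0: "\<forall>x. norm x > R \<longrightarrow> q x = 0"
  shows "integrable lborel (\<lambda>x. q x *\<^sub>R f x)" "L2 (\<lambda>x. q x *\<^sub>R f x)"
    "L2 (cft (-1) (\<lambda>x. q x *\<^sub>R f x))" "l2 (cft (-1) (\<lambda>x. q x *\<^sub>R f x)) \<le> sqrt ((2 * pi) ^ CARD('m)) * (c * l2 f)"
    "norm (cft (-1) (\<lambda>x. q x *\<^sub>R f x) \<eta>) \<le> c * (l2 f * l2 (indicator (cball 0 R) :: (real, 'm) vec \<Rightarrow> real))"
proof -
  note [measurable] = L2_measurable[OF f] q(1)
  have c: "0 \<le> c" using q(2)[of 0] by linarith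
  have le: "norm (q x *\<^sub>R f x) \<le> c * norm (f x)" for x using q(2)[of x] by (simp add: mult_right_mono)
  show i: "integrable lborel (\<lambda>x. q x *\<^sub>R f x)"
    by (rule L2_integrable_bounded_support[OF f _ le, of R]) (simp_all add: q0)
  have AE: "AE x in lborel. norm (q x *\<^sub>R f x) \<le> c * norm (f x)" using le by (intro AE_I2)
  show L: "L2 (\<lambda>x. q x *\<^sub>R f x)" by (rule L2_bound(1)[OF f _ AE c]) simp
  have l: "l2 (\<lambda>x. q x *\<^sub>R f x) \<le> c * l2 f" by (rule L2_bound(2)[OF f _ AE c]) simp
  show "L2 (cft (-1) (\<lambda>x. q x *\<^sub>R f x))" by (rule cft_plancherel_le(1)[OF _ i L]) simp
  show "l2 (cft (-1) (\<lambda>x. q x *\<^sub>R f x)) \<le> sqrt ((2 * pi) ^ CARD('m)) * (c * l2 f)"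
    by (rule order_trans[OF cft_plancherel_le(2)[OF _ i L] mult_left_mono[OF l]]) auto
  let ?I = "indicator (cball 0 R) :: (real, 'm) vec \<Rightarrow> real"
  note CS = L2_Cauchy_Schwarz[OF f L2_indicator_cball[where R=R]]
  have "norm (q x *\<^sub>R f x) \<le> c * (norm (f x) * norm (?I x))" for x
    using le[of x] q0[rule_format, of x] by (cases "norm x > R") (auto simp: indicator_def)
  then have "(\<integral>x. norm (q x *\<^sub>R f x) \<partial>lborel) \<le> (\<integral>x. c * (norm (f x) * norm (?I x)) \<partial>lborel)"
    by (intro integral_mono integrable_norm i integrable_mult_right CS(1))
  also have "\<dots> \<le> c * (l2 f * l2 ?I)" using CS(2) c by (simp only: integral_mult_right_zero mult_left_mono)
  finally show "norm (cft (-1) (\<lambda>x. q x *\<^sub>R f x) \<eta>) \<le> c * (l2 f * l2 ?I)"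
    by (rule order_trans[OF norm_cft_le])
qed

lemma cutoff_transform:
  fixes f :: "(real, 'm::finite) vec \<Rightarrow> 'm clif"
  assumes "L2 f" "R > 0"
  shows "integrable lborel (\<lambda>x. cutoff R x *\<^sub>R f x)" "L2 (\<lambda>x. cutoff R x *\<^sub>R f x)"
    "L2 (cft (-1) (\<lambda>x. cutoff R x *\<^sub>R f x))"
    "norm (cft (-1) (\<lambda>x. cutoff R x *\<^sub>R f x) \<eta>) \<le> 1 * (l2 f * l2 (indicator (cball 0 R) :: (real, 'm) vec \<Rightarrow> real))"
proof -
  have q: "cutoff R \<in> borel_measurable borel" "\<And>x::(real, 'm) vec. \<bar>cutoff R x\<bar> \<le> 1" "\<forall>x::(real, 'm) vec. norm x > R \<longrightarrow> cutoff R x = 0"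
    using assms(2) by (auto simp: cutoff_nonneg cutoff_le_1 cutoff_outside)
  note T = compact_support_transform[OF assms(1) q]
  show "integrable lborel (\<lambda>x. cutoff R x *\<^sub>R f x)" "L2 (\<lambda>x. cutoff R x *\<^sub>R f x)"
    "L2 (cft (-1) (\<lambda>x. cutoff R x *\<^sub>R f x))"
    "norm (cft (-1) (\<lambda>x. cutoff R x *\<^sub>R f x) \<eta>) \<le> 1 * (l2 f * l2 (indicator (cball 0 R) :: (real, 'm) vec \<Rightarrow> real))"
    by (rule T)+
qed

lemma rem_bounds:
  fixes F :: "real \<times> ((real, 'm::{finite,linorder}) vec) \<Rightarrow> 'm clif"
  assumes f: "L2 (\<lambda>x. F (t, x))" "l2 (\<lambda>x. F (t, x)) \<le> M" and R: "R > 0"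
  shows "L2 (rem R F t)" "l2 (rem R F t) \<le> CARD('m) * (sqrt ((2 * pi) ^ CARD('m)) * (4 / R * M))"
    "norm (rem R F t \<eta>) \<le> CARD('m) * (4 / R * (M * l2 (indicator (cball 0 R) :: (real, 'm) vec \<Rightarrow> real)))"
proof -
  define K where "K = sqrt ((2 * pi) ^ CARD('m))"
  let ?I = "indicator (cball 0 R) :: (real, 'm) vec \<Rightarrow> real"
  let ?c = "\<lambda>k. cft (-1) (\<lambda>x. cutoff' R x (axis k 1) *\<^sub>R F (t, x))"
  have q: "(\<lambda>x. cutoff' R x (axis k 1)) \<in> borel_measurable borel" "\<And>x. \<bar>cutoff' R (x :: (real, 'm) vec) (axis k 1)\<bar> \<le> 4 / R"
    "\<forall>x :: (real, 'm) vec. norm x > R \<longrightarrow> cutoff' R x (axis k 1) = 0" for k :: 'm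
    using R by (auto simp: cutoff'_outside intro!: cutoff'_le)
  note T = compact_support_transform[OF f(1) q]
  have m: "(\<lambda>\<eta>. clif_mult (clif_gen k) (?c k \<eta>)) \<in> borel_measurable borel" for k
    using L2_measurable[OF T(3)] by (intro clif_mult_measurable)
  have AE: "AE \<eta> in lborel. norm (clif_mult (clif_gen k) (?c k \<eta>)) \<le> 1 * norm (?c k \<eta>)" for k
    by (simp add: norm_clif_gen)
  have Lk: "L2 (\<lambda>\<eta>. clif_mult (clif_gen k) (?c k \<eta>))" for k
    by (rule L2_bound(1)[OF T(3) m AE]) simp_all
  have lk: "l2 (\<lambda>\<eta>. clif_mult (clif_gen k) (?c k \<eta>)) \<le> K * (4 / R * M)" for k
  proof -
    have "l2 (\<lambda>\<eta>. clif_mult (clif_gen k) (?c k \<eta>)) \<le> 1 * l2 (?c k)"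
      by (rule L2_bound(2)[OF T(3) m AE]) simp_all
    also have "\<dots> \<le> K * (4 / R * l2 (\<lambda>x. F (t, x)))" using T(4)[of k] by (simp add: K_def)
    also have "\<dots> \<le> K * (4 / R * M)" using f(2) R by (intro mult_left_mono) (auto simp: K_def)
    finally show ?thesis .
  qed
  have "L2 (\<lambda>\<eta>. \<Sum>k\<in>UNIV. clif_mult (clif_gen k) (?c k \<eta>)) \<and> l2 (\<lambda>\<eta>. \<Sum>k\<in>UNIV. clif_mult (clif_gen k) (?c k \<eta>)) \<le> CARD('m) * (K * (4 / R * M))"
    by (rule L2_sum[OF finite Lk lk])
  then show "L2 (rem R F t)" "l2 (rem R F t) \<le> CARD('m) * (sqrt ((2 * pi) ^ CARD('m)) * (4 / R * M))"
    by (simp_all add: rem_def[abs_def] K_def)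
  have "norm (rem R F t \<eta>) \<le> (\<Sum>k\<in>(UNIV::'m set). 4 / R * (M * l2 ?I))"
    unfolding rem_def
  proof (rule sum_norm_le)
    fix k
    have "norm (?c k \<eta>) \<le> 4 / R * (l2 (\<lambda>x. F (t, x)) * l2 ?I)" by (rule T(5))
    also have "\<dots> \<le> 4 / R * (M * l2 ?I)" using f(2) R by (intro mult_left_mono mult_right_mono) auto
    finally show "norm (clif_mult (clif_gen k) (?c k \<eta>)) \<le> 4 / R * (M * l2 ?I)" by (simp add: norm_clif_gen)
  qed
  then show "norm (rem R F t \<eta>) \<le> CARD('m) * (4 / R * (M * l2 ?I))" by simp
qed

text \<open>The support of psi confines the exponential growth of \<open>Eop\<close> to the ball of
  radius K; outside it psi and its evolution vanish.\<close>

lemma inner_Eop_bound: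
  assumes "\<And>\<eta>. norm \<eta> > K \<Longrightarrow> \<psi> \<eta> = 0" "\<bar>s\<bar> \<le> a"
  shows "norm (Eop s \<eta> (\<psi> \<eta>)) \<le> 2 * exp (a * K) * norm (\<psi> \<eta>)"
    "norm (\<psi> \<eta> \<bullet> Eop s \<eta> w) \<le> norm (\<psi> \<eta>) * (2 * exp (a * K)) * norm w"
proof -
  have E: "norm (Eop s \<eta> w) \<le> 2 * exp (a * K) * norm w" if "norm \<eta> \<le> K" for w
  proof -
    have "\<bar>s\<bar> * norm \<eta> \<le> a * K" using assms(2) that by (intro mult_mono) auto
    then have "2 * exp (\<bar>s\<bar> * norm \<eta>) * norm w \<le> 2 * exp (a * K) * norm w" by (intro mult_right_mono) auto
    then show ?thesis using norm_Eop_le[of s \<eta> w] by linarith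
  qed
  show "norm (Eop s \<eta> (\<psi> \<eta>)) \<le> 2 * exp (a * K) * norm (\<psi> \<eta>)"
    using E[of "\<psi> \<eta>"] assms(1)[of \<eta>] linear_0[OF linear_Eop, of s \<eta>] by (cases "norm \<eta> \<le> K") auto
  show "norm (\<psi> \<eta> \<bullet> Eop s \<eta> w) \<le> norm (\<psi> \<eta>) * (2 * exp (a * K)) * norm w"
  proof (cases "norm \<eta> \<le> K")
    case True
    have "norm (\<psi> \<eta> \<bullet> Eop s \<eta> w) \<le> norm (\<psi> \<eta>) * norm (Eop s \<eta> w)" by (simp add: Cauchy_Schwarz_ineq2)
    also have "\<dots> \<le> norm (\<psi> \<eta>) * (2 * exp (a * K) * norm w)" by (intro mult_left_mono E True) simp
    finally show ?thesis by (simp add: mult_ac)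
  qed (simp add: assms(1))
qed

text \<open>The remainder is small only in L2, not pointwise in eta; pairing with a fixed psi converts its
  L2 bound into a bound on the derivative of a scalar function of time.\<close>
lemma pairing_increment:
  fixes F :: "real \<times> ((real, 'm::{finite,linorder}) vec) \<Rightarrow> 'm clif"
  assumes F: "left_monogenic (slab {-a<..<a}) F"
    and L: "\<And>s. \<bar>s\<bar> < a \<Longrightarrow> L2 (\<lambda>x. F (s, x))" "\<And>s. \<bar>s\<bar> < a \<Longrightarrow> l2 (\<lambda>x. F (s, x)) \<le> M"
    and \<psi>: "L2 \<psi>" "\<And>\<eta>. norm \<eta> > K \<Longrightarrow> \<psi> \<eta> = 0" and R: "R > 0" and t: "\<bar>t\<bar> < a"
  defines "U s \<equiv> \<integral>\<eta>. \<psi> \<eta> \<bullet> Eop (- s) \<eta> (cft (-1) (\<lambda>x. cutoff R x *\<^sub>R F (s, x)) \<eta>) \<partial>lborel"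
  shows "norm (U t - U 0) \<le> 2 * exp (a * K) * l2 \<psi> * (CARD('m) * (sqrt ((2 * pi) ^ CARD('m)) * (4 / R * M))) * \<bar>t\<bar>"
proof -
  let ?u = "\<lambda>s \<eta>. cft (-1) (\<lambda>x. cutoff R x *\<^sub>R F (s, x)) \<eta>"
  \<comment> \<open>C decays like 1 / R and is the bound sought; C2 dominates the derivative of the
    integrand for fixed R only.\<close>
  define C where "C = 2 * exp (a * K) * l2 \<psi> * (CARD('m) * (sqrt ((2 * pi) ^ CARD('m)) * (4 / R * M)))"
  define C2 where "C2 = CARD('m) * (4 / R * (M * l2 (indicator (cball 0 R) :: (real, 'm) vec \<Rightarrow> real)))"
  \<comment> \<open>The integrating factor cancels the \<open>Jop\<close> term of the equation, so
    only the remainder is left in the derivative.\<close>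
  define U' where "U' s = (\<integral>\<eta>. \<psi> \<eta> \<bullet> Eop (- s) \<eta> (rem R F s \<eta>) \<partial>lborel)" for s
  note [measurable] = L2_measurable[OF \<psi>(1)]
  have \<psi>i: "integrable lborel \<psi>"
    by (rule L2_integrable_bounded_support[OF \<psi>(1) _ _ \<psi>(2), where c=1]) auto
  have rm: "rem R F s \<in> borel_measurable borel" if "\<bar>s\<bar> < a" for s
    by (rule L2_measurable[OF rem_bounds(1)[OF L[OF that] R]])
  have um: "?u s \<in> borel_measurable borel" if "\<bar>s\<bar> < a" for s
    by (rule L2_measurable[OF cutoff_transform(3)[OF L(1)[OF that] R]])
  have int_bound: "integrable lborel (\<lambda>\<eta>. \<psi> \<eta> \<bullet> Eop (- s) \<eta> (w \<eta>))"
    if s: "\<bar>s\<bar> < a" and w: "w \<in> borel_measurable borel" "\<And>\<eta>. norm (w \<eta>) \<le> c" for s c and w :: "(real, 'm) vec \<Rightarrow> 'm clif"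
  proof (rule Bochner_Integration.integrable_bound)
    show "integrable lborel (\<lambda>\<eta>. norm (\<psi> \<eta>) * (2 * exp (a * K)) * c)" using \<psi>i by simp
    have c: "0 \<le> c" using w(2)[of 0] norm_ge_zero[of "w 0"] by linarith
    have "norm (\<psi> \<eta> \<bullet> Eop (- s) \<eta> (w \<eta>)) \<le> norm (norm (\<psi> \<eta>) * (2 * exp (a * K)) * c)" for \<eta>
    proof -
      have "norm (\<psi> \<eta> \<bullet> Eop (- s) \<eta> (w \<eta>)) \<le> norm (\<psi> \<eta>) * (2 * exp (a * K)) * norm (w \<eta>)"
        by (rule inner_Eop_bound(2)[OF \<psi>(2)]) (use s in auto)
      also have "\<dots> \<le> norm (\<psi> \<eta>) * (2 * exp (a * K)) * c" by (intro mult_left_mono w) auto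
      finally show ?thesis using c by simp
    qed
    then show "AE \<eta> in lborel. norm (\<psi> \<eta> \<bullet> Eop (- s) \<eta> (w \<eta>)) \<le> norm (norm (\<psi> \<eta>) * (2 * exp (a * K)) * c)" by simp
    note [measurable] = Eop_measurable[OF w(1)]
    show "(\<lambda>\<eta>. \<psi> \<eta> \<bullet> Eop (- s) \<eta> (w \<eta>)) \<in> borel_measurable lborel" by simp
  qed
  have der: "(U has_vector_derivative U' s) (at s)" if s: "\<bar>s\<bar> < a" for s
    unfolding U_def U'_def
  proof (rule has_vector_derivative_integral[where r="a - \<bar>s\<bar>" and B="\<lambda>\<eta>. norm (\<psi> \<eta>) * (2 * exp (a * K)) * C2"])
    show "0 < a - \<bar>s\<bar>" using s by simp
    show "integrable lborel (\<lambda>\<eta>. norm (\<psi> \<eta>) * (2 * exp (a * K)) * C2)" using \<psi>i by simp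
    show "integrable lborel (\<lambda>\<eta>. \<psi> \<eta> \<bullet> Eop (- s) \<eta> (rem R F s \<eta>))"
      by (rule int_bound[OF s rm[OF s] rem_bounds(3)[OF L[OF s] R]])
    fix y assume "\<bar>y - s\<bar> < a - \<bar>s\<bar>"
    then have y: "\<bar>y\<bar> < a" by linarith
    show "integrable lborel (\<lambda>\<eta>. \<psi> \<eta> \<bullet> Eop (- y) \<eta> (?u y \<eta>))"
      by (rule int_bound[OF y um[OF y] cutoff_transform(4)[OF L(1)[OF y] R]])
    fix \<eta>
    have "((\<lambda>y. ?u y \<eta>) has_vector_derivative (rem R F y \<eta> - Jop \<eta> (?u y \<eta>))) (at y)"
      by (rule transform_ode[OF F _ _ R]) (use y in auto)
    from Eop_neg_has_vector_derivative[OF this, of \<eta>]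
    have "((\<lambda>y. Eop (- y) \<eta> (?u y \<eta>)) has_vector_derivative Eop (- y) \<eta> (rem R F y \<eta>)) (at y)" by simp
    then show "((\<lambda>y. \<psi> \<eta> \<bullet> Eop (- y) \<eta> (?u y \<eta>)) has_vector_derivative \<psi> \<eta> \<bullet> Eop (- y) \<eta> (rem R F y \<eta>)) (at y)"
      by (rule bounded_linear.has_vector_derivative[OF bounded_linear_inner_right])
    have "norm (\<psi> \<eta> \<bullet> Eop (- y) \<eta> (rem R F y \<eta>)) \<le> norm (\<psi> \<eta>) * (2 * exp (a * K)) * norm (rem R F y \<eta>)"
      by (rule inner_Eop_bound(2)[OF \<psi>(2)]) (use y in auto)
    also have "\<dots> \<le> norm (\<psi> \<eta>) * (2 * exp (a * K)) * C2"
      unfolding C2_def by (intro mult_left_mono rem_bounds(3)[OF L[OF y] R]) auto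
    finally show "norm (\<psi> \<eta> \<bullet> Eop (- y) \<eta> (rem R F y \<eta>)) \<le> norm (\<psi> \<eta>) * (2 * exp (a * K)) * C2" .
  qed
  have U'_le: "norm (U' s) \<le> C" if s: "\<bar>s\<bar> < a" for s
  proof -
    note CS = L2_Cauchy_Schwarz[OF \<psi>(1) rem_bounds(1)[OF L[OF s] R]]
    have "norm (U' s) \<le> (\<integral>\<eta>. norm (\<psi> \<eta> \<bullet> Eop (- s) \<eta> (rem R F s \<eta>)) \<partial>lborel)"
      unfolding U'_def by (rule integral_norm_bound)
    also have "\<dots> \<le> (\<integral>\<eta>. (2 * exp (a * K)) * (norm (\<psi> \<eta>) * norm (rem R F s \<eta>)) \<partial>lborel)"
    proof (rule integral_mono)
      show "integrable lborel (\<lambda>\<eta>. norm (\<psi> \<eta> \<bullet> Eop (- s) \<eta> (rem R F s \<eta>)))"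
        by (rule integrable_norm[OF int_bound[OF s rm[OF s] rem_bounds(3)[OF L[OF s] R]]])
      show "norm (\<psi> \<eta> \<bullet> Eop (- s) \<eta> (rem R F s \<eta>)) \<le> (2 * exp (a * K)) * (norm (\<psi> \<eta>) * norm (rem R F s \<eta>))" for \<eta>
        using inner_Eop_bound(2)[OF \<psi>(2), where s="- s" and a=a and \<eta>=\<eta> and w="rem R F s \<eta>"] s by (simp add: mult_ac)
    qed (intro integrable_mult_right CS(1))
    also have "\<dots> \<le> (2 * exp (a * K)) * (l2 \<psi> * (CARD('m) * (sqrt ((2 * pi) ^ CARD('m)) * (4 / R * M))))"
      unfolding integral_mult_right_zero
      by (intro mult_left_mono order_trans[OF CS(2)] rem_bounds(2)[OF L[OF s] R]) auto
    finally show ?thesis by (simp add: C_def mult.assoc)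
  qed
  have a0: "a > 0" using t by linarith
  have "norm (U t - U 0) \<le> C * norm (t - 0)"
  proof (rule differentiable_bound[of "{-a<..<a}" U "\<lambda>s h. h *\<^sub>R U' s"])
    fix s assume "s \<in> {-a<..<a}"
    then have s: "\<bar>s\<bar> < a" by auto
    show "(U has_derivative (\<lambda>h. h *\<^sub>R U' s)) (at s within {-a<..<a})"
      using der[OF s] unfolding has_vector_derivative_def by (rule has_derivative_at_withinI)
    show "onorm (\<lambda>h. h *\<^sub>R U' s) \<le> C"
    proof (rule onorm_bound[OF order_trans[OF norm_ge_zero U'_le[OF s]]])
      fix h show "norm (h *\<^sub>R U' s) \<le> C * norm h"
        using mult_left_mono[OF U'_le[OF s], of "\<bar>h\<bar>"] by (simp add: abs_mult mult.commute)
    qed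
  qed (use t a0 in auto)
  then show ?thesis by (simp add: C_def)
qed

text \<open>As R tends to infinity, the pairings at heights t and 0 converge while their difference
  vanishes, so psi is orthogonal to \<open>Eop (- t)\<close> gt - g0. A suitable psi makes this
  orthogonality an equality on each ball, and the group law inverts
  \<open>Eop (- t)\<close>.\<close>

lemma spectral_evolution:
  fixes F :: "real \<times> ((real, 'm::{finite,linorder}) vec) \<Rightarrow> 'm clif"
  assumes F: "left_monogenic (slab {-a<..<a}) F"
    and L: "\<And>s. \<bar>s\<bar> < a \<Longrightarrow> L2 (\<lambda>x. F (s, x))" "\<And>s. \<bar>s\<bar> < a \<Longrightarrow> l2 (\<lambda>x. F (s, x)) \<le> M"
    and t: "\<bar>t\<bar> < a" and gt: "is_ft (\<lambda>x. F (t, x)) gt" and g0: "is_ft (\<lambda>x. F (0, x)) g0"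
  shows "AE \<eta> in lborel. gt \<eta> = Eop t \<eta> (g0 \<eta>)"
proof -
  have gtL: "L2 gt" and g0L: "L2 g0" using gt g0 by (simp_all add: is_ft_def)
  note [measurable] = L2_measurable[OF gtL] L2_measurable[OF g0L] Eop_measurable[OF L2_measurable[OF gtL]]
  have a0: "\<bar>0\<bar> < a" using t by linarith
  have on_ball: "AE \<eta> in lborel. indicator (cball 0 (real k)) \<eta> *\<^sub>R (Eop (- t) \<eta> (gt \<eta>) - g0 \<eta>) = 0" for k :: nat
  proof -
    define K where "K = real k"
    \<comment> \<open>The difference to be shown zero, cut to a ball: its pairing with the
      difference is the square of its own L2 norm.\<close>
    define \<psi> where "\<psi> \<eta> = indicator (cball 0 K) \<eta> *\<^sub>R (Eop (- t) \<eta> (gt \<eta>) - g0 \<eta>)" for \<eta>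
    have bb: "bounded_bilinear (inner :: 'm clif \<Rightarrow> _)" "norm (x \<bullet> y) \<le> norm x * norm y" for x y :: "'m clif"
      by (auto simp: bounded_bilinear_inner Cauchy_Schwarz_ineq2)
    have \<psi>0: "\<psi> \<eta> = 0" if "norm \<eta> > K" for \<eta> using that by (simp add: \<psi>_def)
    have \<psi>L: "L2 \<psi>"
    proof -
      have "L2 (\<lambda>\<eta>. indicator (cball 0 K) \<eta> *\<^sub>R Eop (- t) \<eta> (gt \<eta>))"
      proof (rule L2_bound(1)[OF gtL])
        show "AE \<eta> in lborel. norm (indicator (cball 0 K) \<eta> *\<^sub>R Eop (- t) \<eta> (gt \<eta>)) \<le> 2 * exp (a * K) * norm (gt \<eta>)"
        proof (rule AE_I2)
          fix \<eta>
          show "norm (indicator (cball 0 K) \<eta> *\<^sub>R Eop (- t) \<eta> (gt \<eta>)) \<le> 2 * exp (a * K) * norm (gt \<eta>)"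
          proof (cases "norm \<eta> \<le> K")
            case True
            have "\<bar>- t\<bar> * norm \<eta> \<le> a * K" using True t by (intro mult_mono) auto
            then have "2 * exp (\<bar>- t\<bar> * norm \<eta>) * norm (gt \<eta>) \<le> 2 * exp (a * K) * norm (gt \<eta>)" by (intro mult_right_mono) auto
            then show ?thesis using norm_Eop_le[of "- t" \<eta> "gt \<eta>"] True by simp
          qed simp
        qed
        show "(\<lambda>\<eta>. indicator (cball 0 K) \<eta> *\<^sub>R Eop (- t) \<eta> (gt \<eta>)) \<in> borel_measurable borel"
          by (intro borel_measurable_scaleR borel_measurable_indicator Eop_measurable L2_measurable[OF gtL]) simp
      qed simp
      from L2_diff[OF this L2_indicator(1)[OF g0L, of K]] show ?thesis
        by (simp add: \<psi>_def[abs_def] scaleR_right_diff_distrib)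
    qed
    note [measurable] = L2_measurable[OF \<psi>L]
    define Rn where "Rn n = real (Suc n)" for n
    have Rn: "Rn n > 0" for n by (simp add: Rn_def)
    define u where "u n s = cft (-1) (\<lambda>x. cutoff (Rn n) x *\<^sub>R F (s, x))" for n s
    define U where "U n s = (\<integral>\<eta>. \<psi> \<eta> \<bullet> Eop (- s) \<eta> (u n s \<eta>) \<partial>lborel)" for n s
    have Rlim: "filterlim Rn at_top sequentially"
      unfolding Rn_def by (rule filterlim_compose[OF filterlim_real_sequentially filterlim_Suc])
    \<comment> \<open>Self-adjointness moves \<open>Eop\<close> onto psi, where it is bounded, so L2
      convergence of the truncated transforms suffices to pass to the limit.\<close>
    have adj: "Eop s \<eta> (\<psi> \<eta>) \<bullet> w = \<psi> \<eta> \<bullet> Eop s \<eta> w" for s \<eta> w by (rule Eop_selfadjoint)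
    have conv: "(\<lambda>n. U n s) \<longlonglongrightarrow> (\<integral>\<eta>. \<psi> \<eta> \<bullet> Eop (- s) \<eta> (g \<eta>) \<partial>lborel)
        \<and> integrable lborel (\<lambda>\<eta>. \<psi> \<eta> \<bullet> Eop (- s) \<eta> (g \<eta>))"
      if s: "\<bar>s\<bar> < a" and g: "is_ft (\<lambda>x. F (s, x)) g" for s g
    proof -
      have gL: "L2 g" using g by (simp add: is_ft_def)
      note T = cutoff_transform[OF L(1)[OF s] Rn]
      have uL: "L2 (u n s)" for n unfolding u_def by (rule T(3))
      have "(\<lambda>n. l2 (\<lambda>x. F (s, x) - cutoff (Rn n) x *\<^sub>R F (s, x))) \<longlonglongrightarrow> 0"
        by (rule filterlim_compose[OF l2_cutoff_tendsto[OF L(1)[OF s]] Rlim])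
           (auto simp: cutoff_nonneg cutoff_le_1 cutoff_tendsto)
      from is_ft_tendsto[OF g T(1) T(2) this]
      have lim: "(\<lambda>n. l2 (\<lambda>\<eta>. g \<eta> - u n s \<eta>)) \<longlonglongrightarrow> 0" by (simp add: u_def)
      have EL: "L2 (\<lambda>\<eta>. Eop (- s) \<eta> (\<psi> \<eta>))"
      proof (rule L2_bound(1)[OF \<psi>L])
        show "AE \<eta> in lborel. norm (Eop (- s) \<eta> (\<psi> \<eta>)) \<le> 2 * exp (a * K) * norm (\<psi> \<eta>)"
          by (intro AE_I2 inner_Eop_bound(1)[OF \<psi>0]) (use s in auto)
      qed auto
      note i = L2_bilinear(1)[OF bb EL, unfolded adj]
      have le: "norm (U n s - (\<integral>\<eta>. \<psi> \<eta> \<bullet> Eop (- s) \<eta> (g \<eta>) \<partial>lborel)) \<le> l2 (\<lambda>\<eta>. Eop (- s) \<eta> (\<psi> \<eta>)) * l2 (\<lambda>\<eta>. g \<eta> - u n s \<eta>)" for n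
      proof -
        have "U n s - (\<integral>\<eta>. \<psi> \<eta> \<bullet> Eop (- s) \<eta> (g \<eta>) \<partial>lborel) = (\<integral>\<eta>. \<psi> \<eta> \<bullet> Eop (- s) \<eta> (u n s \<eta>) - \<psi> \<eta> \<bullet> Eop (- s) \<eta> (g \<eta>) \<partial>lborel)"
          unfolding U_def by (rule Bochner_Integration.integral_diff[OF i[OF uL] i[OF gL], symmetric])
        also have "\<dots> = (\<integral>\<eta>. Eop (- s) \<eta> (\<psi> \<eta>) \<bullet> (u n s \<eta> - g \<eta>) \<partial>lborel)"
          unfolding inner_diff_right adj ..
        finally show ?thesis using L2_bilinear(2)[OF bb EL L2_diff[OF uL gL], of n] by (simp add: l2_minus_commute[of g])
      qed
      have "(\<lambda>n. U n s - (\<integral>\<eta>. \<psi> \<eta> \<bullet> Eop (- s) \<eta> (g \<eta>) \<partial>lborel)) \<longlonglongrightarrow> 0"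
        by (rule Lim_null_comparison[OF always_eventually[OF allI[OF le]] tendsto_mult_right_zero[OF lim]])
      from LIM_zero_cancel[OF this] i[OF gL] show ?thesis by (rule conjI)
    qed
    note ct = conv[OF t gt] and c0 = conv[OF a0 g0]
    have le: "norm (U n t - U n 0) \<le> 2 * exp (a * K) * l2 \<psi> * (CARD('m) * (sqrt ((2 * pi) ^ CARD('m)) * (4 / Rn n * M))) * \<bar>t\<bar>" for n
      unfolding U_def u_def by (rule pairing_increment[OF F L \<psi>L \<psi>0 Rn t])
    have "(\<lambda>n. 4 / Rn n) \<longlonglongrightarrow> 0"
      by (rule tendsto_divide_0[OF tendsto_const filterlim_at_top_imp_at_infinity[OF Rlim]])
    then have "(\<lambda>n. 2 * exp (a * K) * l2 \<psi> * (CARD('m) * (sqrt ((2 * pi) ^ CARD('m)) * (4 / Rn n * M))) * \<bar>t\<bar>) \<longlonglongrightarrow> 0"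
      by (intro tendsto_mult_left_zero tendsto_mult_right_zero)
    from Lim_null_comparison[OF always_eventually[OF allI[OF le]] this]
    have l0: "(\<lambda>n. U n t - U n 0) \<longlonglongrightarrow> 0" .
    have l1: "(\<lambda>n. U n t - U n 0) \<longlonglongrightarrow> (\<integral>\<eta>. \<psi> \<eta> \<bullet> Eop (- t) \<eta> (gt \<eta>) \<partial>lborel) - (\<integral>\<eta>. \<psi> \<eta> \<bullet> Eop (- 0) \<eta> (g0 \<eta>) \<partial>lborel)"
      by (rule tendsto_diff[OF conjunct1[OF ct] conjunct1[OF c0]])
    have "(\<integral>\<eta>. \<psi> \<eta> \<bullet> Eop (- t) \<eta> (gt \<eta>) \<partial>lborel) - (\<integral>\<eta>. \<psi> \<eta> \<bullet> Eop (- 0) \<eta> (g0 \<eta>) \<partial>lborel) = 0"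
      by (rule LIMSEQ_unique[OF l1 l0])
    then have "(\<integral>\<eta>. \<psi> \<eta> \<bullet> Eop (- t) \<eta> (gt \<eta>) - \<psi> \<eta> \<bullet> Eop (- 0) \<eta> (g0 \<eta>) \<partial>lborel) = 0"
      by (simp only: Bochner_Integration.integral_diff[OF conjunct2[OF ct] conjunct2[OF c0]])
    moreover have "\<psi> \<eta> \<bullet> Eop (- t) \<eta> (gt \<eta>) - \<psi> \<eta> \<bullet> Eop (- 0) \<eta> (g0 \<eta>) = (norm (\<psi> \<eta>))\<^sup>2" for \<eta>
      by (simp add: \<psi>_def indicator_def power2_norm_eq_inner inner_diff_right)
    ultimately have "(l2 \<psi>)\<^sup>2 = 0" by (simp add: l2_power2)
    then show ?thesis using l2_zero_AE[OF \<psi>L] by (simp add: \<psi>_def[abs_def] K_def)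
  qed
  then have "AE \<eta> in lborel. \<forall>k::nat. indicator (cball 0 (real k)) \<eta> *\<^sub>R (Eop (- t) \<eta> (gt \<eta>) - g0 \<eta>) = 0"
    unfolding AE_all_countable by blast
  then show ?thesis
  proof eventually_elim
    fix \<eta> assume *: "\<forall>k::nat. indicator (cball 0 (real k)) \<eta> *\<^sub>R (Eop (- t) \<eta> (gt \<eta>) - g0 \<eta>) = 0"
    obtain k :: nat where "norm \<eta> \<le> real k" using real_arch_simple by blast
    with * have "Eop (- t) \<eta> (gt \<eta>) = g0 \<eta>" by (auto dest: spec[of _ k])
    then have "Eop t \<eta> (Eop (- t) \<eta> (gt \<eta>)) = Eop t \<eta> (g0 \<eta>)" by simp
    then show "gt \<eta> = Eop t \<eta> (g0 \<eta>)" by (simp add: Eop_add)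
  qed
qed

section \<open>Representation and uniqueness\<close>

text \<open>The second bound involves M but not a; this allows it to be used for all widths at once
  in the Liouville argument.\<close>

lemma H2_representation:
  fixes F :: "real \<times> ((real, 'm::{finite,linorder}) vec) \<Rightarrow> 'm clif"
  assumes a: "a > 0" and F: "left_monogenic (slab {-a<..<a}) F"
    and L: "\<And>s. \<bar>s\<bar> < a \<Longrightarrow> L2 (\<lambda>x. F (s, x))" "\<And>s. \<bar>s\<bar> < a \<Longrightarrow> l2 (\<lambda>x. F (s, x)) \<le> M"
    and g: "is_ft (\<lambda>x. F (0, x)) g"
  shows "L2 (\<lambda>\<xi>. exp (a * norm \<xi>) *\<^sub>R g \<xi>)"
    "l2 (\<lambda>\<xi>. exp (a * norm \<xi>) *\<^sub>R g \<xi>) \<le> sqrt 2 * (sqrt ((2 * pi) ^ CARD('m)) * M)"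
    "\<And>t y. \<bar>t\<bar> < a \<Longrightarrow> F (t, y) = cauchy_ext g (t, y)"
proof -
  define B where "B = sqrt ((2 * pi) ^ CARD('m)) * M"
  have gL: "L2 g" using g by (simp add: is_ft_def)
  note [measurable] = L2_measurable[OF gL]
  have M: "0 \<le> M" using L(2)[of 0] a order_trans[OF l2_nonneg] by auto
  have B: "0 \<le> B" using M by (simp add: B_def)
  have ex: "\<exists>h. is_ft (\<lambda>x. F (t, x)) h \<and> (AE \<eta> in lborel. h \<eta> = Eop t \<eta> (g \<eta>))" if t: "\<bar>t\<bar> < a" for t
  proof -
    obtain h where h: "is_ft (\<lambda>x. F (t, x)) h" by (rule is_ft_exists[OF L(1)[OF t]])
    then show ?thesis using spectral_evolution[OF F L t h g] by blast
  qed
  have E: "L2 (\<lambda>\<eta>. Eop t \<eta> (g \<eta>)) \<and> l2 (\<lambda>\<eta>. Eop t \<eta> (g \<eta>)) \<le> B" if t: "\<bar>t\<bar> < a" for t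
  proof -
    from ex[OF t] obtain h where h: "is_ft (\<lambda>x. F (t, x)) h" "AE \<eta> in lborel. h \<eta> = Eop t \<eta> (g \<eta>)" by blast
    have hL: "L2 h" using h by (simp add: is_ft_def)
    have m: "(\<lambda>\<eta>. Eop t \<eta> (g \<eta>)) \<in> borel_measurable borel" by (rule Eop_measurable) simp
    have AE': "AE \<eta> in lborel. Eop t \<eta> (g \<eta>) = h \<eta>" using h(2) by eventually_elim simp
    have "l2 (\<lambda>\<eta>. Eop t \<eta> (g \<eta>)) = l2 h" by (rule l2_cong_AE[OF AE' m L2_measurable[OF hL]])
    also have "\<dots> \<le> B"
      unfolding B_def by (rule order_trans[OF is_ft_l2_le[OF h(1)] mult_left_mono[OF L(2)[OF t]]]) simp
    finally show ?thesis using L2_cong_AE[OF AE' hL m] by simp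
  qed
  \<comment> \<open>Each of the heights t and - t contributes B^2, whence the factor sqrt 2.\<close>
  have le_t: "(\<integral>\<^sup>+\<xi>. ennreal ((norm (exp (t * norm \<xi>) *\<^sub>R g \<xi>))\<^sup>2) \<partial>lborel) \<le> ennreal ((sqrt 2 * B)\<^sup>2)" if t: "\<bar>t\<bar> < a" for t
  proof -
    have t': "\<bar>- t\<bar> < a" using t by simp
    note m = Eop_measurable[OF L2_measurable[OF gL]]
    have "(\<integral>\<^sup>+\<xi>. ennreal ((norm (exp (t * norm \<xi>) *\<^sub>R g \<xi>))\<^sup>2) \<partial>lborel)
      \<le> (\<integral>\<^sup>+\<xi>. ennreal ((norm (Eop t \<xi> (g \<xi>)))\<^sup>2) + ennreal ((norm (Eop (- t) \<xi> (g \<xi>)))\<^sup>2) \<partial>lborel)"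
    proof (rule nn_integral_mono)
      fix \<xi>
      have "(norm (exp (t * norm \<xi>) *\<^sub>R g \<xi>))\<^sup>2 = exp (2 * t * norm \<xi>) * (norm (g \<xi>))\<^sup>2"
        by (simp add: power_mult_distrib exp_double[symmetric] mult.assoc)
      then show "ennreal ((norm (exp (t * norm \<xi>) *\<^sub>R g \<xi>))\<^sup>2) \<le> ennreal ((norm (Eop t \<xi> (g \<xi>)))\<^sup>2) + ennreal ((norm (Eop (- t) \<xi> (g \<xi>)))\<^sup>2)"
        using Eop_norm_lower[of t \<xi> "g \<xi>"] by (subst ennreal_plus[symmetric]) (auto intro!: ennreal_leI simp del: ennreal_plus)
    qed
    also have "\<dots> = ennreal ((l2 (\<lambda>\<xi>. Eop t \<xi> (g \<xi>)))\<^sup>2) + ennreal ((l2 (\<lambda>\<xi>. Eop (- t) \<xi> (g \<xi>)))\<^sup>2)"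
      using m[of t] m[of "- t"] by (subst nn_integral_add) (auto simp: nn_integral_L2[OF conjunct1[OF E[OF t]]] nn_integral_L2[OF conjunct1[OF E[OF t']]])
    also have "\<dots> \<le> ennreal (B\<^sup>2) + ennreal (B\<^sup>2)"
      using E[OF t] E[OF t'] by (intro add_mono ennreal_leI power_mono) auto
    also have "\<dots> = ennreal ((sqrt 2 * B)\<^sup>2)"
      by (subst ennreal_plus[symmetric]) (auto simp: power_mult_distrib simp del: ennreal_plus)
    finally show ?thesis .
  qed
  \<comment> \<open>The height a lies outside the open strip, so it is approached from inside and
    the bound is carried over by Fatou.\<close>
  define tn where "tn n = a * (1 - 1 / real (Suc n))" for n
  have tn: "\<bar>tn n\<bar> < a" for n
  proof -
    have "0 \<le> 1 - 1 / real (Suc n)" "1 - 1 / real (Suc n) < 1" by (auto simp: field_simps)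
    then show ?thesis using a unfolding tn_def by (simp add: abs_mult del: of_nat_Suc)
  qed
  have tlim: "tn \<longlonglongrightarrow> a"
  proof -
    have "(\<lambda>n. a * (1 - 1 / real (Suc n))) \<longlonglongrightarrow> a * (1 - 0)"
      by (intro tendsto_intros LIMSEQ_Suc[OF lim_inverse_n'])
    then show ?thesis by (simp add: tn_def[abs_def])
  qed
  have "(\<integral>\<^sup>+\<xi>. ennreal ((norm (exp (a * norm \<xi>) *\<^sub>R g \<xi>))\<^sup>2) \<partial>lborel)
    = (\<integral>\<^sup>+\<xi>. liminf (\<lambda>n. ennreal ((norm (exp (tn n * norm \<xi>) *\<^sub>R g \<xi>))\<^sup>2)) \<partial>lborel)"
  proof (rule nn_integral_cong)
    fix \<xi>
    have "(\<lambda>n. ennreal ((norm (exp (tn n * norm \<xi>) *\<^sub>R g \<xi>))\<^sup>2)) \<longlonglongrightarrow> ennreal ((norm (exp (a * norm \<xi>) *\<^sub>R g \<xi>))\<^sup>2)"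
      by (intro tendsto_ennrealI tendsto_intros tlim)
    from lim_imp_Liminf[OF trivial_limit_sequentially this]
    show "ennreal ((norm (exp (a * norm \<xi>) *\<^sub>R g \<xi>))\<^sup>2) = liminf (\<lambda>n. ennreal ((norm (exp (tn n * norm \<xi>) *\<^sub>R g \<xi>))\<^sup>2))" by simp
  qed
  also have "\<dots> \<le> liminf (\<lambda>n. \<integral>\<^sup>+\<xi>. ennreal ((norm (exp (tn n * norm \<xi>) *\<^sub>R g \<xi>))\<^sup>2) \<partial>lborel)"
    by (rule nn_integral_liminf) measurable
  also have "\<dots> \<le> liminf (\<lambda>n. ennreal ((sqrt 2 * B)\<^sup>2))"
    by (intro Liminf_mono always_eventually allI le_t tn)
  also have "\<dots> = ennreal ((sqrt 2 * B)\<^sup>2)" by (simp add: Liminf_const)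
  finally have fin: "(\<integral>\<^sup>+\<xi>. ennreal ((norm (exp (a * norm \<xi>) *\<^sub>R g \<xi>))\<^sup>2) \<partial>lborel) \<le> ennreal ((sqrt 2 * B)\<^sup>2)" .
  show W: "L2 (\<lambda>\<xi>. exp (a * norm \<xi>) *\<^sub>R g \<xi>)"
    by (rule L2I_nn(1)[OF _ fin]) (use B in auto)
  show "l2 (\<lambda>\<xi>. exp (a * norm \<xi>) *\<^sub>R g \<xi>) \<le> sqrt 2 * (sqrt ((2 * pi) ^ CARD('m)) * M)"
    unfolding B_def[symmetric] by (rule L2I_nn(2)[OF _ fin]) (use B in auto)
  show "F (t, y) = cauchy_ext g (t, y)" if t: "\<bar>t\<bar> < a" for t y
  proof -
    from ex[OF t] obtain h where h: "is_ft (\<lambda>x. F (t, x)) h" "AE \<eta> in lborel. h \<eta> = Eop t \<eta> (g \<eta>)" by blast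
    have hm[measurable]: "h \<in> borel_measurable borel" using h(1) by (auto simp: is_ft_def dest: L2_measurable)
    have Em[measurable]: "(\<lambda>\<eta>. Eop t \<eta> (g \<eta>)) \<in> borel_measurable borel" by (rule Eop_measurable) simp
    \<comment> \<open>The gap between |t| and a turns the L2 weight into integrability, as pointwise
      inversion requires.\<close>
    have "integrable lborel (\<lambda>\<eta>. Eop t \<eta> (g \<eta>))"
    proof (rule Bochner_Integration.integrable_bound)
      show "integrable lborel (\<lambda>\<eta>. 2 * norm (exp (\<bar>t\<bar> * norm \<eta>) *\<^sub>R g \<eta>))"
        by (intro integrable_mult_right integrable_norm weighted_integrable[OF W t])
      show "AE \<eta> in lborel. norm (Eop t \<eta> (g \<eta>)) \<le> norm (2 * norm (exp (\<bar>t\<bar> * norm \<eta>) *\<^sub>R g \<eta>))"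
        using norm_Eop_le[of t] by (auto simp: mult.assoc)
    qed simp
    then have hi: "integrable lborel h" using h(2) by (subst integrable_cong_AE[OF _ _ h(2)]) auto
    have "isCont (\<lambda>x. F (t, x)) y"
      using left_monogenic_slice(1)[OF F, of t] t by (auto simp: continuous_on_eq_continuous_at abs_less_iff)
    from cft_inversion[OF L(1)[OF t] this h(1) hi]
    have "F (t, y) = (1 / (2 * pi) ^ CARD('m)) *\<^sub>R cft 1 h y" .
    also have "cft 1 h y = cft 1 (\<lambda>\<eta>. Eop t \<eta> (g \<eta>)) y"
      unfolding cft_def by (rule integral_cong_AE) (use h(2) in auto)
    finally show ?thesis by (simp add: cauchy_ext_slice)
  qed
qed

text \<open>Off the ball of radius e the weight is at least exp(b e), so the L2 norm of g there is
  at most exp(- b e) C for every b. Letting e shrink leaves only the origin, a null set.\<close>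

lemma weighted_bounded_imp_zero:
  fixes g :: "'a::euclidean_space \<Rightarrow> 'b::euclidean_space"
  assumes L: "\<And>b. b > 0 \<Longrightarrow> L2 (\<lambda>\<xi>. exp (b * norm \<xi>) *\<^sub>R g \<xi>)"
    and C: "\<And>b. b > 0 \<Longrightarrow> l2 (\<lambda>\<xi>. exp (b * norm \<xi>) *\<^sub>R g \<xi>) \<le> C"
  shows "AE \<xi> in lborel. g \<xi> = 0"
proof -
  have [measurable]: "g \<in> borel_measurable borel" by (rule weighted_measurable[OF L[of 1]]) simp
  have "AE \<xi> in lborel. indicator {\<xi>. 1 / real (Suc k) \<le> norm \<xi>} \<xi> *\<^sub>R g \<xi> = 0" for k
  proof -
    define e where "e = 1 / real (Suc k)"
    have e: "e > 0" by (simp add: e_def)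
    define h where "h \<xi> = indicator {\<xi>. e \<le> norm \<xi>} \<xi> *\<^sub>R g \<xi>" for \<xi>
    have hm: "h \<in> borel_measurable borel"
      unfolding h_def by (intro borel_measurable_scaleR borel_measurable_indicator) auto
    have AE: "AE \<xi> in lborel. norm (h \<xi>) \<le> exp (- (b * e)) * norm (exp (b * norm \<xi>) *\<^sub>R g \<xi>)" if "b > 0" for b
    proof (rule AE_I2)
      fix \<xi> show "norm (h \<xi>) \<le> exp (- (b * e)) * norm (exp (b * norm \<xi>) *\<^sub>R g \<xi>)"
      proof (cases "e \<le> norm \<xi>")
        case True
        then have "b * e \<le> b * norm \<xi>" using that by simp
        then have "1 \<le> exp (- (b * e) + b * norm \<xi>)" by simp
        then have "1 * norm (g \<xi>) \<le> exp (- (b * e) + b * norm \<xi>) * norm (g \<xi>)" by (intro mult_right_mono) auto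
        then show ?thesis using True by (simp add: h_def mult_exp_exp mult.assoc[symmetric])
      qed (simp add: h_def)
    qed
    have hL: "L2 h" by (rule L2_bound(1)[OF L[of 1] hm AE]) auto
    have le: "l2 h \<le> exp (- (real (Suc n) * e)) * C" for n
    proof -
      have "l2 h \<le> exp (- (real (Suc n) * e)) * l2 (\<lambda>\<xi>. exp (real (Suc n) * norm \<xi>) *\<^sub>R g \<xi>)"
        by (rule L2_bound(2)[OF L hm AE]) auto
      also have "\<dots> \<le> exp (- (real (Suc n) * e)) * C" by (intro mult_left_mono C) auto
      finally show ?thesis .
    qed
    have "(\<lambda>n. (1 * real (Suc n)) ^ 0 * exp (- e * real (Suc n)) * C) \<longlonglongrightarrow> 0 * C"
      by (intro tendsto_mult power_times_exp_neg_tendsto[OF e] tendsto_const)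
    then have "(\<lambda>n. exp (- (real (Suc n) * e)) * C) \<longlonglongrightarrow> 0"
      by (simp add: mult.commute del: of_nat_Suc)
    then have "l2 h \<le> 0" by (rule LIMSEQ_le_const) (use le in auto)
    from l2_zero_AE[OF hL this] show ?thesis by (simp add: h_def e_def)
  qed
  then have "AE \<xi> in lborel. \<forall>k. indicator {\<xi>. 1 / real (Suc k) \<le> norm \<xi>} \<xi> *\<^sub>R g \<xi> = 0"
    unfolding AE_all_countable by blast
  moreover have "AE \<xi>::'a in lborel. \<xi> \<noteq> 0" by (rule AE_lborel_singleton)
  ultimately show ?thesis
  proof eventually_elim
    fix \<xi> :: 'a assume *: "\<forall>k. indicator {\<xi>. 1 / real (Suc k) \<le> norm \<xi>} \<xi> *\<^sub>R g \<xi> = 0" and "\<xi> \<noteq> 0"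
    then obtain k where "1 / real (Suc k) < norm \<xi>" using nat_approx_posE[of "norm \<xi>"] by auto
    then show "g \<xi> = 0" using spec[OF *, of k] by simp
  qed
qed

text \<open>A Liouville-type theorem; it makes the two summands of the decomposition independent.\<close>
lemma entire_H2_eq_0:
  fixes G :: "real \<times> ((real, 'm::{finite,linorder}) vec) \<Rightarrow> 'm clif"
  assumes "left_monogenic (slab UNIV) G" "\<And>s. L2 (\<lambda>x. G (s, x))" "\<And>s. l2 (\<lambda>x. G (s, x)) \<le> M"
  shows "G x = 0"
proof -
  obtain g where g: "is_ft (\<lambda>x. G (0, x)) g" by (rule is_ft_exists[OF assms(2)])
  have mono: "left_monogenic (slab {-b<..<b}) G" for b
    by (rule left_monogenic_subset[OF assms(1) open_slab]) (auto simp: slab_def)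
  have gz: "AE \<xi> in lborel. g \<xi> = 0"
    by (rule weighted_bounded_imp_zero[OF H2_representation(1,2)[OF _ mono assms(2,3) g]]) auto
  have gm: "g \<in> borel_measurable borel" using g by (auto simp: is_ft_def dest: L2_measurable)
  obtain t y where x: "x = (t, y)" by (cases x)
  have "G (t, y) = cauchy_ext g (t, y)"
    by (rule H2_representation(3)[OF _ mono assms(2,3) g, of "\<bar>t\<bar> + 1"]) auto
  also have "\<dots> = 0"
  proof -
    have "cft 1 (\<lambda>\<xi>. Eop t \<xi> (g \<xi>)) y = 0"
      unfolding cft_def
    proof (rule integral_eq_zero_AE, use gz in eventually_elim)
      fix \<xi> assume "g \<xi> = 0"
      then show "cscale (cis (1 * (\<xi> \<bullet> y))) (Eop t \<xi> (g \<xi>)) = 0"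
        by (simp add: linear_0[OF linear_Eop] bounded_bilinear.zero_right[OF bounded_bilinear_cscale])
    qed
    then show ?thesis by (simp add: cauchy_ext_slice)
  qed
  finally show ?thesis by (simp add: x)
qed

text \<open>Agreement on the strip lets p and q be glued to a function monogenic everywhere whose
  slices are uniformly bounded in L2; such a function vanishes.\<close>

lemma H2_decomposition_unique:
  fixes p q :: "real \<times> ((real, 'm::{finite,linorder}) vec) \<Rightarrow> 'm clif"
  assumes a: "a > 0" and p: "H2 (halfplus a) p" and q: "H2 (halfminus a) q"
    and eq: "\<And>x. x \<in> strip a \<Longrightarrow> p x = q x"
  shows "(\<forall>x\<in>halfplus a. p x = 0) \<and> (\<forall>x\<in>halfminus a. q x = 0)"
proof -
  define G where "G x = (if fst x > - a then p x else q x)" for x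
  have Gp: "G x = p x" if "x \<in> halfplus a" for x using that by (simp add: G_def halfplus_def)
  have Gq: "G x = q x" if "x \<in> halfminus a" for x
    using that eq[of x] by (auto simp: G_def halfminus_def strip_def)
  have "left_monogenic (halfplus a \<union> halfminus a) G"
    by (rule left_monogenic_Un; rule left_monogenic_cong) (use p q Gp Gq in \<open>auto simp: H2_def\<close>)
  moreover have "halfplus a \<union> halfminus a = (slab UNIV :: (real \<times> ((real, 'm) vec)) set)"
    using a by (auto simp: halfplus_def halfminus_def slab_def)
  ultimately have G: "left_monogenic (slab UNIV) G" by simp
  have ne: "{-a<..} \<noteq> {}" "{..<a} \<noteq> {}" by auto
  from p obtain C where C: "\<And>t. t > - a \<Longrightarrow> L2 (\<lambda>y. p (t, y))" "\<And>t. t > - a \<Longrightarrow> l2 (\<lambda>y. p (t, y)) \<le> C"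
    unfolding halfplus_slab H2_slab_iff[OF ne(1)] by auto
  from q obtain C' where C': "\<And>t. t < a \<Longrightarrow> L2 (\<lambda>y. q (t, y))" "\<And>t. t < a \<Longrightarrow> l2 (\<lambda>y. q (t, y)) \<le> C'"
    unfolding halfminus_slab H2_slab_iff[OF ne(2)] by auto
  have "L2 (\<lambda>y. G (s, y)) \<and> l2 (\<lambda>y. G (s, y)) \<le> max C C'" for s
    using C[of s] C'[of s] a by (cases "s > - a") (auto simp: G_def)
  then have "G x = 0" for x by (intro entire_H2_eq_0[OF G]) auto
  then show ?thesis using Gp Gq by metis
qed

text \<open>Here g is any coefficient function representing f. It is compared with the L2 transform
  g' of the central slice of its own extension: both are integrable and have the same inverse
  transform, so they agree almost everywhere.\<close>

lemma cauchy_ext_fourier: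
  fixes f :: "(real, 'm::{finite,linorder}) vec \<Rightarrow> 'm clif"
  assumes a: "a > 0" and f: "L2 f" and g: "L2 (\<lambda>\<xi>. exp (a * norm \<xi>) *\<^sub>R g \<xi>)"
    and fg: "AE x in lborel. f x = cauchy_ext g (0, x)"
  shows "is_fourier_L2 f g"
proof -
  define F where "F = cauchy_ext g"
  have ne: "{-a<..<a} \<noteq> {}" using a by simp
  have gm[measurable]: "g \<in> borel_measurable borel" by (rule weighted_measurable[OF g])
  have gL: "L2 g"
    using weighted_mono(1)[OF g, of 0 g 1] a by simp
  have gi: "integrable lborel g" using weighted_integrable[OF g, of 0] a by simp
  have H: "H2 (slab {-a<..<a}) F" using cauchy_ext_H2[OF a g] by (simp add: F_def strip_slab)
  then obtain M where F: "left_monogenic (slab {-a<..<a}) F"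
    and L: "\<And>s. \<bar>s\<bar> < a \<Longrightarrow> L2 (\<lambda>x. F (s, x))" "\<And>s. \<bar>s\<bar> < a \<Longrightarrow> l2 (\<lambda>x. F (s, x)) \<le> M"
    unfolding H2_slab_iff[OF ne] by (metis abs_less_iff greaterThanLessThan_iff minus_less_iff)
  have L0: "L2 (\<lambda>x. F (0, x))" using L(1)[of 0] a by simp
  obtain g' where g': "is_ft (\<lambda>x. F (0, x)) g'" by (rule is_ft_exists[OF L0])
  note R = H2_representation[OF a F L g']
  have g'm[measurable]: "g' \<in> borel_measurable borel" by (rule weighted_measurable[OF R(1)])
  have g'i: "integrable lborel g'" using weighted_integrable[OF R(1), of 0] a by simp
  have "cft 1 (\<lambda>\<xi>. g \<xi> - g' \<xi>) y = 0" for y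
  proof -
    have "cauchy_ext g (0, y) = cauchy_ext g' (0, y)" using R(3)[of 0 y] a by (simp add: F_def)
    then have "cft 1 g y = cft 1 g' y" by (simp add: cauchy_ext_slice)
    then show ?thesis by (simp add: cft_diff[OF gi g'i])
  qed
  from cft_unique[OF Bochner_Integration.integrable_diff[OF gi g'i] this]
  have gg': "AE \<xi> in lborel. g \<xi> = g' \<xi>" by simp
  define p where "p R x = indicator (cball 0 R) x *\<^sub>R F (0, x)" for R x
  have p: "integrable lborel (p R)" "L2 (p R)" for R unfolding p_def by (rule L2_indicator[OF L0])+
  have lim: "((\<lambda>R. l2 (\<lambda>\<xi>. g' \<xi> - cft (-1) (p R) \<xi>)) \<longlongrightarrow> 0) at_top"
    by (rule is_ft_tendsto[OF g' p]) (use L2_indicator(3)[OF L0] in \<open>simp add: p_def\<close>)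
  have pm: "cft (-1) (p R) \<in> borel_measurable borel" for R
    by (rule cft_measurable[OF L2_measurable[OF p(2)]])
  \<comment> \<open>f equals the central slice only almost everywhere, which the truncated integrals
    do not see.\<close>
  have trunc: "fourier_trunc f R \<xi> = cft (-1) (p R) \<xi>" for R \<xi>
    unfolding fourier_trunc_def cft_def
  proof (rule integral_cong_AE)
    note [measurable] = L2_measurable[OF f] L2_measurable[OF p(2)]
    show "(\<lambda>x. indicator (cball 0 R) x *\<^sub>R cscale (exp (- \<i> * complex_of_real (x \<bullet> \<xi>))) (f x)) \<in> borel_measurable lborel"
      unfolding measurable_lborel2 by (intro borel_measurable_scaleR borel_measurable_indicator) auto
    show "(\<lambda>x. cscale (cis (- 1 * (x \<bullet> \<xi>))) (p R x)) \<in> borel_measurable lborel" by measurable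
    show "AE x in lborel. indicator (cball 0 R) x *\<^sub>R cscale (exp (- \<i> * complex_of_real (x \<bullet> \<xi>))) (f x) = cscale (cis (- 1 * (x \<bullet> \<xi>))) (p R x)"
      using fg by eventually_elim (simp add: p_def F_def cis_conv_exp cscale_scaleR_right)
  qed
  have "(\<integral>\<^sup>+\<xi>. ennreal ((norm (g \<xi> - fourier_trunc f R \<xi>))\<^sup>2) \<partial>lborel) = ennreal ((l2 (\<lambda>\<xi>. g' \<xi> - cft (-1) (p R) \<xi>))\<^sup>2)" for R
  proof -
    have pL: "L2 (cft (-1) (p R))" by (rule cft_plancherel_le(1)[OF _ p]) simp
    have "l2 (\<lambda>\<xi>. g' \<xi> - cft (-1) (p R) \<xi>) = l2 (\<lambda>\<xi>. g \<xi> - cft (-1) (p R) \<xi>)"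
      using gg' pm[of R] by (intro l2_cong_AE) auto
    then show ?thesis by (simp add: trunc nn_integral_L2[OF L2_diff[OF gL pL]])
  qed
  moreover have "((\<lambda>R. ennreal ((l2 (\<lambda>\<xi>. g' \<xi> - cft (-1) (p R) \<xi>))\<^sup>2)) \<longlongrightarrow> ennreal (0\<^sup>2)) at_top"
    by (intro tendsto_ennrealI tendsto_power lim)
  ultimately show ?thesis using gL by (simp add: is_fourier_L2_def L2fun_iff_L2)
qed

lemma H2_strip_imp_cauchy_ext:
  fixes F :: "real \<times> ((real, 'm::{finite,linorder}) vec) \<Rightarrow> 'm clif"
  assumes a: "a > 0" and F: "H2 (strip a) F"
  obtains g where "g \<in> borel_measurable borel" "L2 (\<lambda>\<xi>. exp (a * norm \<xi>) *\<^sub>R g \<xi>)"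
    "\<And>x. x \<in> strip a \<Longrightarrow> F x = cauchy_ext g x"
proof -
  have ne: "{-a<..<a} \<noteq> {}" using a by simp
  from F obtain M where m: "left_monogenic (slab {-a<..<a}) F"
    and L: "\<And>s. \<bar>s\<bar> < a \<Longrightarrow> L2 (\<lambda>x. F (s, x))" "\<And>s. \<bar>s\<bar> < a \<Longrightarrow> l2 (\<lambda>x. F (s, x)) \<le> M"
    unfolding strip_slab H2_slab_iff[OF ne] by (metis abs_less_iff greaterThanLessThan_iff minus_less_iff)
  obtain g where g: "is_ft (\<lambda>x. F (0, x)) g" by (rule is_ft_exists[OF L(1)[of 0]]) (use a in simp)
  note R = H2_representation[OF a m L g]
  show thesis
  proof (rule that[OF weighted_measurable[OF R(1)] R(1)])
    fix x :: "real \<times> (real, 'm) vec" assume "x \<in> strip a"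
    then show "F x = cauchy_ext g x" using R(3)[of "fst x" "snd x"] by (simp add: strip_def)
  qed
qed

text \<open>An L2 function f is determined only up to null sets, so restriction to the central slice
  is equality almost everywhere, while the extension formula holds at every point of the strip. The
  direct sum is expressed by the last three clauses: existence of a decomposition, its uniqueness on
  the full half spaces, and membership of every sum in the space of the strip.\<close>

theorem theorem3p2:
  fixes f :: "(real, 'm::{finite,linorder}) vec \<Rightarrow> 'm clif" and a :: real
  assumes "a > 0" and "L2fun f"
  shows "((\<exists>F. H2 (strip a) F \<and> (AE x in lborel. f x = F (0, x))) \<longleftrightarrow>
           (\<exists>g. g \<in> borel_measurable lborel \<and> L2fun (\<lambda>\<xi>. exp (a * norm \<xi>) *\<^sub>R g \<xi>) \<and>
                (AE x in lborel. f x = cauchy_ext g (0, x))))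
       \<and> (\<forall>F. H2 (strip a) F \<and> (AE x in lborel. f x = F (0, x)) \<longrightarrow>
           (\<exists>g. g \<in> borel_measurable lborel \<and> L2fun (\<lambda>\<xi>. exp (a * norm \<xi>) *\<^sub>R g \<xi>) \<and>
                (\<forall>x\<in>strip a. F x = cauchy_ext g x)))
       \<and> (\<forall>g. g \<in> borel_measurable lborel \<and> L2fun (\<lambda>\<xi>. exp (a * norm \<xi>) *\<^sub>R g \<xi>) \<and>
                (AE x in lborel. f x = cauchy_ext g (0, x)) \<longrightarrow> is_fourier_L2 f g)
       \<and> (\<forall>F::real \<times> (real, 'm) vec \<Rightarrow> 'm clif. H2 (strip a) F \<longrightarrow>
           (\<exists>fp fm. H2 (halfplus a) fp \<and> H2 (halfminus a) fm \<and>
                    (\<forall>x\<in>strip a. F x = fp x + fm x)))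
       \<and> (\<forall>(F::real \<times> (real, 'm) vec \<Rightarrow> 'm clif) fp fm fp' fm'. H2 (strip a) F \<and>
             H2 (halfplus a) fp \<and> H2 (halfminus a) fm \<and> (\<forall>x\<in>strip a. F x = fp x + fm x) \<and>
             H2 (halfplus a) fp' \<and> H2 (halfminus a) fm' \<and> (\<forall>x\<in>strip a. F x = fp' x + fm' x) \<longrightarrow>
             (\<forall>x\<in>halfplus a. fp x = fp' x) \<and> (\<forall>x\<in>halfminus a. fm x = fm' x))
       \<and> (\<forall>(fp::real \<times> (real, 'm) vec \<Rightarrow> 'm clif) fm. H2 (halfplus a) fp \<and> H2 (halfminus a) fm \<longrightarrow>
             H2 (strip a) (\<lambda>x. fp x + fm x))"
proof (intro conjI allI impI ballI)
  have fL: "L2 f" using assms(2) by (simp add: L2fun_iff_L2)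
  have a: "a > 0" by fact
  have fwd: "\<exists>g. g \<in> borel_measurable lborel \<and> L2fun (\<lambda>\<xi>. exp (a * norm \<xi>) *\<^sub>R g \<xi>) \<and> (\<forall>x\<in>strip a. F x = cauchy_ext g x)"
    if "H2 (strip a) F" for F :: "real \<times> (real, 'm) vec \<Rightarrow> 'm clif"
    by (rule H2_strip_imp_cauchy_ext[OF a that]) (auto simp: L2fun_iff_L2)
  show "(\<exists>F. H2 (strip a) F \<and> (AE x in lborel. f x = F (0, x))) \<longleftrightarrow>
      (\<exists>g. g \<in> borel_measurable lborel \<and> L2fun (\<lambda>\<xi>. exp (a * norm \<xi>) *\<^sub>R g \<xi>) \<and>
        (AE x in lborel. f x = cauchy_ext g (0, x)))" (is "?L \<longleftrightarrow> ?R")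
  proof
    assume ?L
    then obtain F where F: "H2 (strip a) F" "AE x in lborel. f x = F (0, x)" by blast
    from fwd[OF F(1)] obtain g where g: "g \<in> borel_measurable lborel" "L2fun (\<lambda>\<xi>. exp (a * norm \<xi>) *\<^sub>R g \<xi>)"
      "\<forall>x\<in>strip a. F x = cauchy_ext g x" by blast
    have "F (0, x) = cauchy_ext g (0, x)" for x using g(3) a by (simp add: strip_def)
    then show ?R using F(2) g(1,2) by auto
  next
    assume ?R
    then show ?L using cauchy_ext_H2[OF a] by (auto simp: L2fun_iff_L2)
  qed
  show "\<exists>g. g \<in> borel_measurable lborel \<and> L2fun (\<lambda>\<xi>. exp (a * norm \<xi>) *\<^sub>R g \<xi>) \<and> (\<forall>x\<in>strip a. F x = cauchy_ext g x)"
    if "H2 (strip a) F \<and> (AE x in lborel. f x = F (0, x))" for F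
    using fwd that by blast
  show "is_fourier_L2 f g"
    if "g \<in> borel_measurable lborel \<and> L2fun (\<lambda>\<xi>. exp (a * norm \<xi>) *\<^sub>R g \<xi>) \<and> (AE x in lborel. f x = cauchy_ext g (0, x))" for g
    using that by (intro cauchy_ext_fourier[OF a fL]) (auto simp: L2fun_iff_L2)
  show "\<exists>fp fm. H2 (halfplus a) fp \<and> H2 (halfminus a) fm \<and> (\<forall>x\<in>strip a. F x = fp x + fm x)"
    if F: "H2 (strip a) F" for F :: "real \<times> (real, 'm) vec \<Rightarrow> 'm clif"
  proof -
    from fwd[OF F] obtain g where g: "L2 (\<lambda>\<xi>. exp (a * norm \<xi>) *\<^sub>R g \<xi>)" "\<forall>x\<in>strip a. F x = cauchy_ext g x"
      by (auto simp: L2fun_iff_L2)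
    show ?thesis
      using fplus_H2[OF g(1)] fminus_H2[OF g(1)] cauchy_ext_split[OF g(1)] g(2)
      by (intro exI[of _ "fplus g"] exI[of _ "fminus g"]) auto
  qed
  show "H2 (strip a) (\<lambda>x. fp x + fm x)" if "H2 (halfplus a) fp \<and> H2 (halfminus a) fm"
    for fp fm :: "real \<times> (real, 'm) vec \<Rightarrow> 'm clif"
  proof -
    have ne: "{-a<..<a} \<noteq> {}" using a by simp
    have "H2 (slab {-a<..}) fp" "H2 (slab {..<a}) fm" using that by (simp_all add: halfplus_slab halfminus_slab)
    then have "H2 (slab {-a<..<a}) fp" "H2 (slab {-a<..<a}) fm" by (auto elim!: H2_slab_subset)
    then show ?thesis unfolding strip_slab by (rule H2_slab_add[OF ne])
  qed
  have uniq: "(\<forall>x\<in>halfplus a. fp x = fp' x) \<and> (\<forall>x\<in>halfminus a. fm x = fm' x)"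
    if "H2 (strip a) F \<and> H2 (halfplus a) fp \<and> H2 (halfminus a) fm \<and> (\<forall>x\<in>strip a. F x = fp x + fm x) \<and>
      H2 (halfplus a) fp' \<and> H2 (halfminus a) fm' \<and> (\<forall>x\<in>strip a. F x = fp' x + fm' x)"
    for F fp fm fp' fm' :: "real \<times> (real, 'm) vec \<Rightarrow> 'm clif"
  proof -
    from that have H: "H2 (halfplus a) fp" "H2 (halfplus a) fp'" "H2 (halfminus a) fm" "H2 (halfminus a) fm'"
      and e: "\<forall>x\<in>strip a. F x = fp x + fm x" "\<forall>x\<in>strip a. F x = fp' x + fm' x" by blast+
    have ne: "{-a<..} \<noteq> {}" "{..<a} \<noteq> {}" by auto
    have p: "H2 (halfplus a) (\<lambda>x. fp x - fp' x)"
      using H(1,2) unfolding halfplus_slab by (rule H2_slab_diff[OF ne(1)])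
    \<comment> \<open>The difference is taken in the opposite order, so that the two differences
      coincide on the strip.\<close>
    have q: "H2 (halfminus a) (\<lambda>x. fm' x - fm x)"
      using H(4,3) unfolding halfminus_slab by (rule H2_slab_diff[OF ne(2)])
    have pq: "fp x - fp' x = fm' x - fm x" if "x \<in> strip a" for x
      using bspec[OF e(1) that] bspec[OF e(2) that] by (simp add: algebra_simps)
    show ?thesis using H2_decomposition_unique[OF a p q pq] by auto
  qed
  show "fp x = fp' x" if "H2 (strip a) F \<and> H2 (halfplus a) fp \<and> H2 (halfminus a) fm \<and> (\<forall>x\<in>strip a. F x = fp x + fm x) \<and>
      H2 (halfplus a) fp' \<and> H2 (halfminus a) fm' \<and> (\<forall>x\<in>strip a. F x = fp' x + fm' x)" "x \<in> halfplus a"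
    for F fp fm fp' fm' :: "real \<times> (real, 'm) vec \<Rightarrow> 'm clif" and x
    using uniq[OF that(1)] that(2) by blast
  show "fm x = fm' x" if "H2 (strip a) F \<and> H2 (halfplus a) fp \<and> H2 (halfminus a) fm \<and> (\<forall>x\<in>strip a. F x = fp x + fm x) \<and>
      H2 (halfplus a) fp' \<and> H2 (halfminus a) fm' \<and> (\<forall>x\<in>strip a. F x = fp' x + fm' x)" "x \<in> halfminus a"
    for F fp fm fp' fm' :: "real \<times> (real, 'm) vec \<Rightarrow> 'm clif" and x
    using uniq[OF that(1)] that(2) by blast
qed

end
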